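(* Let $0<\alpha<1$ and $\varepsilon>0$. The interval $CI_{m,\alpha}$ (constructed in the context) is a $(1-\alpha)$-level confidence interval for the minimum, i.e. $\mathbb P_f(M(f)\in CI_{m,\alpha})\ge1-\alpha$ for all $f\in\mathcal F$. Moreover, when $0<\alpha<0.3$, its expected length satisfies $$\mathbb E_fL(CI_{m,\alpha})\le c_{m,\alpha}\,\rho_m(\varepsilon;f)\le C_{m,\alpha}\,L_{m,\alpha}(\varepsilon;f)\qquad\text{for all } f\in\mathcal F,$$ where $c_{m,\alpha}$ and $C_{m,\alpha}$ are constants depending on $\alpha$ only.
   Context: $\Phi$ is the standard normal cdf and $z_\beta=\Phi^{-1}(1-\beta)$. $\mathcal F$ is the collection of convex functions $f:[0,1]\to\mathbb R$ with a unique minimizer $Z(f)=\arg\min_{0\le t\le1}f(t)$; $M(f)=f(Z(f))$. One observes the white noise model $dY(t)=f(t)\,dt+\varepsilon\,dW(t)$, $0\le t\le1$, $W$ a standard Brownian motion, $\varepsilon>0$; $\mathbb P_f,\mathbb E_f$ are probability and expectation under drift $f$ (including auxiliary randomness). $L(CI)$ is the length of an interval $CI$. Benchmark: $L_{m,\alpha}(\varepsilon;f)=\sup_{g\in\mathcal F}\inf_{CI\in\mathcal I_{m,\alpha}(\{f,g\})}\mathbb E_fL(CI)$, where $\mathcal I_{m,\alpha}(\{f,g\})$ is the collection of confidence intervals based on $Y$ that contain $M(h)$ with probability at least $1-\alpha$ under drift $h$, for both $h=f$ and $h=g$. Geometric quantity: with $f_u(t)=\max\{f(t),u\}$ and $\|\cdot\|_2$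 the $L_2[0,1]$ norm, $\rho_m(\varepsilon;f)=\sup\{u-M(f):\|f-f_u\|_2\le\varepsilon\}$. Construction of $CI_{m,\alpha}$. Sample splitting: let $B_1,B_2$ be independent standard Brownian motions, independent of $Y$, and set $Y_l=Y+\frac{\sqrt2}{2}\varepsilon B_1+\frac{\sqrt6}{2}\varepsilon B_2$, $Y_s=Y+\frac{\sqrt2}{2}\varepsilon B_1-\frac{\sqrt6}{2}\varepsilon B_2$, $Y_e=Y-\sqrt2\,\varepsilon B_1$. Localization: $m_j=2^{-j}$, $t_{j,i}=i\,m_j$. For $j\ge0$, $1\le i\le2^j$ let $X_{j,i}=\int_{t_{j,i-1}}^{t_{j,i}}dY_l(t)$, $\tilde X_{j,i}=\int_{t_{j,i-1}}^{t_{j,i}}dY_s(t)$ and $\bar X_{j,i}=\int_{t_{j,i-1}}^{t_{j,i}}dY_e(t)$; for integers $i\notin\{1,\dots,2^j\}$ set $X_{j,i}=\tilde X_{j,i}=\bar X_{j,i}=+\infty$. Let $\hat i_0=1$ and, for $j\ge1$, $\hat i_j=\arg\min_{2\hat i_{j-1}-2\le i\le2\hat i_{j-1}+1}X_{j,i}$. Stopping: $T_j=\min\{\tilde X_{j,\hat i_j+6}-\tilde X_{j,\hat i_j+5},\ \tilde X_{j,\hat i_j-6}-\tilde X_{j,\hat i_j-5}\}$, with the convention $+\infty-x=+\infty$ and $\min\{+\infty,x\}=x$ for all $-\infty\le x\le\infty$. Let $\sigma_j^2=6m_j\varepsilon^2$ and $\hat j=\min\{j:T_j/\sigma_j\le2\}$.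 Confidence interval: for $\beta\in(0,1)$ let $K_\beta=\lceil\log\beta/\log\Phi(-2)\rceil$ and $\tilde K_\beta=\max\{4,\,2+\lceil\log_2(2+z_{\beta/3})\rceil\}$. Let $S_{n,\beta}$ be the $(1-\beta)$ quantile of the maximum of $n$ i.i.d. $N(0,1)$ variables. With $j_0=(\hat j-K_{\alpha/4}-1)_+$ (positive part), set $t_L=t_{j_0,\hat i_{j_0}-5}$, $t_R=t_{j_0,\hat i_{j_0}+4}$, $i_L=t_L\cdot2^{\hat j+\tilde K_{\alpha/4}}$, $i_R=t_R\cdot2^{\hat j+\tilde K_{\alpha/4}}$. With $m^*=m_{\hat j+\tilde K_{\alpha/4}}$, let $$\hat f_1=\frac1{m^*}\min_{i_L<i\le i_R}\bar X_{\hat j+\tilde K_{\alpha/4},\,i},$$ $$f_{lo}=\hat f_1-z_{\alpha/4}\frac{\sqrt3\,\varepsilon}{\sqrt{m^*}}-\frac{\sqrt3\,\varepsilon}{\sqrt{m^*}},\qquad f_{hi}=\hat f_1+S_{i_R-i_L,\alpha/4}\frac{\sqrt3\,\varepsilon}{\sqrt{m^*}},$$ and $CI_{m,\alpha}=[f_{lo},f_{hi}]$. *)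

theory Defs
  imports "HOL-Probability.Probability"
begin

section \<open>Convex functions on the unit interval\<close>

text \<open>
  A function on \<open>[0,1]\<close> is a total function \<^typ>\<open>real \<Rightarrow> real\<close>, of which only the values on
  \<^term>\<open>{0..1::real}\<close> are used.
\<close>

definition is_minimizer :: "(real \<Rightarrow> real) \<Rightarrow> real \<Rightarrow> bool" where
  "is_minimizer f t \<longleftrightarrow> t \<in> {0..1} \<and> (\<forall>s\<in>{0..1}. f t \<le> f s)"

definition conv_class :: "(real \<Rightarrow> real) set" where
  "conv_class = {f. convex_on {0..1} f \<and> (\<exists>!t. is_minimizer f t)}"

definition minimizer :: "(real \<Rightarrow> real) \<Rightarrow> real" where
  "minimizer f = (THE t. is_minimizer f t)"

definition minimum :: "(real \<Rightarrow> real) \<Rightarrow> real" where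
  "minimum f = f (minimizer f)"

definition L2_norm :: "(real \<Rightarrow> real) \<Rightarrow> real" where
  "L2_norm h = sqrt (LBINT t:{0..1}. (h t)\<^sup>2)"

text \<open>
  For \<open>f\<close> in \<^const>\<open>conv_class\<close> (hence bounded on \<open>[0,1]\<close>) the set below is nonempty and bounded
  above, so the real supremum is the intended one.
\<close>

definition rho_m :: "real \<Rightarrow> (real \<Rightarrow> real) \<Rightarrow> real" where
  "rho_m \<epsilon> f = Sup {u - minimum f | u. L2_norm (\<lambda>t. f t - max (f t) u) \<le> \<epsilon>}"


section \<open>Gaussian quantiles\<close>

definition Phi :: "real \<Rightarrow> real" where
  "Phi = cdf std_normal_distribution"

definition z_quantile :: "real \<Rightarrow> real" where
  "z_quantile \<beta> = inv Phi (1 - \<beta>)"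

definition quantile :: "real measure \<Rightarrow> real \<Rightarrow> real" where
  "quantile \<mu> p = Inf {x. p \<le> cdf \<mu> x}"

definition max_normal_distribution :: "nat \<Rightarrow> real measure" where
  "max_normal_distribution n =
     distr (PiM {..<n} (\<lambda>_. std_normal_distribution)) borel (\<lambda>x. Max (x ` {..<n}))"

definition S_quantile :: "nat \<Rightarrow> real \<Rightarrow> real" where
  "S_quantile n \<beta> = quantile (max_normal_distribution n) (1 - \<beta>)"


section \<open>The white noise model\<close>

locale brownian_motion = prob_space M for M :: "'a measure" +
  fixes W :: "real \<Rightarrow> 'a \<Rightarrow> real"
  assumes measurable_at: "\<And>t. t \<in> {0..1} \<Longrightarrow> W t \<in> borel_measurable M"
    and starts_at_0: "AE \<omega> in M. W 0 \<omega> = 0"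
    and normal_increments:
      "\<And>s t. 0 \<le> s \<Longrightarrow> s < t \<Longrightarrow> t \<le> 1 \<Longrightarrow>
         distributed M lborel (\<lambda>\<omega>. W t \<omega> - W s \<omega>) (normal_density 0 (sqrt (t - s)))"
    and indep_increments:
      "\<And>(n::nat) \<tau>. strict_mono_on {..n} \<tau> \<Longrightarrow> \<tau> ` {..n} \<subseteq> {0..1} \<Longrightarrow>
         indep_vars (\<lambda>_. borel) (\<lambda>i \<omega>. W (\<tau> (Suc i)) \<omega> - W (\<tau> i) \<omega>) {..<n}"
    and continuous_paths: "AE \<omega> in M. continuous_on {0..1} (\<lambda>t. W t \<omega>)"

definition path_space :: "(real \<Rightarrow> real) measure" where
  "path_space = PiM {0..1} (\<lambda>_. borel)"

definition path_of :: "(real \<Rightarrow> 'a \<Rightarrow> real) \<Rightarrow> 'a \<Rightarrow> real \<Rightarrow> real" where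
  "path_of X \<omega> = (\<lambda>t\<in>{0..1}. X t \<omega>)"

text \<open>
  \<open>W\<close> drives the observation, \<open>B1\<close> and \<open>B2\<close> are the auxiliary Brownian motions used for sample
  splitting; the three paths are mutually independent.
\<close>

locale white_noise_model =
  W: brownian_motion M W + B1: brownian_motion M B1 + B2: brownian_motion M B2
  for M :: "'a measure" and W B1 B2 :: "real \<Rightarrow> 'a \<Rightarrow> real" +
  assumes indep_paths:
    "prob_space.indep_vars M (\<lambda>_. path_space) (\<lambda>k. path_of ([W, B1, B2] ! k)) {..<3}"

definition obs :: "(real \<Rightarrow> 'a \<Rightarrow> real) \<Rightarrow> real \<Rightarrow> (real \<Rightarrow> real) \<Rightarrow> real \<Rightarrow> 'a \<Rightarrow> real" where
  "obs W \<epsilon> f t \<omega> = (LBINT s:{0..t}. f s) + \<epsilon> * W t \<omega>"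


section \<open>The benchmark\<close>

text \<open>
  The joint law, under drift \<open>f\<close>, of the observed path and of an independent uniform variable,
  which is the auxiliary randomness available to a confidence interval.
\<close>

definition expt_law ::
    "'a measure \<Rightarrow> (real \<Rightarrow> 'a \<Rightarrow> real) \<Rightarrow> real \<Rightarrow> (real \<Rightarrow> real) \<Rightarrow> ((real \<Rightarrow> real) \<times> real) measure" where
  "expt_law M W \<epsilon> f =
     distr M path_space (path_of (obs W \<epsilon> f)) \<Otimes>\<^sub>M uniform_measure lborel {0..1}"

text \<open>
  Restricting to closed intervals with finite endpoints does not change the benchmark: passing to
  the closure keeps the length and can only increase coverage, and an interval that is unbounded
  with positive probability has infinite expected length.
\<close>

definition conf_intervals ::
    "'a measure \<Rightarrow> (real \<Rightarrow> 'a \<Rightarrow> real) \<Rightarrow> real \<Rightarrow> real \<Rightarrow> (real \<Rightarrow> real) set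
       \<Rightarrow> ((real \<Rightarrow> real) \<times> real \<Rightarrow> real set) set" where
  "conf_intervals M W \<alpha> \<epsilon> H =
     {CI. (\<exists>lo \<in> borel_measurable (path_space \<Otimes>\<^sub>M borel).
             \<exists>hi \<in> borel_measurable (path_space \<Otimes>\<^sub>M borel). CI = (\<lambda>x. {lo x..hi x})) \<and>
          (\<forall>h\<in>H. 1 - \<alpha> \<le> measure (expt_law M W \<epsilon> h)
                              {x \<in> space (expt_law M W \<epsilon> h). minimum h \<in> CI x})}"

definition interval_length :: "real set \<Rightarrow> ennreal" where
  "interval_length I = emeasure lborel I"

definition benchmark ::
    "'a measure \<Rightarrow> (real \<Rightarrow> 'a \<Rightarrow> real) \<Rightarrow> real \<Rightarrow> real \<Rightarrow> (real \<Rightarrow> real) \<Rightarrow> ennreal" where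
  "benchmark M W \<alpha> \<epsilon> f =
     (SUP g\<in>conv_class. INF CI\<in>conf_intervals M W \<alpha> \<epsilon> {f, g}.
        \<integral>\<^sup>+ x. interval_length (CI x) \<partial>expt_law M W \<epsilon> f)"


section \<open>The confidence interval for the minimum\<close>

text \<open>
  The construction is a functional of the observed path \<open>y\<close> and of the auxiliary paths \<open>b1\<close>, \<open>b2\<close>.
\<close>

definition Y_l :: "real \<Rightarrow> (real \<Rightarrow> real) \<Rightarrow> (real \<Rightarrow> real) \<Rightarrow> (real \<Rightarrow> real) \<Rightarrow> real \<Rightarrow> real" where
  "Y_l \<epsilon> y b1 b2 t = y t + sqrt 2 / 2 * \<epsilon> * b1 t + sqrt 6 / 2 * \<epsilon> * b2 t"

definition Y_s :: "real \<Rightarrow> (real \<Rightarrow> real) \<Rightarrow> (real \<Rightarrow> real) \<Rightarrow> (real \<Rightarrow> real) \<Rightarrow> real \<Rightarrow> real" where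
  "Y_s \<epsilon> y b1 b2 t = y t + sqrt 2 / 2 * \<epsilon> * b1 t - sqrt 6 / 2 * \<epsilon> * b2 t"

definition Y_e :: "real \<Rightarrow> (real \<Rightarrow> real) \<Rightarrow> (real \<Rightarrow> real) \<Rightarrow> real \<Rightarrow> real" where
  "Y_e \<epsilon> y b1 t = y t - sqrt 2 * \<epsilon> * b1 t"

definition mesh :: "nat \<Rightarrow> real" where
  "mesh j = 1 / 2 ^ j"

definition grid :: "nat \<Rightarrow> int \<Rightarrow> real" where
  "grid j i = of_int i * mesh j"

definition incr :: "(real \<Rightarrow> real) \<Rightarrow> nat \<Rightarrow> int \<Rightarrow> ereal" where
  "incr y j i = (if i \<in> {1..2 ^ j} then ereal (y (grid j i) - y (grid j (i - 1))) else \<infinity>)"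

text \<open>Ties in the argmin have probability zero.\<close>

primrec i_hat :: "(real \<Rightarrow> real) \<Rightarrow> nat \<Rightarrow> int" where
  "i_hat yl 0 = 1"
| "i_hat yl (Suc j) =
     arg_min_on (incr yl (Suc j)) {2 * i_hat yl j - 2 .. 2 * i_hat yl j + 1}"

text \<open>In \<^typ>\<open>ereal\<close>, \<open>\<infinity> - x = \<infinity>\<close> for every \<open>x\<close>, including \<open>x = \<infinity>\<close>.\<close>

definition T_stat :: "(real \<Rightarrow> real) \<Rightarrow> (real \<Rightarrow> real) \<Rightarrow> nat \<Rightarrow> ereal" where
  "T_stat yl ys j =
     min (incr ys j (i_hat yl j + 6) - incr ys j (i_hat yl j + 5))
         (incr ys j (i_hat yl j - 6) - incr ys j (i_hat yl j - 5))"

definition sigma :: "real \<Rightarrow> nat \<Rightarrow> real" where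
  "sigma \<epsilon> j = sqrt (6 * mesh j * \<epsilon>\<^sup>2)"

text \<open>
  The stopping level exists almost surely; on the null event where it does not, \<open>LEAST\<close> returns
  some fixed number.
\<close>

definition j_hat :: "real \<Rightarrow> (real \<Rightarrow> real) \<Rightarrow> (real \<Rightarrow> real) \<Rightarrow> nat" where
  "j_hat \<epsilon> yl ys = (LEAST j. T_stat yl ys j / ereal (sigma \<epsilon> j) \<le> 2)"

definition K_const :: "real \<Rightarrow> nat" where
  "K_const \<beta> = nat \<lceil>ln \<beta> / ln (Phi (-2))\<rceil>"

definition K_tilde :: "real \<Rightarrow> nat" where
  "K_tilde \<beta> = nat (max 4 (2 + \<lceil>log 2 (2 + z_quantile (\<beta> / 3))\<rceil>))"

text \<open>
  Natural-number subtraction gives the positive part in \<open>j0\<close>. The numbers \<open>iL\<close> and \<open>iR\<close> are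
  integer-valued. At least one index of the minimum lies in \<open>{1..2 ^ J}\<close>, so that minimum is finite.
\<close>

definition CI_m ::
    "real \<Rightarrow> real \<Rightarrow> (real \<Rightarrow> real) \<Rightarrow> (real \<Rightarrow> real) \<Rightarrow> (real \<Rightarrow> real) \<Rightarrow> real set" where
  "CI_m \<alpha> \<epsilon> y b1 b2 =
    (let yl = Y_l \<epsilon> y b1 b2;
         ys = Y_s \<epsilon> y b1 b2;
         ye = Y_e \<epsilon> y b1;
         jh = j_hat \<epsilon> yl ys;
         j0 = jh - K_const (\<alpha> / 4) - 1;
         J = jh + K_tilde (\<alpha> / 4);
         iL = grid j0 (i_hat yl j0 - 5) * 2 ^ J;
         iR = grid j0 (i_hat yl j0 + 4) * 2 ^ J;
         f1 = 1 / mesh J * real_of_ereal (Min (incr ye J ` {i. iL < real_of_int i \<and> real_of_int i \<le> iR}));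
         s = sqrt 3 * \<epsilon> / sqrt (mesh J);
         flo = f1 - z_quantile (\<alpha> / 4) * s - s;
         fhi = f1 + S_quantile (nat \<lfloor>iR - iL\<rfloor>) (\<alpha> / 4) * s
     in {flo..fhi})"

definition CI_random ::
    "(real \<Rightarrow> 'a \<Rightarrow> real) \<Rightarrow> (real \<Rightarrow> 'a \<Rightarrow> real) \<Rightarrow> (real \<Rightarrow> 'a \<Rightarrow> real)
       \<Rightarrow> real \<Rightarrow> real \<Rightarrow> (real \<Rightarrow> real) \<Rightarrow> 'a \<Rightarrow> real set" where
  "CI_random W B1 B2 \<alpha> \<epsilon> f \<omega> =
     CI_m \<alpha> \<epsilon> (\<lambda>t. obs W \<epsilon> f t \<omega>) (\<lambda>t. B1 t \<omega>) (\<lambda>t. B2 t \<omega>)"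

end

theory Submission
  imports Defs
begin

text \<open>
  Rotating the three Gaussian noises shows that the paths \<open>Y_l\<close>, \<open>Y_s\<close>, \<open>Y_e\<close> are independent. At
  every level the stopping test uses two cells on either side of the localized one, and the
  windows of different levels do not overlap, so choosing one side per level from \<open>Y_l\<close> gives
  tests that are independent given \<open>Y_l\<close>.
  The intervals that can still be reached after level \<open>j\<close> shrink. Once they miss the minimizer, one
  test per level has nonpositive drift and passes with probability at most \<open>\<Phi>(-2)\<close>, so
  \<open>K_const\<close> further levels without stopping are unlikely. As long as a level is steep, that is
  \<open>f\<close> rises by more than the noise level of the final cells near the minimizer, a wrong
  localization or an early stop is unlikely, with probabilities that sum to \<open>\<alpha> / 4\<close> over the
  levels. The two remaining error terms come from the extreme values of the estimation sample.

  For the length, the definition of \<open>\<rho>\<close> forces \<open>f\<close> to stay below \<open>M(f) + 2 \<rho>\<close> at distance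
  \<open>\<epsilon>\<^sup>2 / (8 \<rho>\<^sup>2)\<close> from the minimizer on one side. From the level of this scale on, every test
  stops with probability at least \<open>1 / 2\<close>, which outweighs the growth by \<open>\<surd>2\<close> per level of the length.

  The lower bound tests \<open>f\<close> against \<open>g = max f (M(f) + \<eta> (1 + \<bar>t - Z(f)\<bar>))\<close>, which is convex with
  the same unique minimizer and satisfies \<open>\<bar>f - g\<bar> \<le> \<bar>f - f\<^sub>u\<bar> / 6\<close> for \<open>u = M(f) + 12 \<eta>\<close>. The
  chi-square distance of the increment vectors bounds the two laws on cylinder sets, hence on all
  of the path space.
\<close>

section \<open>Rotation of independent Gaussian variables\<close>

text \<open>The windows tested on \<open>Y_s\<close> sit at random places, chosen by
  \<open>Y_l\<close>. Independence of the three paths turns every probability into an integral over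
  frozen paths: with \<open>Y_l\<close> fixed the windows are fixed and the tests are independent
  Gaussians; with \<open>Y_l\<close> and \<open>Y_s\<close> fixed only finitely many cell noises of
  \<open>Y_e\<close> remain. The four shares \<alpha> / 4 of the error are spent on a search region
  that misses the minimizer, on too early a stop, and on each endpoint. The decisive scale is a cell
  width h at which f rises, on one side and within distance 2 h of its minimizer, by no more than
  sqrt 3 * \<epsilon> / sqrt h, the standard deviation of a cell mean of \<open>Y_e\<close>. At such
  a scale some cell next to the minimizer has mean at most one standard deviation above M(f); this
  is the extra standard deviation subtracted in the lower endpoint. The \<open>K_tilde\<close>
  levels between the stopping level and the final cells make the comparisons at earlier levels
  significant: the drift of a comparison in units of its noise grows like the power 3/2 of the ratio
  of the cell widths.\<close>

abbreviation gauss :: "real \<Rightarrow> real measure" where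
  "gauss s \<equiv> density lborel (\<lambda>x. ennreal (normal_density 0 s x))"

lemma prob_space_gauss: "0 < s \<Longrightarrow> prob_space (gauss s)"
  by (rule prob_space_normal_density)

text \<open>The joint density of two independent centred normals of equal variance depends on
  \<open>u\<^sup>2 + v\<^sup>2\<close> only, and the map is a reflection of the plane.\<close>

lemma normal_density_rotation:
  assumes "a\<^sup>2 + b\<^sup>2 = (1::real)"
  shows "normal_density 0 s (a * u + b * v) * normal_density 0 s (b * u - a * v)
       = normal_density 0 s u * normal_density 0 s v"
proof -
  have "(a * u + b * v)\<^sup>2 + (b * u - a * v)\<^sup>2 = (a\<^sup>2 + b\<^sup>2) * (u\<^sup>2 + v\<^sup>2)"
    by (simp add: power2_eq_square algebra_simps)
  hence *: "(a * u + b * v)\<^sup>2 + (b * u - a * v)\<^sup>2 = u\<^sup>2 + v\<^sup>2" using assms by simp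
  have e: "exp (- (x\<^sup>2) / (2 * s\<^sup>2)) * exp (- (y\<^sup>2) / (2 * s\<^sup>2)) = exp (- (x\<^sup>2 + y\<^sup>2) / (2 * s\<^sup>2))" for x y
    by (simp add: mult_exp_exp diff_divide_distrib)
  have "normal_density 0 s x * normal_density 0 s y = (1 / sqrt (2 * pi * s\<^sup>2))\<^sup>2 * exp (- (x\<^sup>2 + y\<^sup>2) / (2 * s\<^sup>2))" for x y
    unfolding normal_density_def e[symmetric] by (simp add: power2_eq_square)
  thus ?thesis using * by simp
qed

text \<open>The substitutions \<open>u = a x + b y\<close> at fixed \<open>y\<close> and then \<open>v = (b u - y) / a\<close> at fixed \<open>u\<close>
  avoid a change of variables in the plane.\<close>

lemma nn_integral_gauss_rotation:
  assumes s: "0 < s" and ab: "a\<^sup>2 + b\<^sup>2 = (1::real)" and a: "0 < a"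
    and g[measurable]: "case_prod g \<in> borel_measurable (borel \<Otimes>\<^sub>M borel)"
  shows "(\<integral>\<^sup>+y. \<integral>\<^sup>+x. g (a * x + b * y) (b * x - a * y) \<partial>gauss s \<partial>gauss s)
       = (\<integral>\<^sup>+v. \<integral>\<^sup>+u. g u v \<partial>gauss s \<partial>gauss s)"
proof -
  let ?\<phi> = "\<lambda>x. ennreal (normal_density 0 s x)"
  have [measurable]: "(\<lambda>x. g (f1 x) (f2 x)) \<in> borel_measurable M"
    if "f1 \<in> borel_measurable M" "f2 \<in> borel_measurable M" for f1 f2 :: "'x \<Rightarrow> real" and M
  proof -
    have "(\<lambda>x. case_prod g (f1 x, f2 x)) \<in> borel_measurable M"
      using that by measurable
    thus ?thesis by simp
  qed
  have meas: "(\<lambda>y. \<integral>\<^sup>+x. g (a1 * x + b1 * y) (a2 * x + b2 * y) \<partial>gauss s) \<in> borel_measurable borel" for a1 b1 a2 b2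
  proof -
    interpret G: prob_space "gauss s" by (rule prob_space_gauss[OF s])
    show ?thesis by (rule G.borel_measurable_nn_integral) simp
  qed
  have b0: "(\<integral>\<^sup>+y. \<integral>\<^sup>+x. g (a1 * x + b1 * y) (a2 * x + b2 * y) \<partial>gauss s \<partial>gauss s)
     = (\<integral>\<^sup>+y. \<integral>\<^sup>+x. ?\<phi> x * ?\<phi> y * g (a1 * x + b1 * y) (a2 * x + b2 * y) \<partial>lborel \<partial>lborel)" for a1 b1 a2 b2
    apply (subst nn_integral_density)
      apply simp
     apply (simp add: meas)
    apply (subst nn_integral_density)
      apply simp
     apply simp
    apply (simp add: nn_integral_cmult[symmetric] ac_simps)
    done
  have "(\<integral>\<^sup>+y. \<integral>\<^sup>+x. g (a * x + b * y) (b * x - a * y) \<partial>gauss s \<partial>gauss s)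
      = (\<integral>\<^sup>+y. \<integral>\<^sup>+x. ?\<phi> x * ?\<phi> y * g (a * x + b * y) (b * x - a * y) \<partial>lborel \<partial>lborel)"
    using b0[of a b b "-a"] by simp
  also have "\<dots> = (\<integral>\<^sup>+y. (1/a) * (\<integral>\<^sup>+u. ?\<phi> ((u - b * y) / a) * ?\<phi> y * g u ((b * u - y) / a) \<partial>lborel) \<partial>lborel)"
  proof (intro nn_integral_cong)
    fix y :: real
    have e: "b * (- (b * y) / a + 1 / a * x) - a * y = (b * x - y) / a" for x
    proof -
      have "b * (- (b * y) / a + 1 / a * x) - a * y = (b * x - (a\<^sup>2 + b\<^sup>2) * y) / a"
        using a by (simp add: field_simps power2_eq_square)
      thus ?thesis using ab by simp
    qed
    have e0: "a * (- (b * y) / a + 1 / a * x) + b * y = x" for x using a by (simp add: field_simps)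
    show "(\<integral>\<^sup>+x. ?\<phi> x * ?\<phi> y * g (a * x + b * y) (b * x - a * y) \<partial>lborel)
       = (1/a) * (\<integral>\<^sup>+u. ?\<phi> ((u - b * y) / a) * ?\<phi> y * g u ((b * u - y) / a) \<partial>lborel)"
      apply (subst nn_integral_real_affine[where c="1/a" and t="-(b*y)/a"])
      using a apply simp
      using a apply simp
      unfolding e e0 using a by (simp add: diff_divide_distrib)
  qed
  also have "\<dots> = (1/a) * (\<integral>\<^sup>+y. (\<integral>\<^sup>+u. ?\<phi> ((u - b * y) / a) * ?\<phi> y * g u ((b * u - y) / a) \<partial>lborel) \<partial>lborel)"
    by (subst nn_integral_cmult) simp_all
  also have "\<dots> = (1/a) * (\<integral>\<^sup>+u. (\<integral>\<^sup>+y. ?\<phi> ((u - b * y) / a) * ?\<phi> y * g u ((b * u - y) / a) \<partial>lborel) \<partial>lborel)"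
    by (subst lborel_pair.Fubini'[symmetric]) simp_all
  also have "\<dots> = (1/a) * (\<integral>\<^sup>+u. a * (\<integral>\<^sup>+v. ?\<phi> u * ?\<phi> v * g u v \<partial>lborel) \<partial>lborel)"
  proof (intro arg_cong2[where f="(*)"] refl nn_integral_cong)
    fix u :: real
    have e1: "(b * u - (b * u + - a * v)) / a = v" for v using a by simp
    have e2: "(u - b * (b * u + - a * v)) / a = a * u + b * v" for v
    proof -
      have "(u - b * (b * u + - a * v)) / a = ((a\<^sup>2 + b\<^sup>2) * u - b * (b * u + - a * v)) / a" using ab by simp
      also have "\<dots> = a * u + b * v" using a by (simp add: field_simps power2_eq_square)
      finally show ?thesis .
    qed
    have e3: "?\<phi> (a * u + b * v) * ?\<phi> (b * u + - a * v) = ?\<phi> u * ?\<phi> v" for v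
      using normal_density_rotation[OF ab, of s u v] by (simp add: ennreal_mult'[symmetric])
    show "(\<integral>\<^sup>+y. ?\<phi> ((u - b * y) / a) * ?\<phi> y * g u ((b * u - y) / a) \<partial>lborel)
      = a * (\<integral>\<^sup>+v. ?\<phi> u * ?\<phi> v * g u v \<partial>lborel)"
      apply (subst nn_integral_real_affine[where c="-a" and t="b*u"])
      using a apply simp
      using a apply simp
      unfolding e1 e2 e3 using a by simp
  qed
  also have "\<dots> = (1/a) * (a * (\<integral>\<^sup>+u. (\<integral>\<^sup>+v. ?\<phi> u * ?\<phi> v * g u v \<partial>lborel) \<partial>lborel))"
    by (subst nn_integral_cmult) simp_all
  also have "\<dots> = (\<integral>\<^sup>+u. (\<integral>\<^sup>+v. ?\<phi> u * ?\<phi> v * g u v \<partial>lborel) \<partial>lborel)"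
    using a by (simp add: mult.assoc[symmetric] ennreal_mult'[symmetric])
  also have "\<dots> = (\<integral>\<^sup>+v. (\<integral>\<^sup>+u. ?\<phi> u * ?\<phi> v * g u v \<partial>lborel) \<partial>lborel)"
    by (subst lborel_pair.Fubini') simp_all
  also have "\<dots> = (\<integral>\<^sup>+v. \<integral>\<^sup>+u. g u v \<partial>gauss s \<partial>gauss s)"
    using b0[of 1 0 0 1] by simp
  finally show ?thesis .
qed

lemma gauss_scale:
  assumes s: "0 < s" and c: "0 < c"
  shows "gauss (c * s) = distr (gauss s) borel ((*) c)"
proof -
  interpret prob_space "gauss s" by (rule prob_space_gauss[OF s])
  have "distributed (gauss s) lborel (\<lambda>x. x) (normal_density 0 s)"
    by (auto simp: distributed_def distr_id2)
  from normal_density_affine[OF this s, of c 0] c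
  have "distributed (gauss s) lborel ((*) c) (normal_density 0 (c * s))" by simp
  hence "distr (gauss s) lborel ((*) c) = gauss (c * s)" by (simp add: distributed_def)
  thus ?thesis by (metis distr_cong sets_lborel)
qed

text \<open>Up to the factor sqrt 3 the three combinations form an orthogonal matrix. It factors
  into two plane reflections: one in \<open>(x, y)\<close>, which produces the third sample
  \<open>e\<close> and the common part \<open>p\<close> of the first two, and one with equal weights
  in \<open>(p, z)\<close>, which separates these two.\<close>

lemma gauss_sample_split:
  assumes s: "0 < s" and [measurable]: "A \<in> sets borel" "B \<in> sets borel" "C \<in> sets borel"
  shows "(\<integral>\<^sup>+z. \<integral>\<^sup>+y. \<integral>\<^sup>+x. indicator A (x + sqrt 2 / 2 * y + sqrt 6 / 2 * z)
        * indicator B (x + sqrt 2 / 2 * y - sqrt 6 / 2 * z) * indicator C (x - sqrt 2 * y)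
        \<partial>gauss s \<partial>gauss s \<partial>gauss s)
     = emeasure (gauss (sqrt 3 * s)) A * emeasure (gauss (sqrt 3 * s)) B * emeasure (gauss (sqrt 3 * s)) C"
proof -
  interpret G: prob_space "gauss s" by (rule prob_space_gauss[OF s])
  interpret GG: pair_prob_space "gauss s" "gauss s" ..
  let ?a = "sqrt 2 / sqrt 3 :: real" and ?b = "1 / sqrt 3 :: real" and ?r = "1 / sqrt 2 :: real"
  have ab: "?a\<^sup>2 + ?b\<^sup>2 = 1" "?r\<^sup>2 + ?r\<^sup>2 = 1" by (simp_all add: power_divide)
  have s3: "sqrt 3 * sqrt 3 = (3::real)" "sqrt 2 * sqrt 2 = (2::real)" by simp_all
  have s6: "sqrt 6 = sqrt 2 * sqrt (3::real)" by (simp add: real_sqrt_mult[symmetric])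
  let ?A = "\<lambda>x. indicator A (sqrt 3 * x) :: ennreal"
  let ?B = "\<lambda>x. indicator B (sqrt 3 * x) :: ennreal"
  let ?C = "\<lambda>x. indicator C (sqrt 3 * x) :: ennreal"
  have em: "(\<integral>\<^sup>+x. indicator D (sqrt 3 * x) \<partial>gauss s) = emeasure (gauss (sqrt 3 * s)) D"
    if [measurable]: "D \<in> sets borel" for D
    by (subst gauss_scale[OF s]) (simp_all add: nn_integral_indicator[symmetric] nn_integral_distr del: nn_integral_indicator)
  have 1: "(\<integral>\<^sup>+y. \<integral>\<^sup>+x. indicator A (x + sqrt 2 / 2 * y + sqrt 6 / 2 * z)
        * indicator B (x + sqrt 2 / 2 * y - sqrt 6 / 2 * z) * indicator C (x - sqrt 2 * y) \<partial>gauss s \<partial>gauss s)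
     = (\<integral>\<^sup>+e. \<integral>\<^sup>+p. ?A (?r * p + ?r * z) * ?B (?r * p - ?r * z) * ?C e \<partial>gauss s \<partial>gauss s)" for z
  proof -
    have p: "x + sqrt 2 / 2 * y = sqrt 3 * ?r * (?a * x + ?b * y)"
       "sqrt 6 / 2 * z = sqrt 3 * ?r * z" "x - sqrt 2 * y = sqrt 3 * (?b * x - ?a * y)" for x y
      unfolding s6 by (simp_all add: field_simps s3)
    have "(\<integral>\<^sup>+y. \<integral>\<^sup>+x. indicator A (x + sqrt 2 / 2 * y + sqrt 6 / 2 * z)
        * indicator B (x + sqrt 2 / 2 * y - sqrt 6 / 2 * z) * indicator C (x - sqrt 2 * y) \<partial>gauss s \<partial>gauss s)
     = (\<integral>\<^sup>+y. \<integral>\<^sup>+x. (\<lambda>p e. ?A (?r * p + ?r * z) * ?B (?r * p - ?r * z) * ?C e)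
           (?a * x + ?b * y) (?b * x - ?a * y) \<partial>gauss s \<partial>gauss s)"
      unfolding p by (simp add: algebra_simps)
    also have "\<dots> = (\<integral>\<^sup>+e. \<integral>\<^sup>+p. ?A (?r * p + ?r * z) * ?B (?r * p - ?r * z) * ?C e \<partial>gauss s \<partial>gauss s)"
      by (rule nn_integral_gauss_rotation[OF s ab(1)]) (simp_all add: split_beta')
    finally show ?thesis .
  qed
  have "(\<integral>\<^sup>+z. \<integral>\<^sup>+e. \<integral>\<^sup>+p. ?A (?r * p + ?r * z) * ?B (?r * p - ?r * z) * ?C e \<partial>gauss s \<partial>gauss s \<partial>gauss s)
    = (\<integral>\<^sup>+z. \<integral>\<^sup>+e. ?C e * (\<integral>\<^sup>+p. ?A (?r * p + ?r * z) * ?B (?r * p - ?r * z) \<partial>gauss s) \<partial>gauss s \<partial>gauss s)"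
    by (subst nn_integral_cmult[symmetric]) (simp_all add: ac_simps)
  also have "\<dots> = (\<integral>\<^sup>+z. (\<integral>\<^sup>+e. ?C e \<partial>gauss s) * (\<integral>\<^sup>+p. ?A (?r * p + ?r * z) * ?B (?r * p - ?r * z) \<partial>gauss s) \<partial>gauss s)"
    by (subst nn_integral_multc) simp_all
  also have "\<dots> = (\<integral>\<^sup>+e. ?C e \<partial>gauss s) * (\<integral>\<^sup>+z. \<integral>\<^sup>+p. ?A (?r * p + ?r * z) * ?B (?r * p - ?r * z) \<partial>gauss s \<partial>gauss s)"
    by (subst nn_integral_cmult) simp_all
  also have "(\<integral>\<^sup>+z. \<integral>\<^sup>+p. ?A (?r * p + ?r * z) * ?B (?r * p - ?r * z) \<partial>gauss s \<partial>gauss s)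
     = (\<integral>\<^sup>+v. \<integral>\<^sup>+u. ?A u * ?B v \<partial>gauss s \<partial>gauss s)"
    using nn_integral_gauss_rotation[OF s ab(2), of "\<lambda>u v. ?A u * ?B v"] by (simp add: split_beta')
  also have "\<dots> = (\<integral>\<^sup>+u. ?A u \<partial>gauss s) * (\<integral>\<^sup>+v. ?B v \<partial>gauss s)"
    by (simp add: nn_integral_multc nn_integral_cmult)
  finally show ?thesis unfolding 1 em[OF assms(2)] em[OF assms(3)] em[OF assms(4)] by (simp only: ac_simps)
qed

section \<open>Independence of the split samples\<close>

text \<open>Common interface for the sources, with \<open>c = 1\<close>, and for the split noises,
  with \<open>c = sqrt 3\<close>; \<open>c\<close> is the standard deviation of the increment over
  unit time.\<close>

locale gauss_process = prob_space M for M :: "'a measure" +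
  fixes c :: real and X :: "real \<Rightarrow> 'a \<Rightarrow> real"
  assumes measurable_at: "\<And>t. t \<in> {0..1} \<Longrightarrow> X t \<in> borel_measurable M"
    and c_pos: "0 < c"
    and starts_at_0: "AE \<omega> in M. X 0 \<omega> = 0"
    and distr_increment:
      "\<And>s t. 0 \<le> s \<Longrightarrow> s < t \<Longrightarrow> t \<le> 1 \<Longrightarrow> distr M borel (\<lambda>\<omega>. X t \<omega> - X s \<omega>) = gauss (c * sqrt (t - s))"
    and indep_increments:
      "\<And>(n::nat) \<tau>. strict_mono_on {..n} \<tau> \<Longrightarrow> \<tau> ` {..n} \<subseteq> {0..1} \<Longrightarrow>
         indep_vars (\<lambda>_. borel) (\<lambda>i \<omega>. X (\<tau> (Suc i)) \<omega> - X (\<tau> i) \<omega>) {..<n}"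

lemma (in brownian_motion) gauss_process_1: "gauss_process M 1 W"
proof unfold_locales
  fix s t :: real assume st: "0 \<le> s" "s < t" "t \<le> 1"
  have "distr M lborel (\<lambda>\<omega>. W t \<omega> - W s \<omega>) = gauss (sqrt (t - s))"
    using normal_increments[OF st] by (simp add: distributed_def)
  moreover have "distr M borel (\<lambda>\<omega>. W t \<omega> - W s \<omega>) = distr M lborel (\<lambda>\<omega>. W t \<omega> - W s \<omega>)"
    by (rule distr_cong) simp_all
  ultimately show "distr M borel (\<lambda>\<omega>. W t \<omega> - W s \<omega>) = gauss (1 * sqrt (t - s))"
    by simp
qed (fact measurable_at zero_less_one starts_at_0 indep_increments)+

text \<open>Padding with \<open>0\<close> makes every path value a sum of increments from time zero
  on; padding with \<open>1\<close> keeps the number of increments positive. In this way cylinder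
  events become events on increment vectors.\<close>

lemma times_enumeration:
  assumes "finite F" "F \<subseteq> {0..1::real}"
  obtains n :: nat and \<tau> where "0 < n" "strict_mono_on {..n} \<tau>" "\<tau> ` {..n} \<subseteq> {0..1}" "\<tau> 0 = 0" "F \<subseteq> \<tau> ` {..n}"
proof -
  define xs where "xs = sorted_list_of_set (F \<union> {0,1})"
  have fin: "finite (F \<union> {0,1})" using assms by simp
  have set: "set xs = F \<union> {0,1}" and ss: "sorted_wrt (<) xs"
    unfolding xs_def using fin by (simp_all del: sorted_list_of_set_insert_remove)
  have len: "length xs = card (F \<union> {0,1})"
    unfolding xs_def using fin by (simp del: sorted_list_of_set_insert_remove)
  have "card {0,1::real} \<le> card (F \<union> {0,1})" by (rule card_mono) (use fin in auto)
  hence len2: "2 \<le> length xs" using len by simp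
  have sl: "i < j \<Longrightarrow> j < length xs \<Longrightarrow> xs ! i < xs ! j" for i j
    using ss by (simp add: sorted_wrt_iff_nth_less)
  have img: "(!) xs ` {..length xs - 1} = set xs"
  proof -
    have "{..length xs - 1} = {..<length xs}" using len2 by auto
    moreover have "set xs = (!) xs ` {..<length xs}" unfolding set_conv_nth by auto
    ultimately show ?thesis by simp
  qed
  have "xs ! 0 = 0"
  proof -
    have "0 \<in> set xs" using set by auto
    then obtain i where i: "i < length xs" "xs ! i = 0" by (auto simp: in_set_conv_nth)
    have "xs ! 0 \<in> F \<union> {0,1}" using set len2 nth_mem[of 0 xs] by fastforce
    hence "0 \<le> xs ! 0" using assms(2) by auto
    thus ?thesis using sl[of 0 i] i by (cases "i = 0") auto
  qed
  moreover have "strict_mono_on {..length xs - 1} ((!) xs)"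
    using sl len2 by (intro strict_mono_onI) simp
  moreover have "F \<subseteq> (!) xs ` {..length xs - 1}" "(!) xs ` {..length xs - 1} \<subseteq> {0..1}"
    unfolding img set using assms(2) by auto
  ultimately show ?thesis
    using len2 by (intro that[of "length xs - 1" "(!) xs"]) simp_all
qed

lemma (in prob_space) distr_indep_triple:
  assumes "indep_vars (\<lambda>_. N) X {..<3::nat}"
  shows "distr M (N \<Otimes>\<^sub>M (N \<Otimes>\<^sub>M N)) (\<lambda>\<omega>. (X 0 \<omega>, X 1 \<omega>, X 2 \<omega>))
    = distr M N (X 0) \<Otimes>\<^sub>M (distr M N (X 1) \<Otimes>\<^sub>M distr M N (X 2))"
proof -
  have X[measurable]: "random_variable N (X i)" if "i < 3" for i
    using assms that by (auto simp: indep_vars_def2)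
  have [measurable]: "random_variable N (X 0)" "random_variable N (X 1)" "random_variable N (X 2)" by (simp_all add: X)
  \<comment> \<open>\<open>indep_var\<close> wants both components in one type, so
    \<open>X 0\<close> enters as a pair with itself and is projected back at the end.\<close>
  have "indep_var (N \<Otimes>\<^sub>M N) ((\<lambda>f. (f 0, f 0)) \<circ> (\<lambda>\<omega>. restrict (\<lambda>i. X i \<omega>) {0})) (N \<Otimes>\<^sub>M N)
     ((\<lambda>f. (f 1, f 2)) \<circ> (\<lambda>\<omega>. restrict (\<lambda>i. X i \<omega>) {1,2}))"
    by (rule indep_var_compose[OF indep_var_restrict[OF assms]]) auto
  hence 1: "indep_var (N \<Otimes>\<^sub>M N) (\<lambda>\<omega>. (X 0 \<omega>, X 0 \<omega>)) (N \<Otimes>\<^sub>M N) (\<lambda>\<omega>. (X 1 \<omega>, X 2 \<omega>))" by (simp add: comp_def)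
  have "indep_var N ((\<lambda>f. f 1) \<circ> (\<lambda>\<omega>. restrict (\<lambda>i. X i \<omega>) {1})) N
     ((\<lambda>f. f 2) \<circ> (\<lambda>\<omega>. restrict (\<lambda>i. X i \<omega>) {2}))"
    by (rule indep_var_compose[OF indep_var_restrict[OF assms]]) auto
  hence "indep_var N (X 1) N (X 2)" by (simp add: comp_def)
  hence 2: "distr M N (X 1) \<Otimes>\<^sub>M distr M N (X 2) = distr M (N \<Otimes>\<^sub>M N) (\<lambda>\<omega>. (X 1 \<omega>, X 2 \<omega>))"
    unfolding indep_var_distribution_eq by simp
  let ?D = "distr M (N \<Otimes>\<^sub>M N) (\<lambda>\<omega>. (X 0 \<omega>, X 0 \<omega>))" and ?E = "distr M (N \<Otimes>\<^sub>M N) (\<lambda>\<omega>. (X 1 \<omega>, X 2 \<omega>))"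
  interpret E: prob_space "distr ?E (N \<Otimes>\<^sub>M N) (\<lambda>x. x)"
    by (intro prob_space.prob_space_distr prob_space_distr) auto
  have "distr ?D N fst \<Otimes>\<^sub>M distr ?E (N \<Otimes>\<^sub>M N) (\<lambda>x. x)
      = distr (?D \<Otimes>\<^sub>M ?E) (N \<Otimes>\<^sub>M (N \<Otimes>\<^sub>M N)) (\<lambda>(x, y). (fst x, y))"
    by (rule pair_measure_distr[OF _ _ E.sigma_finite_measure_axioms]) simp_all
  also have "?D \<Otimes>\<^sub>M ?E = distr M ((N \<Otimes>\<^sub>M N) \<Otimes>\<^sub>M (N \<Otimes>\<^sub>M N)) (\<lambda>\<omega>. ((X 0 \<omega>, X 0 \<omega>), (X 1 \<omega>, X 2 \<omega>)))"
    using 1 unfolding indep_var_distribution_eq by simp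
  finally show ?thesis unfolding 2
    by (simp add: distr_distr comp_def distr_id2 del: One_nat_def)
qed

text \<open>Different coordinates are independent, while \<open>x\<close>, \<open>y\<close>,
  \<open>z\<close> stay coupled within a coordinate. The product is therefore pulled out of one
  integral after the other, from the inside; the order \<open>(z, y, x)\<close> keeps the inner
  integrals measurable.\<close>

lemma (in product_sigma_finite) triple_product_nn_integral_prod:
  assumes I: "finite I"
    and g: "\<And>i. i \<in> I \<Longrightarrow> (\<lambda>(z, y, x). g i x y z) \<in> borel_measurable (M i \<Otimes>\<^sub>M (M i \<Otimes>\<^sub>M M i))"
  shows "(\<integral>\<^sup>+z. \<integral>\<^sup>+y. \<integral>\<^sup>+x. (\<Prod>i\<in>I. g i (x i) (y i) (z i)) \<partial>Pi\<^sub>M I M \<partial>Pi\<^sub>M I M \<partial>Pi\<^sub>M I M)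
      = (\<Prod>i\<in>I. \<integral>\<^sup>+z. \<integral>\<^sup>+y. \<integral>\<^sup>+x. g i x y z \<partial>M i \<partial>M i \<partial>M i)"
proof -
  have m3: "(\<lambda>x. g i x y z) \<in> borel_measurable (M i)" if "i \<in> I" "y \<in> space (M i)" "z \<in> space (M i)" for i y z
  proof -
    have "(\<lambda>x. (z, y, x)) \<in> measurable (M i) (M i \<Otimes>\<^sub>M (M i \<Otimes>\<^sub>M M i))" using that by simp
    from measurable_compose[OF this g[OF that(1)]] show ?thesis by simp
  qed
  have m2': "(\<lambda>(z, y). \<integral>\<^sup>+x. g i x y z \<partial>M i) \<in> borel_measurable (M i \<Otimes>\<^sub>M M i)" if i: "i \<in> I" for i
  proof -
    have "(\<lambda>p. (fst (fst p), snd (fst p), snd p)) \<in> measurable ((M i \<Otimes>\<^sub>M M i) \<Otimes>\<^sub>M M i) (M i \<Otimes>\<^sub>M (M i \<Otimes>\<^sub>M M i))"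
      by measurable
    from measurable_compose[OF this g[OF i]]
    have "case_prod (\<lambda>q x. g i x (snd q) (fst q)) \<in> borel_measurable ((M i \<Otimes>\<^sub>M M i) \<Otimes>\<^sub>M M i)"
      by (simp add: split_beta')
    from sigma_finite_measure.borel_measurable_nn_integral[OF sigma_finite_measures this]
    show ?thesis by (simp add: split_beta')
  qed
  have m2: "(\<lambda>y. \<integral>\<^sup>+x. g i x y z \<partial>M i) \<in> borel_measurable (M i)" if i: "i \<in> I" and z: "z \<in> space (M i)" for i z
  proof -
    have "(\<lambda>y. (z, y)) \<in> measurable (M i) (M i \<Otimes>\<^sub>M M i)" using z by simp
    from measurable_compose[OF this m2'[OF i]] show ?thesis by simp
  qed
  have m1: "(\<lambda>z. \<integral>\<^sup>+y. \<integral>\<^sup>+x. g i x y z \<partial>M i \<partial>M i) \<in> borel_measurable (M i)" if i: "i \<in> I" for i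
    using sigma_finite_measure.borel_measurable_nn_integral[OF sigma_finite_measures m2'[OF i]] .
  have "(\<integral>\<^sup>+z. \<integral>\<^sup>+y. \<integral>\<^sup>+x. (\<Prod>i\<in>I. g i (x i) (y i) (z i)) \<partial>Pi\<^sub>M I M \<partial>Pi\<^sub>M I M \<partial>Pi\<^sub>M I M)
     = (\<integral>\<^sup>+z. \<integral>\<^sup>+y. (\<Prod>i\<in>I. \<integral>\<^sup>+x. g i x (y i) (z i) \<partial>M i) \<partial>Pi\<^sub>M I M \<partial>Pi\<^sub>M I M)"
    by (intro nn_integral_cong product_nn_integral_prod I m3) (auto simp: space_PiM)
  also have "\<dots> = (\<integral>\<^sup>+z. (\<Prod>i\<in>I. \<integral>\<^sup>+y. \<integral>\<^sup>+x. g i x y (z i) \<partial>M i \<partial>M i) \<partial>Pi\<^sub>M I M)"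
    by (intro nn_integral_cong product_nn_integral_prod I m2) (auto simp: space_PiM)
  also have "\<dots> = (\<Prod>i\<in>I. \<integral>\<^sup>+z. \<integral>\<^sup>+y. \<integral>\<^sup>+x. g i x y z \<partial>M i \<partial>M i \<partial>M i)"
    by (intro product_nn_integral_prod I m1)
  finally show ?thesis .
qed

lemma measurable_path_of:
  assumes "\<And>t. t \<in> {0..1} \<Longrightarrow> X t \<in> borel_measurable M"
  shows "path_of X \<in> measurable M path_space"
  unfolding path_of_def path_space_def using assms by (intro measurable_restrict) auto

lemma (in gauss_process) increments_vector:
  fixes \<tau> :: "nat \<Rightarrow> real" and n :: nat
  assumes \<tau>: "0 < n" "strict_mono_on {..n} \<tau>" "\<tau> ` {..n} \<subseteq> {0..1}"
  shows "distr M (PiM {..<n} (\<lambda>_. borel)) (\<lambda>\<omega>. \<lambda>i\<in>{..<n}. X (\<tau> (Suc i)) \<omega> - X (\<tau> i) \<omega>)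
     = PiM {..<n} (\<lambda>i. gauss (c * sqrt (\<tau> (Suc i) - \<tau> i)))"
proof -
  have mem: "\<tau> i \<in> {0..1}" if "i \<le> n" for i using \<tau>(3) that by auto
  have [measurable]: "random_variable borel (\<lambda>\<omega>. X (\<tau> (Suc i)) \<omega> - X (\<tau> i) \<omega>)" if "i \<in> {..<n}" for i
    using that by (intro borel_measurable_diff measurable_at mem) auto
  have "distr M (PiM {..<n} (\<lambda>_. borel)) (\<lambda>\<omega>. \<lambda>i\<in>{..<n}. X (\<tau> (Suc i)) \<omega> - X (\<tau> i) \<omega>)
    = PiM {..<n} (\<lambda>i. distr M borel (\<lambda>\<omega>. X (\<tau> (Suc i)) \<omega> - X (\<tau> i) \<omega>))"
    by (rule iffD1[OF indep_vars_iff_distr_eq_PiM' indep_increments[OF \<tau>(2,3)]]) (use \<tau>(1) in \<open>auto\<close>)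
  also have "\<dots> = PiM {..<n} (\<lambda>i. gauss (c * sqrt (\<tau> (Suc i) - \<tau> i)))"
  proof (intro PiM_cong refl distr_increment)
    fix i assume i: "i \<in> {..<n}"
    show "0 \<le> \<tau> i" "\<tau> (Suc i) \<le> 1" using mem[of i] mem[of "Suc i"] i by auto
    show "\<tau> i < \<tau> (Suc i)" using \<tau>(2) i by (auto simp: strict_mono_on_def)
  qed
  finally show ?thesis .
qed

text \<open>\<open>Y_l\<close>, \<open>Y_s\<close> and \<open>Y_e\<close> are the drift plus
  \<epsilon> times entry 0, 1 and 2, respectively.\<close>

definition split_noise ::
    "(real \<Rightarrow> 'a \<Rightarrow> real) \<Rightarrow> (real \<Rightarrow> 'a \<Rightarrow> real) \<Rightarrow> (real \<Rightarrow> 'a \<Rightarrow> real) \<Rightarrow> nat \<Rightarrow> real \<Rightarrow> 'a \<Rightarrow> real" where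
  "split_noise W B1 B2 k t \<omega> =
     [W t \<omega> + sqrt 2 / 2 * B1 t \<omega> + sqrt 6 / 2 * B2 t \<omega>,
      W t \<omega> + sqrt 2 / 2 * B1 t \<omega> - sqrt 6 / 2 * B2 t \<omega>,
      W t \<omega> - sqrt 2 * B1 t \<omega>] ! k"

lemma lessThan_3_cases: "k < 3 \<Longrightarrow> k = 0 \<or> k = 1 \<or> k = (2::nat)" by auto

lemma lessThan_3_nonempty [simp]: "{..<3::nat} \<noteq> {}" by (simp add: lessThan_empty_iff bot_nat_def)

lemma lessThan_3: "{..<3::nat} = {0, 1, 2}" by auto

context white_noise_model
begin

lemma source_process: "k < 3 \<Longrightarrow> gauss_process M 1 ([W, B1, B2] ! k)"
  using lessThan_3_cases[of k] W.gauss_process_1 B1.gauss_process_1 B2.gauss_process_1 by auto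

abbreviation "N \<equiv> split_noise W B1 B2"

lemma split_noise_simps:
  "N 0 t \<omega> = W t \<omega> + sqrt 2 / 2 * B1 t \<omega> + sqrt 6 / 2 * B2 t \<omega>"
  "N (Suc 0) t \<omega> = W t \<omega> + sqrt 2 / 2 * B1 t \<omega> - sqrt 6 / 2 * B2 t \<omega>"
  "N 2 t \<omega> = W t \<omega> - sqrt 2 * B1 t \<omega>"
  by (simp_all add: split_noise_def numeral_2_eq_2)

lemma measurable_split_noise: "k < 3 \<Longrightarrow> t \<in> {0..1} \<Longrightarrow> N k t \<in> borel_measurable M"
proof -
  assume k: "k < 3" and t: "t \<in> {0..1}"
  note [measurable] = W.measurable_at[OF t] B1.measurable_at[OF t] B2.measurable_at[OF t]
  show ?thesis
    using lessThan_3_cases[OF k] by (elim disjE) (simp_all add: split_noise_simps[abs_def] fun_eq_iff cong: measurable_cong)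
qed

context
  fixes n :: nat and \<tau> :: "nat \<Rightarrow> real"
  assumes \<tau>: "0 < n" "strict_mono_on {..n} \<tau>" "\<tau> ` {..n} \<subseteq> {0..1}"
begin

abbreviation "\<nu> i \<equiv> gauss (sqrt (\<tau> (Suc i) - \<tau> i))"
abbreviation "\<nu>3 i \<equiv> gauss (sqrt 3 * sqrt (\<tau> (Suc i) - \<tau> i))"
abbreviation "D k i \<omega> \<equiv> ([W, B1, B2] ! k) (\<tau> (Suc i)) \<omega> - ([W, B1, B2] ! k) (\<tau> i) \<omega>"
abbreviation "U k i \<omega> \<equiv> N k (\<tau> (Suc i)) \<omega> - N k (\<tau> i) \<omega>"

lemma \<tau>_mem: "i \<le> n \<Longrightarrow> \<tau> i \<in> {0..1}"
  using \<tau>(3) by auto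

lemma \<tau>_step: "i < n \<Longrightarrow> 0 < sqrt (\<tau> (Suc i) - \<tau> i)"
  using \<tau>(2) by (auto simp: strict_mono_on_def)

lemma measurable_U: "k < 3 \<Longrightarrow> i < n \<Longrightarrow> (\<lambda>\<omega>. U k i \<omega>) \<in> borel_measurable M"
  by (intro borel_measurable_diff measurable_split_noise \<tau>_mem) auto

lemma distr_source_increments:
  "distr M (PiM {..<n} (\<lambda>_. borel) \<Otimes>\<^sub>M (PiM {..<n} (\<lambda>_. borel) \<Otimes>\<^sub>M PiM {..<n} (\<lambda>_. borel)))
     (\<lambda>\<omega>. (\<lambda>i\<in>{..<n}. D 0 i \<omega>, \<lambda>i\<in>{..<n}. D 1 i \<omega>, \<lambda>i\<in>{..<n}. D 2 i \<omega>))
   = PiM {..<n} \<nu> \<Otimes>\<^sub>M (PiM {..<n} \<nu> \<Otimes>\<^sub>M PiM {..<n} \<nu>)"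
proof -
  have "W.indep_vars (\<lambda>_. PiM {..<n} (\<lambda>_. borel))
      (\<lambda>k \<omega>. (\<lambda>x. \<lambda>i\<in>{..<n}. x (\<tau> (Suc i)) - x (\<tau> i)) (path_of ([W, B1, B2] ! k) \<omega>)) {..<3}"
  proof (rule W.indep_vars_compose2[OF indep_paths])
    show "(\<lambda>x. \<lambda>i\<in>{..<n}. x (\<tau> (Suc i)) - x (\<tau> i)) \<in> measurable path_space (PiM {..<n} (\<lambda>_. borel))"
      unfolding path_space_def
      by (intro measurable_restrict borel_measurable_diff measurable_component_singleton \<tau>_mem) simp_all
  qed
  also have "(\<lambda>k \<omega>. (\<lambda>x. \<lambda>i\<in>{..<n}. x (\<tau> (Suc i)) - x (\<tau> i)) (path_of ([W, B1, B2] ! k) \<omega>))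
     = (\<lambda>k \<omega>. \<lambda>i\<in>{..<n}. D k i \<omega>)"
    using \<tau>_mem by (auto simp: path_of_def restrict_def fun_eq_iff)
  finally have "W.indep_vars (\<lambda>_. PiM {..<n} (\<lambda>_. borel)) (\<lambda>k \<omega>. \<lambda>i\<in>{..<n}. D k i \<omega>) {..<3}" .
  from W.distr_indep_triple[OF this]
  show ?thesis
    using gauss_process.increments_vector[OF source_process \<tau>, of 0] gauss_process.increments_vector[OF source_process \<tau>, of 1]
       gauss_process.increments_vector[OF source_process \<tau>, of 2] by simp
qed

text \<open>The sources have independent increments, so the probability factors over the time steps
  \<open>i\<close>; within one step the rotation factors it over the samples
  \<open>k\<close>.\<close>

lemma emeasure_split_increments:
  assumes A[measurable]: "\<And>k i. k < 3 \<Longrightarrow> i < n \<Longrightarrow> A k i \<in> sets borel"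
  shows "emeasure M {\<omega> \<in> space M. \<forall>k<3. \<forall>i<n. U k i \<omega> \<in> A k i}
     = (\<Prod>i<n. \<Prod>k<3. emeasure (\<nu>3 i) (A k i))"
proof -
  let ?P = "PiM {..<n} (\<lambda>_. borel) :: (nat \<Rightarrow> real) measure" and ?Q = "PiM {..<n} \<nu>"
  define V where "V \<omega> = (\<lambda>i\<in>{..<n}. D 0 i \<omega>, \<lambda>i\<in>{..<n}. D 1 i \<omega>, \<lambda>i\<in>{..<n}. D 2 i \<omega>)" for \<omega>
  define g :: "nat \<Rightarrow> real \<Rightarrow> real \<Rightarrow> real \<Rightarrow> ennreal" where
    "g i x y z = indicator (A 0 i) (x + sqrt 2 / 2 * y + sqrt 6 / 2 * z)
        * indicator (A 1 i) (x + sqrt 2 / 2 * y - sqrt 6 / 2 * z) * indicator (A 2 i) (x - sqrt 2 * y)" for i x y z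
  have Dm: "(\<lambda>\<omega>. D k i \<omega>) \<in> borel_measurable M" if "k < 3" "i < n" for k i
    using gauss_process.measurable_at[OF source_process[OF that(1)]] \<tau>_mem that(2) by (intro borel_measurable_diff) auto
  have V: "V \<in> measurable M (?P \<Otimes>\<^sub>M (?P \<Otimes>\<^sub>M ?P))"
    unfolding V_def by (intro measurable_Pair measurable_restrict Dm) auto
  have prob: "prob_space (\<nu> i)" if "i < n" for i by (rule prob_space_gauss[OF \<tau>_step[OF that]])
  \<comment> \<open>Beyond the range \<open>\<nu> i\<close> may fail to be a probability measure,
    since nothing is known there about \<open>\<tau>\<close>.\<close>
  define \<nu>' where "\<nu>' i = (if i < n then \<nu> i else gauss 1)" for i
  interpret PS: product_prob_space \<nu>' "{..<n}"
    by (rule product_prob_spaceI) (simp add: \<nu>'_def prob prob_space_gauss)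
  have Q: "?Q = PiM {..<n} \<nu>'" by (rule PiM_cong) (auto simp: \<nu>'_def)
  interpret Q: prob_space ?Q unfolding Q by (rule prob_space_PiM) (rule PS.prob_space)
  interpret QQ: pair_prob_space ?Q ?Q ..
  interpret QQQ: pair_prob_space ?Q "?Q \<Otimes>\<^sub>M ?Q" ..
  have sQ: "sets ?Q = sets ?P" by (rule sets_PiM_cong) auto
  have gm: "(\<lambda>(x, y, z). g i x y z) \<in> borel_measurable (borel \<Otimes>\<^sub>M (borel \<Otimes>\<^sub>M borel))"
       "(\<lambda>(z, y, x). g i x y z) \<in> borel_measurable (borel \<Otimes>\<^sub>M (borel \<Otimes>\<^sub>M borel))" if "i < n" for i
    unfolding g_def using A[of 0 i] A[of 1 i] A[of 2 i] that by measurable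
  define G where "G = (\<lambda>(x, y, z). \<Prod>i<n. g i (x i) (y i) (z i))"
  have Gm: "G \<in> borel_measurable (?P \<Otimes>\<^sub>M (?P \<Otimes>\<^sub>M ?P))"
  proof -
    have "(\<lambda>p. (\<lambda>(x, y, z). g i x y z) (fst p i, fst (snd p) i, snd (snd p) i)) \<in> borel_measurable (?P \<Otimes>\<^sub>M (?P \<Otimes>\<^sub>M ?P))"
      if "i < n" for i
    proof (rule measurable_compose[OF _ gm(1)[OF that]])
      have [measurable]: "(\<lambda>x. x i) \<in> borel_measurable ?P"
        using that by (intro measurable_component_singleton) simp
      show "(\<lambda>p. (fst p i, fst (snd p) i, snd (snd p) i)) \<in> ?P \<Otimes>\<^sub>M (?P \<Otimes>\<^sub>M ?P) \<rightarrow>\<^sub>M borel \<Otimes>\<^sub>M (borel \<Otimes>\<^sub>M borel)"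
        by (intro measurable_Pair measurable_compose[OF measurable_fst] measurable_compose[OF measurable_snd] measurable_compose[OF _ \<open>(\<lambda>x. x i) \<in> borel_measurable ?P\<close>] measurable_fst measurable_snd)
    qed
    thus ?thesis unfolding G_def by (simp add: split_beta')
  qed
  hence Gm': "G \<in> borel_measurable (?Q \<Otimes>\<^sub>M (?Q \<Otimes>\<^sub>M ?Q))"
    by (simp add: sQ cong: measurable_cong_sets sets_pair_measure_cong)
  have UD: "U k i \<omega> = [D 0 i \<omega> + sqrt 2 / 2 * D 1 i \<omega> + sqrt 6 / 2 * D 2 i \<omega>,
     D 0 i \<omega> + sqrt 2 / 2 * D 1 i \<omega> - sqrt 6 / 2 * D 2 i \<omega>, D 0 i \<omega> - sqrt 2 * D 1 i \<omega>] ! k" if "k < 3" for k i \<omega>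
    using lessThan_3_cases[OF that] by (elim disjE; simp add: split_noise_simps diff_divide_distrib right_diff_distrib)
  have "emeasure M {\<omega> \<in> space M. \<forall>k<3. \<forall>i<n. U k i \<omega> \<in> A k i}
     = (\<integral>\<^sup>+\<omega>. indicator {\<omega> \<in> space M. \<forall>k<3. \<forall>i<n. U k i \<omega> \<in> A k i} \<omega> \<partial>M)"
  proof (intro nn_integral_indicator[symmetric])
    have "{\<omega> \<in> space M. \<forall>k<3. \<forall>i<n. U k i \<omega> \<in> A k i} = {\<omega> \<in> space M. \<forall>k\<in>{..<3}. \<forall>i\<in>{..<n}. U k i \<omega> \<in> A k i}" by auto
    also have "\<dots> \<in> sets M"
      using measurable_U A by (intro sets.sets_Collect_finite_All) (auto intro!: measurable_sets_Collect)
    finally show "{\<omega> \<in> space M. \<forall>k<3. \<forall>i<n. U k i \<omega> \<in> A k i} \<in> sets M" .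
  qed
  also have "\<dots> = (\<integral>\<^sup>+\<omega>. G (V \<omega>) \<partial>M)"
  proof (intro nn_integral_cong)
    fix \<omega> assume \<omega>: "\<omega> \<in> space M"
    have "g i (D 0 i \<omega>) (D 1 i \<omega>) (D 2 i \<omega>) = (\<Prod>k<3. indicator (A k i) (U k i \<omega>))" for i
      unfolding lessThan_3 by (simp add: g_def UD mult.assoc)
    hence "G (V \<omega>) = (\<Prod>i<n. \<Prod>k<3. indicator (A k i) (U k i \<omega>))"
      by (simp add: G_def V_def)
    also have "\<dots> = indicator {\<omega> \<in> space M. \<forall>k<3. \<forall>i<n. U k i \<omega> \<in> A k i} \<omega>"
      using \<omega> by (auto simp: indicator_def prod_eq_1_iff prod_zero_iff)
    finally show "indicator {\<omega> \<in> space M. \<forall>k<3. \<forall>i<n. U k i \<omega> \<in> A k i} \<omega> = G (V \<omega>)" by simp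
  qed
  also have "\<dots> = (\<integral>\<^sup>+p. G p \<partial>distr M (?P \<Otimes>\<^sub>M (?P \<Otimes>\<^sub>M ?P)) V)"
    using V Gm by (simp add: nn_integral_distr)
  also have "distr M (?P \<Otimes>\<^sub>M (?P \<Otimes>\<^sub>M ?P)) V = ?Q \<Otimes>\<^sub>M (?Q \<Otimes>\<^sub>M ?Q)"
    unfolding V_def by (rule distr_source_increments)
  also have "(\<integral>\<^sup>+p. G p \<partial>(?Q \<Otimes>\<^sub>M (?Q \<Otimes>\<^sub>M ?Q))) = (\<integral>\<^sup>+p. \<integral>\<^sup>+x. G (x, p) \<partial>?Q \<partial>(?Q \<Otimes>\<^sub>M ?Q))"
    by (rule QQQ.nn_integral_snd[symmetric]) (use Gm' in simp)
  also have "\<dots> = (\<integral>\<^sup>+z. \<integral>\<^sup>+y. \<integral>\<^sup>+x. G (x, y, z) \<partial>?Q \<partial>?Q \<partial>?Q)"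
  proof -
    have "(\<lambda>(p, x). G (x, p)) \<in> borel_measurable ((?Q \<Otimes>\<^sub>M ?Q) \<Otimes>\<^sub>M ?Q)"
      using measurable_pair_swap[OF Gm'] by simp
    hence "(\<lambda>p. \<integral>\<^sup>+x. G (x, p) \<partial>?Q) \<in> borel_measurable (?Q \<Otimes>\<^sub>M ?Q)"
      by (rule Q.borel_measurable_nn_integral)
    thus ?thesis by (rule QQ.nn_integral_snd[symmetric])
  qed
  also have "\<dots> = (\<Prod>i<n. \<integral>\<^sup>+z. \<integral>\<^sup>+y. \<integral>\<^sup>+x. g i x y z \<partial>\<nu>' i \<partial>\<nu>' i \<partial>\<nu>' i)"
    unfolding G_def Q split_conv
    by (rule PS.triple_product_nn_integral_prod) (use gm(2) in \<open>auto simp: \<nu>'_def cong: measurable_cong_sets sets_pair_measure_cong\<close>)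
  also have "\<dots> = (\<Prod>i<n. \<Prod>k<3. emeasure (\<nu>3 i) (A k i))"
  proof (intro prod.cong refl)
    fix i assume i: "i \<in> {..<n}"
    show "(\<integral>\<^sup>+z. \<integral>\<^sup>+y. \<integral>\<^sup>+x. g i x y z \<partial>\<nu>' i \<partial>\<nu>' i \<partial>\<nu>' i) = (\<Prod>k<3. emeasure (\<nu>3 i) (A k i))"
      using gauss_sample_split[OF \<tau>_step, of i "A 0 i" "A 1 i" "A 2 i"] A i
      unfolding lessThan_3 by (simp add: \<nu>'_def g_def mult.assoc)
  qed
  finally show ?thesis .
qed

text \<open>The marginal comes from a rectangle all of whose sides but one are
  \<open>UNIV\<close>.\<close>

lemma distr_split_increment:
  assumes k: "k < 3" and i: "i < n"
  shows "distr M borel (\<lambda>\<omega>. U k i \<omega>) = \<nu>3 i"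
proof (rule measure_eqI)
  fix B assume "B \<in> sets (distr M borel (\<lambda>\<omega>. U k i \<omega>))"
  hence B: "B \<in> sets borel" by simp
  define A where "A k' i' = (if i' = i then if k' = k then B else UNIV else UNIV)" for k' i'
  have one: "emeasure (\<nu>3 i') UNIV = 1" if "i' < n" for i'
    using prob_space.emeasure_space_1[OF prob_space_gauss[of "sqrt 3 * sqrt (\<tau> (Suc i') - \<tau> i')"]] \<tau>_step[OF that] by simp
  have "emeasure (distr M borel (\<lambda>\<omega>. U k i \<omega>)) B = emeasure M {\<omega> \<in> space M. \<forall>k<3. \<forall>i<n. U k i \<omega> \<in> A k i}"
    using k i B measurable_U[OF k i] by (subst emeasure_distr) (auto simp: A_def intro!: arg_cong[where f="emeasure M"])
  also have "\<dots> = (\<Prod>i'<n. \<Prod>k'<3. emeasure (\<nu>3 i') (A k' i'))"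
    by (rule emeasure_split_increments) (simp add: A_def B)
  also have "\<dots> = (\<Prod>i'<n. if i' = i then (\<Prod>k'<3. if k' = k then emeasure (\<nu>3 i) B else 1) else 1)"
  proof (intro prod.cong refl)
    fix i' assume i': "i' \<in> {..<n}"
    show "(\<Prod>k'<3. emeasure (\<nu>3 i') (A k' i')) = (if i' = i then (\<Prod>k'<3. if k' = k then emeasure (\<nu>3 i) B else 1) else 1)"
    proof (cases "i' = i")
      case True
      have "emeasure (\<nu>3 i) (A k' i) = (if k' = k then emeasure (\<nu>3 i) B else 1)" for k'
        using one[OF i] by (simp add: A_def)
      thus ?thesis using True by simp
    qed (use one i' in \<open>simp add: A_def\<close>)
  qed
  also have "\<dots> = emeasure (\<nu>3 i) B" using k i by simp
  finally show "emeasure (distr M borel (\<lambda>\<omega>. U k i \<omega>)) B = emeasure (\<nu>3 i) B" .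
qed simp

lemma indep_split_increments: "W.indep_vars (\<lambda>_. borel) (\<lambda>(k, i) \<omega>. U k i \<omega>) ({..<3} \<times> {..<n})"
proof (subst W.indep_vars_finite[where E="\<lambda>_. sets borel"])
  show "\<forall>A\<in>{..<3} \<times> {..<n} \<rightarrow> sets borel.
       W.prob (\<Inter>j\<in>{..<3} \<times> {..<n}. (case j of (k, i) \<Rightarrow> \<lambda>\<omega>. U k i \<omega>) -` A j \<inter> space M) =
       (\<Prod>j\<in>{..<3} \<times> {..<n}. W.prob ((case j of (k, i) \<Rightarrow> \<lambda>\<omega>. U k i \<omega>) -` A j \<inter> space M))"
  proof
    fix A :: "nat \<times> nat \<Rightarrow> real set" assume A: "A \<in> {..<3} \<times> {..<n} \<rightarrow> sets borel"
    have mA: "A (k, i) \<in> sets borel" if "k < 3" "i < n" for k i using A that by auto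
    have pr: "emeasure (\<nu>3 i) (A (k, i)) = ennreal (W.prob ((\<lambda>\<omega>. U k i \<omega>) -` A (k, i) \<inter> space M))"
      if "k < 3" "i < n" for k i
      unfolding distr_split_increment[OF that, symmetric] emeasure_distr[OF measurable_U[OF that] mA[OF that]]
      by (rule W.emeasure_eq_measure)
    have "ennreal (W.prob (\<Inter>j\<in>{..<3} \<times> {..<n}. (case j of (k, i) \<Rightarrow> \<lambda>\<omega>. U k i \<omega>) -` A j \<inter> space M))
      = emeasure M {\<omega> \<in> space M. \<forall>k<3. \<forall>i<n. U k i \<omega> \<in> A (k, i)}"
      unfolding W.emeasure_eq_measure[symmetric]
      using \<tau>(1) by (intro arg_cong[where f="emeasure M"]) auto
    also have "\<dots> = (\<Prod>i<n. \<Prod>k<3. ennreal (W.prob ((\<lambda>\<omega>. U k i \<omega>) -` A (k, i) \<inter> space M)))"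
      by (subst emeasure_split_increments) (simp_all add: mA pr)
    also have "\<dots> = (\<Prod>k<3. \<Prod>i<n. ennreal (W.prob ((\<lambda>\<omega>. U k i \<omega>) -` A (k, i) \<inter> space M)))"
      by (rule prod.swap)
    also have "\<dots> = (\<Prod>j\<in>{..<3} \<times> {..<n}. ennreal (W.prob ((case j of (k, i) \<Rightarrow> \<lambda>\<omega>. U k i \<omega>) -` A j \<inter> space M)))"
      by (subst prod.cartesian_product) (auto intro!: prod.cong)
    also have "\<dots> = ennreal (\<Prod>j\<in>{..<3} \<times> {..<n}. W.prob ((case j of (k, i) \<Rightarrow> \<lambda>\<omega>. U k i \<omega>) -` A j \<inter> space M))"
      by (rule prod_ennreal) simp
    finally show "W.prob (\<Inter>j\<in>{..<3} \<times> {..<n}. (case j of (k, i) \<Rightarrow> \<lambda>\<omega>. U k i \<omega>) -` A j \<inter> space M) =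
       (\<Prod>j\<in>{..<3} \<times> {..<n}. W.prob ((case j of (k, i) \<Rightarrow> \<lambda>\<omega>. U k i \<omega>) -` A j \<inter> space M))"
      by (subst (asm) ennreal_inj) (auto intro!: prod_nonneg)
  qed
qed (use \<tau>(1) measurable_U in \<open>auto simp: lessThan_empty_iff bot_nat_def Int_stable_def sets.sigma_sets_eq[of borel, simplified]\<close>)

lemma indep_split_increment_vectors:
  "W.indep_vars (\<lambda>_. PiM {..<n} (\<lambda>_. borel)) (\<lambda>k \<omega>. \<lambda>i\<in>{..<n}. U k i \<omega>) {..<3}"
proof -
  have "W.indep_vars (\<lambda>k. PiM ({k} \<times> {..<n}) (\<lambda>_. borel))
     (\<lambda>k \<omega>. restrict (\<lambda>j. (\<lambda>(k, i) \<omega>. U k i \<omega>) j \<omega>) ({k} \<times> {..<n})) {..<3}"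
    by (rule W.indep_vars_restrict[OF indep_split_increments]) (auto simp: disjoint_family_on_def)
  from W.indep_vars_compose2[OF this, of "\<lambda>k f. \<lambda>i\<in>{..<n}. f (k, i)" "\<lambda>_. PiM {..<n} (\<lambda>_. borel)"]
  have "W.indep_vars (\<lambda>_. PiM {..<n} (\<lambda>_. borel))
     (\<lambda>k \<omega>. \<lambda>i\<in>{..<n}. restrict (\<lambda>j. (\<lambda>(k, i) \<omega>. U k i \<omega>) j \<omega>) ({k} \<times> {..<n}) (k, i)) {..<3}"
    by (auto intro!: measurable_restrict measurable_component_singleton)
  thus ?thesis by (simp cong: restrict_cong)
qed

lemma indep_single_process_increments:
  assumes k: "k < 3"
  shows "W.indep_vars (\<lambda>_. borel) (\<lambda>i \<omega>. U k i \<omega>) {..<n}"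
proof -
  have "W.indep_vars (\<lambda>i. PiM {(k, i)} (\<lambda>_. borel))
     (\<lambda>i \<omega>. restrict (\<lambda>j. (\<lambda>(k, i) \<omega>. U k i \<omega>) j \<omega>) {(k, i)}) {..<n}"
    by (rule W.indep_vars_restrict[OF indep_split_increments]) (use k in \<open>auto simp: disjoint_family_on_def\<close>)
  from W.indep_vars_compose2[OF this, of "\<lambda>i f. f (k, i)" "\<lambda>_. borel"]
  show ?thesis by simp
qed

end

lemma split_noise_starts_at_0: "AE \<omega> in M. \<forall>k<3. N k 0 \<omega> = 0"
  using W.starts_at_0 B1.starts_at_0 B2.starts_at_0
proof eventually_elim
  case (elim \<omega>)
  have "N k 0 \<omega> = 0" if "k < 3" for k
    using elim lessThan_3_cases[OF that] by (elim disjE; simp add: split_noise_simps)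
  thus ?case by simp
qed

lemma gauss_process_split_noise:
  assumes k: "k < 3"
  shows "gauss_process M (sqrt 3) (N k)"
proof unfold_locales
  show "N k t \<in> borel_measurable M" if "t \<in> {0..1}" for t by (rule measurable_split_noise[OF k that])
  show "AE \<omega> in M. N k 0 \<omega> = 0" using split_noise_starts_at_0 k by (auto elim!: eventually_mono)
  fix s t :: real assume st: "0 \<le> s" "s < t" "t \<le> 1"
  show "distr M borel (\<lambda>\<omega>. N k t \<omega> - N k s \<omega>) = gauss (sqrt 3 * sqrt (t - s))"
  proof -
    let ?\<tau> = "\<lambda>i::nat. if i = 0 then s else t"
    have "strict_mono_on {..1} ?\<tau>" "?\<tau> ` {..1} \<subseteq> {0..1}" using st by (auto simp: strict_mono_on_def)
    from distr_split_increment[OF _ this k, of 0] show ?thesis by simp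
  qed
next
  fix n :: nat and \<tau> :: "nat \<Rightarrow> real" assume \<tau>: "strict_mono_on {..n} \<tau>" "\<tau> ` {..n} \<subseteq> {0..1}"
  show "W.indep_vars (\<lambda>_. borel) (\<lambda>i \<omega>. N k (\<tau> (Suc i)) \<omega> - N k (\<tau> i) \<omega>) {..<n}"
  proof (cases "n = 0")
    case True thus ?thesis by (simp add: W.indep_vars_def2 W.indep_sets_def)
  next
    case False thus ?thesis using indep_single_process_increments[OF _ \<tau> k] by simp
  qed
qed simp

text \<open>Cylinder boxes generate the path space and are stable under intersection. Three boxes
  involve finitely many times; on a common partition they become events on the independent increment
  vectors, up to the null set where a noise does not start at zero.\<close>

theorem indep_split_paths: "W.indep_vars (\<lambda>_. path_space) (\<lambda>k. path_of (N k)) {..<3}"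
proof (subst W.indep_vars_finite[where E="\<lambda>_. prod_algebra {0..1} (\<lambda>_. borel)"])
  show "sets path_space = sigma_sets (space path_space) (prod_algebra {0..1} (\<lambda>_. borel))"
    unfolding path_space_def by (simp add: sets_PiM space_PiM)
  show rv: "W.random_variable path_space (path_of (N k))" if "k \<in> {..<3}" for k
    using that by (intro measurable_path_of measurable_split_noise) auto
  show "space path_space \<in> prod_algebra {0..1} (\<lambda>_. borel)"
    unfolding path_space_def space_PiM by (rule space_in_prod_algebra)
  show "prod_algebra {0..1} (\<lambda>_. borel) \<subseteq> Pow (space path_space)"
    unfolding path_space_def space_PiM by (rule prod_algebra_sets_into_space)
  show "\<forall>A\<in>{..<3} \<rightarrow> prod_algebra {0..1} (\<lambda>_. borel).
       W.prob (\<Inter>k\<in>{..<3}. path_of (N k) -` A k \<inter> space M) = (\<Prod>k\<in>{..<3}. W.prob (path_of (N k) -` A k \<inter> space M))"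
  proof
    fix A :: "nat \<Rightarrow> (real \<Rightarrow> real) set" assume A: "A \<in> {..<3} \<rightarrow> prod_algebra {0..1} (\<lambda>_. borel)"
    have "\<forall>k\<in>{..<3}. \<exists>J E. A k = prod_emb {0..1} (\<lambda>_. borel) J (Pi\<^sub>E J E) \<and> finite J \<and> J \<subseteq> {0..1} \<and> (\<forall>i\<in>J. E i \<in> sets borel)"
    proof
      fix k :: nat assume "k \<in> {..<3}"
      hence "A k \<in> prod_algebra {0..1} (\<lambda>_. borel)" using A by auto
      from prod_algebraE[OF this] show "\<exists>J E. A k = prod_emb {0..1} (\<lambda>_. borel) J (Pi\<^sub>E J E) \<and> finite J \<and> J \<subseteq> {0..1} \<and> (\<forall>i\<in>J. E i \<in> sets borel)"
        by metis
    qed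
    then obtain J E where JE: "\<And>k. k < 3 \<Longrightarrow> A k = prod_emb {0..1} (\<lambda>_. borel) (J k) (Pi\<^sub>E (J k) (E k))"
       "\<And>k. k < 3 \<Longrightarrow> finite (J k)" "\<And>k. k < 3 \<Longrightarrow> J k \<subseteq> {0..1}" "\<And>k i. k < 3 \<Longrightarrow> i \<in> J k \<Longrightarrow> E k i \<in> sets borel"
      by (auto simp: bchoice_iff)
    obtain n \<tau> where \<tau>: "0 < (n::nat)" "strict_mono_on {..n} \<tau>" "\<tau> ` {..n} \<subseteq> {0..1}" "\<tau> 0 = 0" "(\<Union>k<3. J k) \<subseteq> \<tau> ` {..n}"
      using times_enumeration[of "\<Union>k<3. J k"] JE(2,3) by blast
    define p where "p t = (SOME i. i \<le> n \<and> \<tau> i = t)" for t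
    have p: "p t \<le> n" "\<tau> (p t) = t" if "k < 3" "t \<in> J k" for k t
    proof -
      have "\<exists>i. i \<le> n \<and> \<tau> i = t" using \<tau>(5) that by auto
      from someI_ex[OF this] show "p t \<le> n" "\<tau> (p t) = t" unfolding p_def by auto
    qed
    let ?P = "PiM {..<n} (\<lambda>_. borel) :: (nat \<Rightarrow> real) measure"
    define V where "V k \<omega> = (\<lambda>i\<in>{..<n}. N k (\<tau> (Suc i)) \<omega> - N k (\<tau> i) \<omega>)" for k \<omega>
    define C where "C k = {v \<in> space ?P. \<forall>t\<in>J k. (\<Sum>i<p t. v i) \<in> E k t}" for k
    have Cm: "C k \<in> sets ?P" if "k < 3" for k
      unfolding C_def using JE(2,4)[OF that] p[OF that]
      by (intro sets.sets_Collect_finite_All measurable_sets_Collect[OF borel_measurable_sum] measurable_component_singleton) force+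
    have ind: "W.indep_vars (\<lambda>_. ?P) V {..<3}"
      unfolding V_def by (rule indep_split_increment_vectors[OF \<tau>(1,2,3)])
    have Vm: "V k \<in> measurable M ?P" if "k < 3" for k using ind that by (auto simp: W.indep_vars_def2)
    have eq: "path_of (N k) \<omega> \<in> A k \<longleftrightarrow> V k \<omega> \<in> C k" if k: "k < 3" and 0: "N k 0 \<omega> = 0" for k \<omega>
    proof -
      have "path_of (N k) \<omega> \<in> A k \<longleftrightarrow> (\<forall>t\<in>J k. N k t \<omega> \<in> E k t)"
        unfolding JE(1)[OF k] prod_emb_def path_of_def using JE(3)[OF k] by (auto simp: space_PiM PiE_iff)
      also have "\<dots> \<longleftrightarrow> (\<forall>t\<in>J k. (\<Sum>i<p t. V k \<omega> i) \<in> E k t)"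
      proof (intro ball_cong refl)
        fix t assume t: "t \<in> J k"
        have "(\<Sum>i<p t. V k \<omega> i) = (\<Sum>i<p t. N k (\<tau> (Suc i)) \<omega> - N k (\<tau> i) \<omega>)"
          using p(1)[OF k t] by (intro sum.cong) (auto simp: V_def)
        also have "\<dots> = N k t \<omega>"
          using sum_lessThan_telescope[of "\<lambda>i. N k (\<tau> i) \<omega>" "p t"] p(2)[OF k t] \<tau>(4) 0 by simp
        finally show "N k t \<omega> \<in> E k t \<longleftrightarrow> (\<Sum>i<p t. V k \<omega> i) \<in> E k t" by simp
      qed
      also have "\<dots> \<longleftrightarrow> V k \<omega> \<in> C k" by (auto simp: C_def V_def space_PiM)
      finally show ?thesis .
    qed
    have Am: "path_of (N k) -` A k \<inter> space M \<in> sets M" if "k < 3" for k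
      using rv[of k] A that unfolding path_space_def
      by (intro measurable_sets[OF rv[of k, unfolded path_space_def]]) (auto simp: sets_PiM)
    have "W.prob (\<Inter>k\<in>{..<3}. path_of (N k) -` A k \<inter> space M) = W.prob (\<Inter>k\<in>{..<3}. V k -` C k \<inter> space M)"
    proof (rule W.finite_measure_eq_AE)
      show "AE \<omega> in M. (\<omega> \<in> (\<Inter>k\<in>{..<3}. path_of (N k) -` A k \<inter> space M)) = (\<omega> \<in> (\<Inter>k\<in>{..<3}. V k -` C k \<inter> space M))"
        using split_noise_starts_at_0 by eventually_elim (simp add: eq)
      show "(\<Inter>k\<in>{..<3}. path_of (N k) -` A k \<inter> space M) \<in> sets M"
        by (intro sets.finite_INT Am) auto
      show "(\<Inter>k\<in>{..<3}. V k -` C k \<inter> space M) \<in> sets M"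
        by (intro sets.finite_INT measurable_sets[OF Vm Cm]) auto
    qed
    also have "\<dots> = (\<Prod>k\<in>{..<3}. W.prob (V k -` C k \<inter> space M))"
      by (rule W.indep_varsD_finite[OF ind]) (auto intro: Cm)
    also have "\<dots> = (\<Prod>k\<in>{..<3}. W.prob (path_of (N k) -` A k \<inter> space M))"
    proof (intro prod.cong refl W.finite_measure_eq_AE)
      fix k :: nat assume "k \<in> {..<3}"
      hence k: "k < 3" by simp
      show "AE \<omega> in M. (\<omega> \<in> V k -` C k \<inter> space M) = (\<omega> \<in> path_of (N k) -` A k \<inter> space M)"
        using split_noise_starts_at_0 by eventually_elim (use k in \<open>simp add: eq\<close>)
    qed (auto intro!: Am measurable_sets[OF Vm Cm])
    finally show "W.prob (\<Inter>k\<in>{..<3}. path_of (N k) -` A k \<inter> space M) = (\<Prod>k\<in>{..<3}. W.prob (path_of (N k) -` A k \<inter> space M))" .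
  qed
qed (auto intro: Int_stable_prod_algebra simp: lessThan_3)

end

section \<open>Gaussian quantiles and tails\<close>

interpretation std_normal: real_distribution std_normal_distribution
  by (rule real_dist_normal_dist)

lemma measure_std_normal_singleton: "measure (gauss 1) {x} = 0"
proof -
  have "AE y in lborel. y \<in> {x} \<longrightarrow> ennreal (normal_density 0 1 y) = 0"
    using AE_lborel_singleton[of x] by eventually_elim simp
  hence "{x} \<in> null_sets (gauss 1)" by (subst null_sets_density_iff) simp_all
  thus ?thesis by (simp add: null_sets_def measure_def)
qed

lemma measure_gauss_affine:
  assumes s: "0 < s"
  shows measure_gauss_le: "measure (gauss s) {x. x \<le> s * a} = Phi a"
    and measure_gauss_greater: "measure (gauss s) {x. s * a < x} = Phi (- a)"
    and measure_gauss_less: "measure (gauss s) {x. x < s * a} = Phi a"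
    and measure_gauss_ge: "measure (gauss s) {x. s * a \<le> x} = Phi (- a)"
proof -
  have sc: "gauss s = distr (gauss 1) borel ((*) s)" using gauss_scale[of 1 s] s by simp
  have sym: "gauss 1 = distr (gauss 1) borel uminus"
  proof -
    have "distributed (gauss 1) lborel (\<lambda>x. x) (normal_density 0 1)"
      by (auto simp: distributed_def distr_id2)
    from std_normal.normal_density_affine[OF this, of "-1" 0]
    have "distributed (gauss 1) lborel uminus (normal_density 0 1)" by simp
    hence "distr (gauss 1) lborel uminus = gauss 1" by (simp add: distributed_def)
    moreover have "distr (gauss 1) borel uminus = distr (gauss 1) lborel uminus" by (rule distr_cong) simp_all
    ultimately show ?thesis by simp
  qed
  note nul = measure_std_normal_singleton
  have le: "measure (gauss 1) {..b} = Phi b" for b by (simp add: Phi_def cdf_def)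
  have lt: "measure (gauss 1) {..<b} = Phi b" for b
  proof -
    have "measure (gauss 1) ({..<b} \<union> {b}) = measure (gauss 1) {..<b} + measure (gauss 1) {b}"
      by (rule std_normal.finite_measure_Union) auto
    moreover have "{..<b} \<union> {b} = {..b}" by auto
    ultimately show ?thesis using le[of b] nul[of b] by (simp only:)
  qed
  have gt: "measure (gauss 1) {b<..} = Phi (-b)" for b
    by (subst sym, subst measure_distr) (auto simp: lt[symmetric] intro!: arg_cong[where f="measure (gauss 1)"])
  have ge: "measure (gauss 1) {b..} = Phi (-b)" for b
    by (subst sym, subst measure_distr) (auto simp: le[symmetric] intro!: arg_cong[where f="measure (gauss 1)"])
  show "measure (gauss s) {x. x \<le> s * a} = Phi a"
    unfolding sc le[symmetric] by (subst measure_distr) (use s in \<open>auto intro!: arg_cong[where f="measure (gauss 1)"]\<close>)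
  show "measure (gauss s) {x. s * a < x} = Phi (- a)"
    unfolding sc gt[symmetric] by (subst measure_distr) (use s in \<open>auto intro!: arg_cong[where f="measure (gauss 1)"]\<close>)
  show "measure (gauss s) {x. x < s * a} = Phi a"
    unfolding sc lt[symmetric] by (subst measure_distr) (use s in \<open>auto intro!: arg_cong[where f="measure (gauss 1)"]\<close>)
  show "measure (gauss s) {x. s * a \<le> x} = Phi (- a)"
    unfolding sc ge[symmetric] by (subst measure_distr) (use s in \<open>auto intro!: arg_cong[where f="measure (gauss 1)"]\<close>)
qed

lemma Phi_uminus: "Phi (- a) = 1 - Phi a"
proof -
  have "measure (gauss 1) {x. 1 * a < x} = measure (gauss 1) (space (gauss 1) - {x. x \<le> 1 * a})"
    by (rule arg_cong[where f="measure (gauss 1)"]) auto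
  also have "\<dots> = 1 - measure (gauss 1) {x. x \<le> 1 * a}"
    by (rule std_normal.prob_compl) simp
  finally show ?thesis using measure_gauss_affine(1,2)[of 1 a] by simp
qed

lemma Phi_0: "Phi 0 = 1 / 2" using Phi_uminus[of 0] by simp

lemma Phi_mono: "a \<le> b \<Longrightarrow> Phi a \<le> Phi b"
  unfolding Phi_def by (rule std_normal.cdf_nondecreasing)

lemma Phi_nonneg: "0 \<le> Phi a" and Phi_le_1: "Phi a \<le> 1"
  unfolding Phi_def by (rule std_normal.cdf_nonneg, rule std_normal.cdf_bounded_prob)

lemma Phi_strict_mono: assumes "a < b" shows "Phi a < Phi b"
proof -
  have pos: "0 < emeasure (gauss 1) {a<..b}"
  proof (rule ccontr)
    assume "\<not> ?thesis"
    hence "{a<..b} \<in> null_sets (gauss 1)" by (auto simp: null_sets_def)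
    hence "AE x in lborel. x \<in> {a<..b} \<longrightarrow> ennreal (normal_density 0 1 x) = 0"
      by (subst (asm) null_sets_density_iff) auto
    hence "AE x in lborel. x \<notin> {a<..b}"
      by eventually_elim (use normal_density_pos[of 1 0] in \<open>auto simp: less_le\<close>)
    hence "emeasure lborel {a<..b} = 0"
      by (subst (asm) AE_iff_measurable[of "{a<..b}"]) auto
    thus False using assms by simp
  qed
  have "Phi b - Phi a = measure (gauss 1) {a<..b}"
    unfolding Phi_def by (rule std_normal.cdf_diff_eq[OF assms])
  thus ?thesis using pos by (simp add: std_normal.emeasure_eq_measure)
qed

lemma Phi_pos: "0 < Phi a" using Phi_strict_mono[of "a - 1" a] Phi_nonneg[of "a - 1"] by simp

lemma Phi_less_1: "Phi a < 1" using Phi_strict_mono[of a "a + 1"] Phi_le_1[of "a + 1"] by simp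

lemma isCont_Phi: "isCont Phi x"
  unfolding Phi_def std_normal.isCont_cdf by (rule measure_std_normal_singleton)

lemma Phi_surj: assumes "0 < p" "p < 1" obtains x where "Phi x = p"
proof -
  have "eventually (\<lambda>x. p < Phi x) at_top"
    unfolding Phi_def by (rule order_tendstoD(1)[OF std_normal.cdf_lim_at_top_prob]) fact
  then obtain b where b: "\<And>x. b \<le> x \<Longrightarrow> p < Phi x" by (auto simp: eventually_at_top_linorder)
  have "eventually (\<lambda>x. Phi x < p) at_bot"
    unfolding Phi_def by (rule order_tendstoD(2)[OF std_normal.cdf_lim_at_bot]) fact
  then obtain a where a: "\<And>x. x \<le> a \<Longrightarrow> Phi x < p" by (auto simp: eventually_at_bot_linorder)
  have "\<exists>x\<ge>min a b. x \<le> b \<and> Phi x = p"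
    by (rule IVT) (use a[of "min a b"] b[of b] isCont_Phi in auto)
  thus ?thesis using that by blast
qed

lemma Phi_z_quantile: assumes "0 < \<beta>" "\<beta> < 1" shows "Phi (z_quantile \<beta>) = 1 - \<beta>"
proof -
  obtain x where "Phi x = 1 - \<beta>" using Phi_surj[of "1 - \<beta>"] assms by auto
  thus ?thesis unfolding z_quantile_def by (metis f_inv_into_f rangeI)
qed

lemma z_quantile_pos: assumes "0 < \<beta>" "\<beta> < 1 / 2" shows "0 < z_quantile \<beta>"
proof (rule ccontr)
  assume "\<not> ?thesis"
  hence "Phi (z_quantile \<beta>) \<le> 1 / 2" using Phi_mono[of "z_quantile \<beta>" 0] Phi_0 by simp
  thus False using Phi_z_quantile[of \<beta>] assms by simp
qed

lemma emeasure_std_normal_Iic: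
  "emeasure (gauss 1) {x. x \<le> a} = (\<integral>\<^sup>+x. ennreal (normal_density 0 1 x) * indicator {x. x \<le> a} x \<partial>lborel)"
  by (rule emeasure_density) simp_all

text \<open>Shifting the normal density by \<open>c\<close> multiplies it by
  \<open>exp (c * x - c\<^sup>2 / 2)\<close>, and \<open>c * x\<close> is nonpositive on the tail
  \<open>x \<le> - z\<close>. This makes error probabilities shrink geometrically away from the
  critical level while keeping the factor \<open>Phi (- z)\<close>.\<close>

lemma Phi_tail_shift:
  assumes z: "0 \<le> z" and c: "0 \<le> c"
  shows "Phi (- (z + c)) \<le> exp (- (c\<^sup>2 / 2)) * Phi (- z)"
proof -
  have em: "emeasure (gauss 1) {x. x \<le> a} = ennreal (Phi a)" for a
    using measure_gauss_affine(1)[of 1 a] by (simp add: std_normal.emeasure_eq_measure)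
  have "ennreal (Phi (- (z + c))) = (\<integral>\<^sup>+x. ennreal (normal_density 0 1 x) * indicator {x. x \<le> - (z + c)} x \<partial>lborel)"
    unfolding em[symmetric] by (rule emeasure_std_normal_Iic)
  also have "\<dots> = (\<integral>\<^sup>+x. ennreal (normal_density 0 1 (- c + x)) * indicator {x. x \<le> - (z + c)} (- c + x) \<partial>lborel)"
    by (subst nn_integral_real_affine[where c=1 and t="-c"]) simp_all
  also have "\<dots> \<le> (\<integral>\<^sup>+x. ennreal (exp (- (c\<^sup>2 / 2))) * (ennreal (normal_density 0 1 x) * indicator {x. x \<le> - z} x) \<partial>lborel)"
  proof (rule nn_integral_mono)
    fix x :: real
    show "ennreal (normal_density 0 1 (- c + x)) * indicator {x. x \<le> - (z + c)} (- c + x)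
       \<le> ennreal (exp (- (c\<^sup>2 / 2))) * (ennreal (normal_density 0 1 x) * indicator {x. x \<le> - z} x)"
    proof (cases "x \<le> - z")
      case True
      have "c * x \<le> 0" using True z c by (intro mult_nonneg_nonpos) auto
      hence "- ((- c + x)\<^sup>2 / 2) \<le> - (c\<^sup>2 / 2) + - (x\<^sup>2 / 2)" by (simp add: power2_eq_square algebra_simps)
      hence "exp (- ((- c + x)\<^sup>2 / 2)) \<le> exp (- (c\<^sup>2 / 2)) * exp (- (x\<^sup>2 / 2))"
        by (simp add: exp_add[symmetric])
      hence "normal_density 0 1 (- c + x) \<le> exp (- (c\<^sup>2 / 2)) * normal_density 0 1 x"
        unfolding std_normal_density_def by (simp add: field_simps)
      thus ?thesis using True by (simp add: ennreal_mult'[symmetric] ennreal_leI)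
    qed simp
  qed
  also have "\<dots> = ennreal (exp (- (c\<^sup>2 / 2))) * ennreal (Phi (- z))"
    by (subst nn_integral_cmult) (simp_all add: em[symmetric] emeasure_std_normal_Iic)
  also have "\<dots> = ennreal (exp (- (c\<^sup>2 / 2)) * Phi (- z))"
    by (simp add: ennreal_mult'[symmetric])
  finally show ?thesis by (subst (asm) ennreal_le_iff) (simp_all add: Phi_nonneg)
qed

lemma Phi_K_const: assumes "0 < \<beta>" "\<beta> < 1" shows "Phi (- 2) ^ K_const \<beta> \<le> \<beta>"
proof -
  let ?r = "ln \<beta> / ln (Phi (- 2))"
  have l: "ln (Phi (- 2)) < 0" using Phi_pos[of "-2"] Phi_less_1[of "-2"] by simp
  have r: "0 \<le> ?r" using l assms by (simp add: divide_nonpos_neg)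
  have "?r \<le> real (K_const \<beta>)" unfolding K_const_def using r by (simp add: le_of_int_ceiling)
  hence "real (K_const \<beta>) * ln (Phi (- 2)) \<le> ln \<beta>" using l by (simp add: field_simps)
  hence "exp (real (K_const \<beta>) * ln (Phi (- 2))) \<le> exp (ln \<beta>)" by simp
  thus ?thesis using assms Phi_pos[of "-2"] by (simp add: exp_of_nat_mult)
qed

text \<open>With the quantile \<open>z\<close>, the second bound exceeds \<open>5 + z\<close>, the
  significance required at the last steep level. The first makes the lower bound on the significance
  grow by 16 with every earlier level.\<close>

lemma K_tilde_ge:
  assumes "0 < \<beta>" "\<beta> < 1"
  shows "16 \<le> (2::real) ^ K_tilde \<beta>" "4 * (2 + z_quantile (\<beta> / 3)) \<le> 2 ^ K_tilde \<beta>"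
proof -
  let ?z = "z_quantile (\<beta> / 3)"
  have z: "0 < ?z" using assms by (intro z_quantile_pos) auto
  have "4 \<le> K_tilde \<beta>" unfolding K_tilde_def by linarith
  hence "(2::real) ^ 4 \<le> 2 ^ K_tilde \<beta>" by (intro power_increasing) auto
  thus "16 \<le> (2::real) ^ K_tilde \<beta>" by simp
  have "2 + log 2 (2 + ?z) \<le> real (K_tilde \<beta>)" unfolding K_tilde_def by linarith
  hence "2 powr (2 + log 2 (2 + ?z)) \<le> 2 powr real (K_tilde \<beta>)" by simp
  moreover have "2 powr (2 + log 2 (2 + ?z)) = 4 * (2 + ?z)" using z by (simp add: powr_add)
  ultimately show "4 * (2 + ?z) \<le> 2 ^ K_tilde \<beta>" by (simp add: powr_realpow)
qed

lemma cdf_max_normal: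
  assumes n: "0 < n"
  shows "cdf (max_normal_distribution n) x = Phi x ^ n"
    and "real_distribution (max_normal_distribution n)"
proof -
  interpret P: product_prob_space "\<lambda>_::nat. std_normal_distribution" "{..<n}" ..
  have m: "(\<lambda>x. Max (x ` {..<n})) \<in> borel_measurable (PiM {..<n} (\<lambda>_::nat. std_normal_distribution))"
  proof (rule borel_measurable_Max[of "{..<n}" "\<lambda>i x. x i", simplified])
    fix i assume "i < n"
    hence "(\<lambda>x. x i) \<in> measurable (PiM {..<n} (\<lambda>_::nat. std_normal_distribution)) std_normal_distribution"
      by (intro measurable_component_singleton) simp
    moreover have "measurable (PiM {..<n} (\<lambda>_::nat. std_normal_distribution)) std_normal_distribution
       = borel_measurable (PiM {..<n} (\<lambda>_::nat. std_normal_distribution))"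
      by (rule measurable_cong_sets) simp_all
    ultimately show "(\<lambda>x. x i) \<in> borel_measurable (PiM {..<n} (\<lambda>_::nat. std_normal_distribution))" by simp
  qed
  have pre: "(\<lambda>x. Max (x ` {..<n})) -` {..x} \<inter> space (PiM {..<n} (\<lambda>_. std_normal_distribution)) = (\<Pi>\<^sub>E i\<in>{..<n}. {..x})"
  proof -
    have "{..<n} \<noteq> {}" using n by auto
    hence "Max (y ` {..<n}) \<le> x \<longleftrightarrow> (\<forall>i\<in>{..<n}. y i \<le> x)" for y :: "nat \<Rightarrow> real"
      by (subst Max_le_iff) auto
    thus ?thesis by (auto simp: space_PiM PiE_iff)
  qed
  have "emeasure (PiM {..<n} (\<lambda>_. std_normal_distribution)) (\<Pi>\<^sub>E i\<in>{..<n}. {..x}) = (\<Prod>i<n. emeasure std_normal_distribution {..x})"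
    by (rule P.emeasure_PiM) simp_all
  also have "\<dots> = ennreal (Phi x ^ n)"
    by (simp add: std_normal.emeasure_eq_measure Phi_def cdf_def ennreal_power)
  finally show "cdf (max_normal_distribution n) x = Phi x ^ n"
    unfolding cdf_def max_normal_distribution_def
    by (subst measure_distr[OF m]) (simp_all add: pre measure_def Phi_nonneg)
  show "real_distribution (max_normal_distribution n)"
    unfolding max_normal_distribution_def
    by (rule prob_space.real_distribution_distr[OF prob_space_PiM m]) (rule std_normal.prob_space_axioms)
qed

text \<open>The cdf is continuous, so the set in the definition of the quantile is closed and
  contains its infimum.\<close>

lemma Phi_S_quantile:
  assumes n: "0 < n" and \<beta>: "0 < \<beta>" "\<beta> < 1"
  shows "1 - \<beta> \<le> Phi (S_quantile n \<beta>) ^ n"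
proof -
  interpret R: real_distribution "max_normal_distribution n" by (rule cdf_max_normal(2)[OF n])
  let ?F = "cdf (max_normal_distribution n)" and ?A = "{x. 1 - \<beta> \<le> cdf (max_normal_distribution n) x}"
  have "eventually (\<lambda>x. 1 - \<beta> < ?F x) at_top"
    by (rule order_tendstoD(1)[OF R.cdf_lim_at_top_prob]) (use \<beta> in simp)
  then obtain b where b: "1 - \<beta> < ?F b" unfolding eventually_at_top_linorder by blast
  have "eventually (\<lambda>x. ?F x < 1 - \<beta>) at_bot"
    by (rule order_tendstoD(2)[OF R.cdf_lim_at_bot]) (use \<beta> in simp)
  then obtain a where a: "\<And>x. x \<le> a \<Longrightarrow> ?F x < 1 - \<beta>" unfolding eventually_at_bot_linorder by blast
  have bdd: "bdd_below ?A"
  proof (rule bdd_belowI[of _ a])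
    fix x assume "x \<in> ?A"
    thus "a \<le> x" using a[of x] by (cases "x \<le> a") auto
  qed
  have "closed ?A"
  proof -
    have "continuous_on UNIV Phi" by (simp add: isCont_Phi continuous_at_imp_continuous_on)
    hence "continuous_on UNIV (\<lambda>x. Phi x ^ n)" by (rule continuous_on_power)
    hence "closed {x. 1 - \<beta> \<le> Phi x ^ n}" by (intro closed_Collect_le continuous_on_const)
    thus ?thesis by (simp add: cdf_max_normal(1)[OF n])
  qed
  hence "Inf ?A \<in> ?A" using less_imp_le[OF b] bdd by (intro closed_contains_Inf) auto
  thus ?thesis unfolding S_quantile_def quantile_def by (simp add: cdf_max_normal(1)[OF n])
qed

section \<open>Dyadic localization and stopping windows\<close>

lemma mesh_pos: "0 < mesh j" by (simp add: mesh_def)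

lemma mesh_Suc: "mesh j = 2 * mesh (Suc j)" by (simp add: mesh_def)

lemma mesh_add: "mesh (j + k) = mesh j / 2 ^ k" by (simp add: mesh_def power_add)

lemma mesh_antimono: "j \<le> k \<Longrightarrow> mesh k \<le> mesh j"
  by (simp add: mesh_def power_increasing divide_left_mono)

lemma grid_le_1_iff: "grid j i \<le> 1 \<longleftrightarrow> i \<le> 2 ^ j"
proof -
  have "grid j i \<le> 1 \<longleftrightarrow> real_of_int i \<le> real_of_int (2 ^ j)" by (simp add: grid_def mesh_def field_simps)
  thus ?thesis by (simp only: of_int_le_iff)
qed

lemma grid_nonneg_iff: "0 \<le> grid j i \<longleftrightarrow> 0 \<le> i"
  using mesh_pos[of j] by (simp add: grid_def zero_le_mult_iff)

lemma grid_in_unit: "0 \<le> i \<Longrightarrow> i \<le> 2 ^ j \<Longrightarrow> grid j i \<in> {0..1}"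
  by (simp add: grid_le_1_iff grid_nonneg_iff)

lemma grid_le_iff: "grid j a \<le> grid j b \<longleftrightarrow> a \<le> b"
  using mesh_pos[of j] by (simp add: grid_def)

lemma grid_refine: "j \<le> J \<Longrightarrow> grid j i = grid J (i * 2 ^ (J - j))"
proof -
  assume "j \<le> J"
  hence "(2::real) ^ J = 2 ^ j * 2 ^ (J - j)" by (simp add: power_add[symmetric])
  thus ?thesis by (simp add: grid_def mesh_def)
qed

lemma grid_Suc: "grid j i = grid (Suc j) (2 * i)"
  using grid_refine[of j "Suc j" i] by (simp add: mult.commute)

lemma i_hat_Suc:
  shows i_hat_Suc_mem: "i_hat y (Suc j) \<in> {2 * i_hat y j - 2 .. 2 * i_hat y j + 1}"
    and i_hat_Suc_min: "\<And>i. i \<in> {2 * i_hat y j - 2 .. 2 * i_hat y j + 1} \<Longrightarrow>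
       incr y (Suc j) (i_hat y (Suc j)) \<le> incr y (Suc j) i"
proof -
  let ?S = "{2 * i_hat y j - 2 .. 2 * i_hat y j + 1}"
  have "?S \<noteq> {}" by simp
  from arg_min_if_finite[OF _ this, of "incr y (Suc j)"]
  show "i_hat y (Suc j) \<in> ?S" and "\<And>i. i \<in> ?S \<Longrightarrow> incr y (Suc j) (i_hat y (Suc j)) \<le> incr y (Suc j) i"
    by (auto simp: not_less)
qed

text \<open>The candidate \<open>2 * i_hat y j\<close> is always a genuine cell with a finite
  increment, so the minimizing candidate is finite too.\<close>

lemma i_hat_range: "1 \<le> i_hat y j \<and> i_hat y j \<le> 2 ^ j"
proof (induction j)
  case (Suc j)
  have "2 * i_hat y j \<in> {2 * i_hat y j - 2 .. 2 * i_hat y j + 1}" by simp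
  from i_hat_Suc_min[OF this]
  have "incr y (Suc j) (i_hat y (Suc j)) \<le> incr y (Suc j) (2 * i_hat y j)" .
  moreover have "incr y (Suc j) (2 * i_hat y j) < \<infinity>" using Suc by (simp add: incr_def)
  ultimately have "incr y (Suc j) (i_hat y (Suc j)) < \<infinity>" by order
  thus ?case by (auto simp: incr_def split: if_splits)
qed simp

text \<open>Every window used after level \<open>j\<close> lies in \<open>loc_hull y j\<close>.\<close>

definition loc_hull :: "(real \<Rightarrow> real) \<Rightarrow> nat \<Rightarrow> real set" where
  "loc_hull y j = {grid (Suc j) (2 * i_hat y j - 9) .. grid (Suc j) (2 * i_hat y j + 7)}"

text \<open>A child index lies between \<open>2 * i - 2\<close> and \<open>2 * i + 1\<close>, and
  its windows reach 7 cells to the left and 6 to the right: this gives the offsets -9 and 7 of the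
  hull.\<close>

lemma hull_Suc:
  "grid (Suc j) (2 * i_hat y j - 9) \<le> grid (Suc j) (i_hat y (Suc j) - 7)"
  "grid (Suc j) (i_hat y (Suc j) + 6) \<le> grid (Suc j) (2 * i_hat y j + 7)"
  using i_hat_Suc_mem[of y j] by (auto simp: grid_le_iff)

text \<open>The hulls are nested: in units of level \<open>j + 1\<close> the hull after level
  \<open>j\<close> spans \<open>2 * i - 9\<close> to \<open>2 * i + 7\<close>, inside the range
  \<open>2 * i - 14\<close> to \<open>2 * i + 12\<close> of the windows of level \<open>j\<close>,
  which lies in the previous hull.\<close>

lemma window_in_hull:
  assumes "j < k"
  shows "grid (Suc j) (2 * i_hat y j - 9) \<le> grid k (i_hat y k - 7) \<and>
    grid k (i_hat y k + 6) \<le> grid (Suc j) (2 * i_hat y j + 7)"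
  using assms
proof (induction k rule: less_Suc_induct)
  case (1 j)
  show ?case using hull_Suc[of j y] by simp
next
  case (2 i j k)
  have "grid j (i_hat y j - 7) \<le> grid (Suc j) (2 * i_hat y j - 9)"
    unfolding grid_Suc[of j] by (simp add: grid_le_iff)
  moreover have "grid (Suc j) (2 * i_hat y j + 7) \<le> grid j (i_hat y j + 6)"
    unfolding grid_Suc[of j] by (simp add: grid_le_iff)
  ultimately show ?case using 2 by linarith
qed

lemma unit_subset_hull_0: "{0..1} \<subseteq> loc_hull y 0"
  by (auto simp: loc_hull_def grid_def mesh_def)

text \<open>\<open>False\<close> stands for the left window, \<open>True\<close> for the right one.\<close>

definition win :: "(real \<Rightarrow> real) \<Rightarrow> bool \<Rightarrow> nat \<Rightarrow> int" where
  "win y r j = (if r then i_hat y j + 4 else i_hat y j - 7)"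

text \<open>The increment over cell \<open>w + 2\<close> minus that over cell \<open>w + 1\<close>.
  On the right window this is the statistic of the stopping rule; on the left window it is its
  negative, which \<open>sgn_side\<close> corrects.\<close>

definition sdiff :: "(real \<Rightarrow> real) \<Rightarrow> nat \<Rightarrow> int \<Rightarrow> real" where
  "sdiff y j w = (y (grid j (w + 2)) - y (grid j (w + 1))) - (y (grid j (w + 1)) - y (grid j w))"

definition sgn_side :: "bool \<Rightarrow> real" where "sgn_side r = (if r then 1 else -1)"

definition in_range :: "nat \<Rightarrow> int \<Rightarrow> bool" where "in_range j w \<longleftrightarrow> 0 \<le> w \<and> w + 2 \<le> 2 ^ j"

lemma T_stat_le:
  assumes "in_range j (win yl r j)"
  shows "T_stat yl ys j \<le> ereal (sgn_side r * sdiff ys j (win yl r j))"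
  using assms unfolding T_stat_def in_range_def win_def sgn_side_def sdiff_def incr_def
  by (auto simp: min_le_iff_disj algebra_simps)

text \<open>A window that leaves the grid contributes infinity to the minimum, so only windows
  inside the grid have to be checked.\<close>

lemma T_stat_ge:
  assumes "\<And>r. in_range j (win yl r j) \<Longrightarrow> a < sgn_side r * sdiff ys j (win yl r j)"
  shows "ereal a < T_stat yl ys j"
proof -
  have 1: "ereal a < incr ys j (i + 6) - incr ys j (i + 5)"
    if "in_range j (i + 4) \<Longrightarrow> a < sdiff ys j (i + 4)" "1 \<le> i" for i
    using that unfolding in_range_def sdiff_def incr_def by (auto simp: algebra_simps)
  have 2: "ereal a < incr ys j (i - 6) - incr ys j (i - 5)"
    if "in_range j (i - 7) \<Longrightarrow> a < - sdiff ys j (i - 7)" "i \<le> 2 ^ j" for i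
    using that unfolding in_range_def sdiff_def incr_def by (auto simp: algebra_simps)
  show ?thesis unfolding T_stat_def
    using 1[of "i_hat yl j"] 2[of "i_hat yl j"] assms[of True] assms[of False] i_hat_range[of yl j]
    by (simp add: win_def sgn_side_def)
qed

text \<open>In units of level \<open>j + 1\<close> the windows of level \<open>j\<close> end at
  \<open>2 * i - 10\<close> and begin at \<open>2 * i + 8\<close>. The hull, which holds all later
  windows, lies strictly between. This is the reason for the distance of the tested cells from
  \<open>i_hat\<close>.\<close>

lemma windows_disjoint:
  assumes "j < k"
  shows "grid k (win y r' k + 2) \<le> grid j (win y r j) \<or> grid j (win y r j + 2) \<le> grid k (win y r' k)"
proof -
  have "grid k (win y r' k + 2) \<le> grid k (i_hat y k + 6)" "grid k (i_hat y k - 7) \<le> grid k (win y r' k)"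
    by (simp_all add: grid_le_iff win_def)
  moreover have "grid (Suc j) (2 * i_hat y j + 7) \<le> grid j (i_hat y j + 4)"
     "grid j (i_hat y j - 5) \<le> grid (Suc j) (2 * i_hat y j - 9)"
    unfolding grid_Suc[of j] by (simp_all add: grid_le_iff)
  moreover have "win y r j = i_hat y j + 4 \<or> win y r j + 2 = i_hat y j - 5"
    by (simp add: win_def)
  ultimately show ?thesis using window_in_hull[OF assms, of y] by (metis order_trans)
qed

lemma sigma_pos: "0 < \<epsilon> \<Longrightarrow> 0 < sigma \<epsilon> j" by (simp add: sigma_def mesh_pos)

lemma stop_iff:
  assumes "0 < \<epsilon>"
  shows "T_stat yl ys j / ereal (sigma \<epsilon> j) \<le> 2 \<longleftrightarrow> T_stat yl ys j \<le> ereal (2 * sigma \<epsilon> j)"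
proof (cases "T_stat yl ys j")
  case (real x) thus ?thesis using sigma_pos[OF assms, of j] by (simp add: divide_le_eq)
next
  case PInf thus ?thesis using sigma_pos[OF assms, of j] by simp
next
  case MInf thus ?thesis using sigma_pos[OF assms, of j] by simp
qed

definition no_stop :: "real \<Rightarrow> (real \<Rightarrow> real) \<Rightarrow> (real \<Rightarrow> real) \<Rightarrow> nat \<Rightarrow> bool" where
  "no_stop \<epsilon> yl ys j \<longleftrightarrow> ereal (2 * sigma \<epsilon> j) < T_stat yl ys j"

lemma j_hat_eq: "0 < \<epsilon> \<Longrightarrow> j_hat \<epsilon> yl ys = (LEAST j. \<not> no_stop \<epsilon> yl ys j)"
  by (simp only: j_hat_def no_stop_def stop_iff not_less)

lemma no_stop_less_j_hat: "0 < \<epsilon> \<Longrightarrow> j < j_hat \<epsilon> yl ys \<Longrightarrow> no_stop \<epsilon> yl ys j"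
  using not_less_Least[of j] by (auto simp: j_hat_eq)

lemma stop_at_j_hat: "0 < \<epsilon> \<Longrightarrow> \<not> no_stop \<epsilon> yl ys j \<Longrightarrow> \<not> no_stop \<epsilon> yl ys (j_hat \<epsilon> yl ys)"
  using LeastI[of "\<lambda>j. \<not> no_stop \<epsilon> yl ys j" j] by (simp add: j_hat_eq)

section \<open>Gaussian increments over dyadic cells\<close>

context gauss_process
begin

lemma grid_indep:
  "indep_vars (\<lambda>_. borel) (\<lambda>i \<omega>. X (grid J (int i + 1)) \<omega> - X (grid J (int i)) \<omega>) {..<2 ^ J}"
proof -
  have "strict_mono_on {..2 ^ J} (\<lambda>i. grid J (int i))"
    by (auto simp: strict_mono_on_def grid_def mesh_pos)
  moreover have "(\<lambda>i. grid J (int i)) ` {..2 ^ J} \<subseteq> {0..1}"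
    using grid_in_unit by fastforce
  ultimately have "indep_vars (\<lambda>_. borel) (\<lambda>i \<omega>. X (grid J (int (Suc i))) \<omega> - X (grid J (int i)) \<omega>) {..<2 ^ J}"
    by (rule indep_increments)
  thus ?thesis by (simp add: add.commute)
qed

lemma measurable_grid: "0 \<le> i \<Longrightarrow> i \<le> 2 ^ j \<Longrightarrow> X (grid j i) \<in> borel_measurable M"
  by (intro measurable_at grid_in_unit)

lemma distr_cell:
  assumes "1 \<le> i" "i \<le> 2 ^ j"
  shows "distr M borel (\<lambda>\<omega>. X (grid j i) \<omega> - X (grid j (i - 1)) \<omega>) = gauss (c * sqrt (mesh j))"
proof -
  have "grid j i - grid j (i - 1) = mesh j" by (simp add: grid_def algebra_simps)
  moreover have "0 \<le> grid j (i - 1)" "grid j i \<le> 1" using assms by (simp_all add: grid_nonneg_iff grid_le_1_iff)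
  moreover have "grid j (i - 1) < grid j i" by (simp add: grid_def mesh_pos)
  ultimately show ?thesis using distr_increment[of "grid j (i - 1)" "grid j i"] by simp
qed

lemma distr_cell_diff:
  assumes a: "1 \<le> a" "a \<le> 2 ^ j" and b: "1 \<le> b" "b \<le> 2 ^ j" and ab: "a \<noteq> b"
  shows "distr M borel (\<lambda>\<omega>. (X (grid j a) \<omega> - X (grid j (a - 1)) \<omega>) - (X (grid j b) \<omega> - X (grid j (b - 1)) \<omega>))
     = gauss (c * sqrt (2 * mesh j))"
proof -
  let ?C = "\<lambda>a \<omega>. X (grid j a) \<omega> - X (grid j (a - 1)) \<omega>"
  have meas: "?C a \<in> borel_measurable M" if "1 \<le> a" "a \<le> 2 ^ j" for a
    using that by (intro borel_measurable_diff measurable_grid) auto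
  have dist: "distributed M lborel (?C a) (normal_density 0 (c * sqrt (mesh j)))" if "1 \<le> a" "a \<le> 2 ^ j" for a
  proof -
    have "distr M lborel (?C a) = distr M borel (?C a)" by (rule distr_cong) simp_all
    thus ?thesis using distr_cell[OF that] meas[OF that] by (simp add: distributed_def)
  qed
  have nat: "nat (a - 1) \<in> {..<2 ^ j}" "int (nat (a - 1)) = a - 1" if "1 \<le> a" "a \<le> 2 ^ j" for a
    using that by (auto simp: nat_less_iff)
  have "indep_var borel ((\<lambda>f. f (nat (a - 1))) \<circ> (\<lambda>\<omega>. restrict (\<lambda>i. X (grid j (int i + 1)) \<omega> - X (grid j (int i)) \<omega>) {nat (a - 1)}))
      borel ((\<lambda>f. f (nat (b - 1))) \<circ> (\<lambda>\<omega>. restrict (\<lambda>i. X (grid j (int i + 1)) \<omega> - X (grid j (int i)) \<omega>) {nat (b - 1)}))"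
    using nat(1)[OF a] nat(1)[OF b] a b ab
    by (intro indep_var_compose[OF indep_var_restrict[OF grid_indep[of j]]]) (auto simp: nat_eq_iff)
  hence "indep_var borel (?C a) borel (?C b)"
    using nat(2)[OF a] nat(2)[OF b] by (simp add: comp_def)
  from diff_indep_normal[OF this _ _ dist[OF a] dist[OF b]]
  have "distributed M lborel (\<lambda>\<omega>. ?C a \<omega> - ?C b \<omega>) (normal_density 0 (sqrt ((c * sqrt (mesh j))\<^sup>2 + (c * sqrt (mesh j))\<^sup>2)))"
    using c_pos mesh_pos[of j] by simp
  moreover have "sqrt ((c * sqrt (mesh j))\<^sup>2 + (c * sqrt (mesh j))\<^sup>2) = c * sqrt (2 * mesh j)"
    using c_pos mesh_pos[of j] by (intro real_sqrt_unique) (simp_all add: power_mult_distrib)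
  ultimately have "distr M lborel (\<lambda>\<omega>. ?C a \<omega> - ?C b \<omega>) = gauss (c * sqrt (2 * mesh j))"
    by (simp add: distributed_def)
  moreover have "distr M borel (\<lambda>\<omega>. ?C a \<omega> - ?C b \<omega>) = distr M lborel (\<lambda>\<omega>. ?C a \<omega> - ?C b \<omega>)"
    by (rule distr_cong) simp_all
  ultimately show ?thesis by simp
qed

lemma distr_sdiff:
  assumes "in_range j w"
  shows "distr M borel (\<lambda>\<omega>. sdiff (\<lambda>t. X t \<omega>) j w) = gauss (c * sqrt (2 * mesh j))"
proof -
  have e: "w + 2 - 1 = w + 1" "w + 1 - 1 = w" by auto
  show ?thesis unfolding sdiff_def
    by (rule distr_cell_diff[of "w + 2" j "w + 1", unfolded e]) (use assms in \<open>auto simp: in_range_def\<close>)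
qed

lemma measurable_sdiff: "in_range j w \<Longrightarrow> (\<lambda>\<omega>. sdiff (\<lambda>t. X t \<omega>) j w) \<in> borel_measurable M"
  unfolding sdiff_def in_range_def by (intro borel_measurable_diff measurable_grid) auto

lemma grid_telescope:
  assumes "j \<le> J" "0 \<le> a" "a \<le> b" "b \<le> 2 ^ j"
  shows "X (grid j b) \<omega> - X (grid j a) \<omega>
    = (\<Sum>i\<in>{nat a * 2 ^ (J - j) ..< nat b * 2 ^ (J - j)}. X (grid J (int i + 1)) \<omega> - X (grid J (int i)) \<omega>)"
proof -
  have le: "nat a * 2 ^ (J - j) \<le> nat b * 2 ^ (J - j)" using assms by (simp add: nat_mono)
  have "(\<Sum>i\<in>{nat a * 2 ^ (J - j) ..< nat b * 2 ^ (J - j)}. X (grid J (int (Suc i))) \<omega> - X (grid J (int i)) \<omega>)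
     = X (grid J (int (nat b * 2 ^ (J - j)))) \<omega> - X (grid J (int (nat a * 2 ^ (J - j)))) \<omega>"
    by (rule sum_Suc_diff'[OF le])
  thus ?thesis using assms by (simp add: grid_refine[of j J] add.commute)
qed

text \<open>All windows are refined to one common level \<open>J\<close>, where a cell of level
  \<open>j\<close> consists of \<open>q j\<close> fine cells. Each statistic is then a function of
  the fine increments in its index block \<open>K j\<close>, and disjoint windows have disjoint
  blocks.\<close>

lemma indep_sdiff:
  fixes w :: "nat \<Rightarrow> int"
  assumes fin: "finite A" and w: "\<And>j. j \<in> A \<Longrightarrow> in_range j (w j)"
    and disj: "\<And>j k. j \<in> A \<Longrightarrow> k \<in> A \<Longrightarrow> j < k \<Longrightarrow>
       grid k (w k + 2) \<le> grid j (w j) \<or> grid j (w j + 2) \<le> grid k (w k)"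
  shows "indep_vars (\<lambda>_. borel) (\<lambda>j \<omega>. sdiff (\<lambda>t. X t \<omega>) j (w j)) A"
proof -
  obtain J where J: "\<And>j. j \<in> A \<Longrightarrow> j \<le> J" using fin by (metis finite_nat_set_iff_bounded_le)
  define q where "q j = (2::nat) ^ (J - j)" for j
  define K where "K j = {nat (w j) * q j ..< nat (w j + 2) * q j}" for j
  define D where "D i \<omega> = X (grid J (int i + 1)) \<omega> - X (grid J (int i)) \<omega>" for i \<omega>
  have sub: "K j \<subseteq> {..<2 ^ J}" if "j \<in> A" for j
  proof -
    have "nat (w j + 2) \<le> 2 ^ j" using w[OF that] by (simp add: in_range_def nat_le_iff)
    hence "nat (w j + 2) * q j \<le> 2 ^ j * 2 ^ (J - j)" unfolding q_def by (intro mult_right_mono) auto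
    also have "\<dots> = 2 ^ J" using J[OF that] by (simp add: power_add[symmetric])
    finally show ?thesis by (auto simp: K_def)
  qed
  have dj: "K j \<inter> K k = {}" if "j \<in> A" "k \<in> A" "j < k" for j k
  proof -
    have g: "nat a * q j \<le> nat b * q k" if "grid j a \<le> grid k b" "j \<in> A" "k \<in> A" "0 \<le> a" "0 \<le> b" for a b j k
    proof -
      have "a * 2 ^ (J - j) \<le> b * 2 ^ (J - k)"
        using that(1) grid_refine[OF J[OF that(2)], of a] grid_refine[OF J[OF that(3)], of b] by (simp add: grid_le_iff)
      hence "int (nat a * q j) \<le> int (nat b * q k)" using that by (simp add: q_def)
      thus ?thesis by (simp only: of_nat_le_iff)
    qed
    show ?thesis using disj[OF that] w[OF that(1)] w[OF that(2)] g[of k "w k + 2" j "w j"] g[of j "w j + 2" k "w k"] that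
      unfolding K_def in_range_def by auto
  qed
  define Y where "Y j f = (\<Sum>i\<in>{nat (w j + 1) * q j ..< nat (w j + 2) * q j}. f i)
       - (\<Sum>i\<in>{nat (w j) * q j ..< nat (w j + 1) * q j}. f i)" for j and f :: "nat \<Rightarrow> real"
  have le: "nat (w j) * q j \<le> nat (w j + 1) * q j" "nat (w j + 1) * q j \<le> nat (w j + 2) * q j" for j
    by (intro mult_right_mono nat_mono; simp)+
  have sub1: "{nat (w j + 1) * q j ..< nat (w j + 2) * q j} \<subseteq> K j" for j
    using le(1)[of j] unfolding K_def by (meson atLeastLessThan_iff order_trans subsetI)
  have sub2: "{nat (w j) * q j ..< nat (w j + 1) * q j} \<subseteq> K j" for j
    using le(2)[of j] unfolding K_def by (meson atLeastLessThan_iff order_less_le_trans subsetI)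
  have ind: "indep_vars (\<lambda>j. PiM (K j) (\<lambda>_. borel)) (\<lambda>j \<omega>. restrict (\<lambda>i. D i \<omega>) (K j)) A"
  proof (rule indep_vars_restrict)
    show "indep_vars (\<lambda>_. borel) D {..<2 ^ J}" unfolding D_def by (rule grid_indep)
    show "disjoint_family_on K A" unfolding disjoint_family_on_def
      using dj by (metis Int_commute linorder_neqE_nat)
  qed (rule sub)
  have Ym: "Y j \<in> borel_measurable (PiM (K j) (\<lambda>_. borel))" for j
    unfolding Y_def using sub1[of j] sub2[of j]
    by (intro borel_measurable_diff borel_measurable_sum measurable_component_singleton) blast+
  have eq: "Y j (restrict (\<lambda>i. D i \<omega>) (K j)) = sdiff (\<lambda>t. X t \<omega>) j (w j)" if j: "j \<in> A" for j \<omega>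
  proof -
    have "(\<Sum>i\<in>B. restrict (\<lambda>i. D i \<omega>) (K j) i) = (\<Sum>i\<in>B. D i \<omega>)" if "B \<subseteq> K j" for B
      using that by (intro sum.cong) auto
    note r = this[OF sub1] this[OF sub2]
    show ?thesis unfolding Y_def r unfolding D_def q_def
      using grid_telescope[OF J[OF j], of "w j + 1" "w j + 2" \<omega>] grid_telescope[OF J[OF j], of "w j" "w j + 1" \<omega>] w[OF j]
      by (simp add: in_range_def sdiff_def)
  qed
  have "indep_vars (\<lambda>_. borel) (\<lambda>j \<omega>. Y j (restrict (\<lambda>i. D i \<omega>) (K j))) A"
    by (rule indep_vars_compose2[OF ind]) (rule Ym)
  also have "?this \<longleftrightarrow> ?thesis"
    by (rule indep_vars_cong) (simp_all add: eq)
  finally show ?thesis .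
qed

end

section \<open>Drift of a convex function over dyadic cells\<close>

lemma set_integral_Icc_diff:
  fixes h :: "real \<Rightarrow> real"
  assumes h: "set_integrable lborel {0..1} h" and ab: "0 \<le> a" "a \<le> b" "b \<le> 1"
  shows "(LBINT t:{0..b}. h t) - (LBINT t:{0..a}. h t) = (LBINT t:{a..b}. h t)"
proof -
  have "{0..b} = {0..a} \<union> {a<..b}" using ab by auto
  hence "(LBINT t:{0..b}. h t) = (LBINT t:{0..a} \<union> {a<..b}. h t)" by simp
  also have "(LBINT t:{0..a} \<union> {a<..b}. h t) = (LBINT t:{0..a}. h t) + (LBINT t:{a<..b}. h t)"
    by (rule set_integral_Un) (use ab in \<open>auto intro: set_integrable_subset[OF h]\<close>)
  also have "(LBINT t:{a<..b}. h t) = (LBINT t:{a..b}. h t)"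
    by (rule set_integral_discrete_difference[where X="{a}"]) auto
  finally show ?thesis by simp
qed

locale convex_min =
  fixes f :: "real \<Rightarrow> real"
  assumes f: "f \<in> conv_class"
begin

definition "Z = minimizer f"
definition "m0 = minimum f"
definition "F t = (LBINT s:{0..t}. f s)"

lemma conv: "convex_on {0..1} f"
  using f by (simp add: conv_class_def)

lemma is_min: "is_minimizer f Z"
  unfolding Z_def minimizer_def using f by (auto simp: conv_class_def intro: theI')

lemma Z: "0 \<le> Z" "Z \<le> 1" using is_min by (auto simp: is_minimizer_def)

lemma f_Z: "f Z = m0" by (simp add: m0_def minimum_def Z_def)

lemma m0_le: "0 \<le> t \<Longrightarrow> t \<le> 1 \<Longrightarrow> m0 \<le> f t"
  using is_min f_Z by (auto simp: is_minimizer_def)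

lemma chord:
  assumes "0 \<le> a" "a < c" "c \<le> 1" "a \<le> b" "b \<le> c"
  shows "(c - a) * f b \<le> (c - b) * f a + (b - a) * f c"
proof -
  define u where "u = (b - a) / (c - a)"
  have u: "(c - a) * u = b - a" using assms by (simp add: u_def)
  have u01: "0 \<le> u" "u \<le> 1" using assms by (auto simp: u_def)
  have "b = a + (c - a) * u" using u by simp
  hence e: "b = (1 - u) *\<^sub>R a + u *\<^sub>R c" by (simp add: algebra_simps)
  have "f ((1 - u) *\<^sub>R a + u *\<^sub>R c) \<le> (1 - u) * f a + u * f c"
    by (rule convex_onD[OF conv]) (use assms u01 in auto)
  hence "(c - a) * f b \<le> (c - a) * ((1 - u) * f a + u * f c)"
    using e assms by (intro mult_left_mono) auto
  also have "\<dots> = (c - a) * f a + ((c - a) * u) * (f c - f a)" by (simp add: algebra_simps)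
  finally show ?thesis unfolding u by (simp add: algebra_simps)
qed

text \<open>Both slopes are compared with the slope over \<open>[a, d]\<close>. The intervals may
  overlap, and the cross-multiplied form avoids divisions by their lengths.\<close>

lemma slope_mono:
  assumes "0 \<le> a" "a < b" "a \<le> c" "b \<le> d" "c < d" "d \<le> 1"
  shows "(f b - f a) * (d - c) \<le> (f d - f c) * (b - a)"
proof -
  have 1: "(f b - f a) * (d - a) \<le> (f d - f a) * (b - a)"
    using chord[of a d b] assms by (simp add: algebra_simps)
  have 2: "(f d - f a) * (d - c) \<le> (f d - f c) * (d - a)"
    using chord[of a d c] assms by (simp add: algebra_simps)
  have "(f b - f a) * (d - c) * (d - a) \<le> (f d - f a) * (b - a) * (d - c)"
    using mult_right_mono[OF 1, of "d - c"] assms by (simp add: ac_simps)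
  also have "\<dots> \<le> (f d - f c) * (d - a) * (b - a)"
    using mult_right_mono[OF 2, of "b - a"] assms by (simp add: ac_simps)
  finally have "((f b - f a) * (d - c)) * (d - a) \<le> ((f d - f c) * (b - a)) * (d - a)" by (simp add: ac_simps)
  thus ?thesis by (rule mult_right_le_imp_le) (use assms in auto)
qed

lemma mono_right:
  assumes "Z \<le> s" "s \<le> t" "t \<le> 1"
  shows "f s \<le> f t"
proof (cases "s = t \<or> s = Z")
  case True thus ?thesis using m0_le[of t] f_Z Z assms by auto
next
  case False
  have "(f s - f Z) * (t - s) \<le> (f t - f s) * (s - Z)"
    using slope_mono[of Z s s t] assms False Z by simp
  moreover have "0 \<le> (f s - f Z) * (t - s)" using m0_le[of s] f_Z assms Z by simp
  ultimately have "0 \<le> (f t - f s) * (s - Z)" by linarith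
  moreover have "0 < s - Z" using False assms by simp
  ultimately show ?thesis by (simp add: zero_le_mult_iff)
qed

lemma mono_left:
  assumes "0 \<le> s" "s \<le> t" "t \<le> Z"
  shows "f t \<le> f s"
proof (cases "s = t \<or> t = Z")
  case True thus ?thesis using m0_le[of s] f_Z Z assms by auto
next
  case False
  have "(f t - f s) * (Z - t) \<le> (f Z - f t) * (t - s)"
    using slope_mono[of s t t Z] assms False Z by simp
  moreover have "(f Z - f t) * (t - s) \<le> 0" using m0_le[of t] f_Z assms Z by (simp add: mult_nonpos_nonneg)
  ultimately have "(f t - f s) * (Z - t) \<le> 0" by linarith
  moreover have "0 < Z - t" using False assms by simp
  ultimately show ?thesis by (simp add: mult_le_0_iff)
qed

definition "fmax = max (f 0) (f 1)"

lemma f_le_fmax: assumes "0 \<le> t" "t \<le> 1" shows "f t \<le> fmax"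
  using mono_right[of t 1] mono_left[of 0 t] assms unfolding fmax_def by (cases "t \<le> Z") auto

text \<open>A convex function may jump at the ends of its domain. Continuity is available on the
  open interval only, and the two end values are added by hand.\<close>

lemma f_measurable: "(\<lambda>t. indicator {0..1} t * f t) \<in> borel_measurable borel"
proof -
  have "continuous_on {0<..<1} f"
    by (rule convex_on_continuous) (auto intro: convex_on_subset[OF conv])
  hence "(\<lambda>t. indicator {0<..<1} t *\<^sub>R f t) \<in> borel_measurable borel"
    by (intro borel_measurable_continuous_on_indicator) auto
  hence "(\<lambda>t. indicator {0<..<1} t *\<^sub>R f t + (indicator {0} t * f 0 + indicator {1} t * f 1)) \<in> borel_measurable borel"
    by measurable
  also have "(\<lambda>t. indicator {0<..<1} t *\<^sub>R f t + (indicator {0} t * f 0 + indicator {1} t * f 1))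
      = (\<lambda>t. indicator {0..1} t * f t)"
    by (auto simp: fun_eq_iff indicator_def)
  finally show ?thesis .
qed

lemma f_integrable: assumes "0 \<le> a" "b \<le> 1" shows "set_integrable lborel {a..b} f"
proof -
  have "integrable lborel (\<lambda>t. indicator {0..1} t * f t)"
  proof (rule Bochner_Integration.integrable_bound)
    show "integrable lborel (\<lambda>t::real. (\<bar>m0\<bar> + \<bar>fmax\<bar>) * indicator {0..1} t)"
      by (intro integrable_mult_right integrable_real_indicator) auto
    show "AE x in lborel. norm (indicator {0..1} x * f x) \<le> norm ((\<bar>m0\<bar> + \<bar>fmax\<bar>) * indicator {0..1} x)"
    proof (rule AE_I2)
      fix x :: real
      show "norm (indicator {0..1} x * f x) \<le> norm ((\<bar>m0\<bar> + \<bar>fmax\<bar>) * indicator {0..1} x)"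
        using m0_le[of x] f_le_fmax[of x] by (auto simp: indicator_def)
    qed
  qed (use f_measurable in simp)
  hence "set_integrable lborel {0..1} f" by (simp add: set_integrable_def)
  thus ?thesis by (rule set_integrable_subset) (use assms in auto)
qed

lemma F_diff: assumes "0 \<le> a" "a \<le> b" "b \<le> 1" shows "F b - F a = (LBINT t:{a..b}. f t)"
  unfolding F_def by (rule set_integral_Icc_diff[OF f_integrable]) (use assms in auto)

lemma F_diff_bounds:
  assumes "0 \<le> a" "a \<le> b" "b \<le> 1"
  shows "(\<And>t. a \<le> t \<Longrightarrow> t \<le> b \<Longrightarrow> f t \<le> B) \<Longrightarrow> F b - F a \<le> (b - a) * B"
    and "(\<And>t. a \<le> t \<Longrightarrow> t \<le> b \<Longrightarrow> B \<le> f t) \<Longrightarrow> (b - a) * B \<le> F b - F a"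
proof -
  have c: "(LBINT t:{a..b}. B) = (b - a) * B" "set_integrable lborel {a..b} (\<lambda>_. B)"
    using assms by (simp_all add: set_lebesgue_integral_def set_integrable_def)
  show "F b - F a \<le> (b - a) * B" if "\<And>t. a \<le> t \<Longrightarrow> t \<le> b \<Longrightarrow> f t \<le> B"
    unfolding F_diff[OF assms] c(1)[symmetric]
    by (rule set_integral_mono) (use that assms f_integrable c in auto)
  show "(b - a) * B \<le> F b - F a" if "\<And>t. a \<le> t \<Longrightarrow> t \<le> b \<Longrightarrow> B \<le> f t"
    unfolding F_diff[OF assms] c(1)[symmetric]
    by (rule set_integral_mono) (use that assms f_integrable c in auto)
qed

text \<open>Writing the difference of two cells as one integral preserves a pointwise bound on
  \<open>f (t + d) - f t\<close>, which separate bounds on the two cells would lose.\<close>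

lemma F_shift_diff:
  assumes "0 \<le> a" "a \<le> b" "b \<le> 1" "0 \<le> a + d" "b + d \<le> 1"
  shows "(F (b + d) - F (a + d)) - (F b - F a) = (LBINT t:{a..b}. f (t + d) - f t)"
    and "set_integrable lborel {a..b} (\<lambda>t. f (t + d) - f t)"
proof -
  have i: "indicator {a + d..b + d} (d + t) = (indicator {a..b} t :: real)" for t
    by (auto simp: indicator_def)
  have int: "integrable lborel (\<lambda>t. indicator {a + d..b + d} t *\<^sub>R f t)"
    using f_integrable[of "a + d" "b + d"] assms by (simp add: set_integrable_def)
  have "integrable lborel (\<lambda>t. indicator {a + d..b + d} (d + 1 * t) *\<^sub>R f (d + 1 * t))"
    by (rule lborel_integrable_real_affine[OF int]) simp
  hence si: "set_integrable lborel {a..b} (\<lambda>t. f (t + d))" by (simp add: i set_integrable_def) (simp add: add.commute)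
  have "(LBINT t:{a + d..b + d}. f t) = (LBINT t:{a..b}. f (t + d))"
    unfolding set_lebesgue_integral_def
    by (subst lborel_integral_real_affine[where c=1 and t=d]) (simp_all add: i, simp add: add.commute)
  thus "(F (b + d) - F (a + d)) - (F b - F a) = (LBINT t:{a..b}. f (t + d) - f t)"
    using assms F_diff[of a b] F_diff[of "a + d" "b + d"] si f_integrable[of a b] by (simp add: set_integral_diff)
  show "set_integrable lborel {a..b} (\<lambda>t. f (t + d) - f t)"
    using si f_integrable[of a b] assms by (intro set_integral_diff) auto
qed

lemma F_shift_bounds:
  assumes "0 \<le> a" "a \<le> b" "b \<le> 1" "0 \<le> a + d" "b + d \<le> 1"
  shows "(\<And>t. a \<le> t \<Longrightarrow> t \<le> b \<Longrightarrow> f (t + d) - f t \<le> B) \<Longrightarrow>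
      (F (b + d) - F (a + d)) - (F b - F a) \<le> (b - a) * B"
    and "(\<And>t. a \<le> t \<Longrightarrow> t \<le> b \<Longrightarrow> B \<le> f (t + d) - f t) \<Longrightarrow>
      (b - a) * B \<le> (F (b + d) - F (a + d)) - (F b - F a)"
proof -
  have c: "(LBINT t:{a..b}. B) = (b - a) * B" "set_integrable lborel {a..b} (\<lambda>_. B)"
    using assms by (simp_all add: set_lebesgue_integral_def set_integrable_def)
  show "(F (b + d) - F (a + d)) - (F b - F a) \<le> (b - a) * B" if "\<And>t. a \<le> t \<Longrightarrow> t \<le> b \<Longrightarrow> f (t + d) - f t \<le> B"
    unfolding F_shift_diff(1)[OF assms] c(1)[symmetric]
    by (rule set_integral_mono) (use that F_shift_diff(2)[OF assms] c in auto)
  show "(b - a) * B \<le> (F (b + d) - F (a + d)) - (F b - F a)" if "\<And>t. a \<le> t \<Longrightarrow> t \<le> b \<Longrightarrow> B \<le> f (t + d) - f t"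
    unfolding F_shift_diff(1)[OF assms] c(1)[symmetric]
    by (rule set_integral_mono) (use that F_shift_diff(2)[OF assms] c in auto)
qed

abbreviation "cell j i \<equiv> F (grid j i) - F (grid j (i - 1))"

lemma cell_bounds:
  assumes "1 \<le> i" "i \<le> 2 ^ j"
  shows "(\<And>t. grid j (i - 1) \<le> t \<Longrightarrow> t \<le> grid j i \<Longrightarrow> f t \<le> B) \<Longrightarrow> cell j i \<le> mesh j * B"
    and "mesh j * m0 \<le> cell j i"
proof -
  have g: "0 \<le> grid j (i - 1)" "grid j (i - 1) \<le> grid j i" "grid j i \<le> 1" "grid j i - grid j (i - 1) = mesh j"
    using assms by (simp_all add: grid_nonneg_iff grid_le_1_iff grid_le_iff) (simp add: grid_def algebra_simps)
  show "cell j i \<le> mesh j * B" if "\<And>t. grid j (i - 1) \<le> t \<Longrightarrow> t \<le> grid j i \<Longrightarrow> f t \<le> B"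
    using F_diff_bounds(1)[OF g(1-3), of B] that g(4) by simp
  show "mesh j * m0 \<le> cell j i"
    using F_diff_bounds(2)[OF g(1-3), of m0] m0_le g by simp
qed

lemma cell_diff_bounds:
  assumes a: "1 \<le> a" "a \<le> 2 ^ j" and b: "1 \<le> b" "b \<le> 2 ^ j"
  defines "d \<equiv> of_int (a - b) * mesh j"
  shows "(\<And>t. grid j (b - 1) \<le> t \<Longrightarrow> t \<le> grid j b \<Longrightarrow> f (t + d) - f t \<le> B) \<Longrightarrow> cell j a - cell j b \<le> mesh j * B"
    and "(\<And>t. grid j (b - 1) \<le> t \<Longrightarrow> t \<le> grid j b \<Longrightarrow> B \<le> f (t + d) - f t) \<Longrightarrow> mesh j * B \<le> cell j a - cell j b"
proof -
  have e: "grid j b + d = grid j a" "grid j (b - 1) + d = grid j (a - 1)" "grid j b - grid j (b - 1) = mesh j"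
    by (simp_all add: d_def grid_def algebra_simps)
  have g: "0 \<le> grid j (b - 1)" "grid j (b - 1) \<le> grid j b" "grid j b \<le> 1" "0 \<le> grid j (b - 1) + d" "grid j b + d \<le> 1"
    unfolding e using a b by (simp_all add: grid_nonneg_iff grid_le_1_iff grid_le_iff)
  show "cell j a - cell j b \<le> mesh j * B" if "\<And>t. grid j (b - 1) \<le> t \<Longrightarrow> t \<le> grid j b \<Longrightarrow> f (t + d) - f t \<le> B"
    using F_shift_bounds(1)[OF g, of B] that unfolding e by simp
  show "mesh j * B \<le> cell j a - cell j b" if "\<And>t. grid j (b - 1) \<le> t \<Longrightarrow> t \<le> grid j b \<Longrightarrow> B \<le> f (t + d) - f t"
    using F_shift_bounds(2)[OF g, of B] that unfolding e by simp
qed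

lemma sdiff_cell: "sdiff F j w = cell j (w + 2) - cell j (w + 1)"
proof -
  have "w + 2 - 1 = w + 1" "w + 1 - 1 = w" by auto
  thus ?thesis by (simp only: sdiff_def)
qed

lemma sdiff_bounds:
  assumes w: "in_range j w"
  shows "(\<And>t. grid j w \<le> t \<Longrightarrow> t + mesh j \<le> grid j (w + 2) \<Longrightarrow> f (t + mesh j) - f t \<le> B) \<Longrightarrow> sdiff F j w \<le> mesh j * B"
    and "(\<And>t. grid j w \<le> t \<Longrightarrow> t + mesh j \<le> grid j (w + 2) \<Longrightarrow> B \<le> f (t + mesh j) - f t) \<Longrightarrow> mesh j * B \<le> sdiff F j w"
proof -
  have e: "grid j (w + 2) = grid j (w + 1) + mesh j" by (simp add: grid_def algebra_simps)
  show "sdiff F j w \<le> mesh j * B" if "\<And>t. grid j w \<le> t \<Longrightarrow> t + mesh j \<le> grid j (w + 2) \<Longrightarrow> f (t + mesh j) - f t \<le> B"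
    unfolding sdiff_cell using cell_diff_bounds(1)[of "w + 2" j "w + 1" B] that w e by (auto simp: in_range_def)
  show "mesh j * B \<le> sdiff F j w" if "\<And>t. grid j w \<le> t \<Longrightarrow> t + mesh j \<le> grid j (w + 2) \<Longrightarrow> B \<le> f (t + mesh j) - f t"
    unfolding sdiff_cell using cell_diff_bounds(2)[of "w + 2" j "w + 1" B] that w e by (auto simp: in_range_def)
qed

lemma in_rangeD: "in_range j w \<Longrightarrow> 0 \<le> grid j w \<and> grid j (w + 2) \<le> 1"
  by (simp add: in_range_def grid_nonneg_iff grid_le_1_iff)

lemma wrong_side_drift:
  assumes "in_range j w"
  shows "grid j (w + 2) \<le> Z \<Longrightarrow> sdiff F j w \<le> 0" and "Z \<le> grid j w \<Longrightarrow> 0 \<le> sdiff F j w"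
proof -
  have g: "0 \<le> grid j w" "grid j (w + 2) \<le> 1" using in_rangeD[OF assms] by auto
  show "sdiff F j w \<le> 0" if "grid j (w + 2) \<le> Z"
    using sdiff_bounds(1)[OF assms, of 0] mono_left that g mesh_pos[of j] by simp
  show "0 \<le> sdiff F j w" if "Z \<le> grid j w"
    using sdiff_bounds(2)[OF assms, of 0] mono_right that g mesh_pos[of j] by simp
qed

lemma win_simps:
  "win y True j = i_hat y j + 4" "win y True j + 2 = i_hat y j + 6"
  "win y False j = i_hat y j - 7" "win y False j + 2 = i_hat y j - 5"
  by (simp_all add: win_def)

text \<open>Once \<open>Z\<close> has left the hull it lies on one side of every later window, and that side has
  nonpositive drift.\<close>

lemma drift_outside_hull:
  assumes Zh: "Z \<notin> loc_hull y j0" and k: "j0 < k"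
  shows "\<exists>r. in_range k (win y r k) \<and> sgn_side r * sdiff F k (win y r k) \<le> 0"
proof -
  note wh = window_in_hull[OF k, of y]
  consider "Z < grid (Suc j0) (2 * i_hat y j0 - 9)" | "grid (Suc j0) (2 * i_hat y j0 + 7) < Z"
    using Zh by (auto simp: loc_hull_def)
  thus ?thesis
  proof cases
    case 1
    hence zw: "Z \<le> grid k (i_hat y k - 7)" using wh by linarith
    hence "0 \<le> i_hat y k - 7" using Z grid_nonneg_iff[of k "i_hat y k - 7"] by linarith
    hence ir: "in_range k (win y False k)" using i_hat_range[of y k] by (simp add: in_range_def win_def)
    show ?thesis using wrong_side_drift(2)[OF ir] zw ir
      by (intro exI[of _ False]) (auto simp: win_def sgn_side_def)
  next
    case 2
    hence zw: "grid k (i_hat y k + 6) \<le> Z" using wh by linarith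
    hence "i_hat y k + 6 \<le> 2 ^ k" using Z grid_le_1_iff[of k "i_hat y k + 6"] by linarith
    hence ir: "in_range k (win y True k)" using i_hat_range[of y k] by (simp add: in_range_def win_def)
    show ?thesis using wrong_side_drift(1)[OF ir, unfolded win_simps(2)] zw ir
      by (intro exI[of _ True]) (auto simp: sgn_side_def)
  qed
qed

text \<open>A side near which \<open>f\<close> grows slowly always offers a window with small drift: either the
  window on that side is close to \<open>Z\<close>, or the opposite window lies beyond \<open>Z\<close> on that side.\<close>

lemma drift_flat:
  assumes w: "0 < w" "64 * mesh j \<le> w" and R: "0 \<le> R"
    and flat: "(Z + w / 2 \<le> 1 \<and> f (Z + w / 2) \<le> m0 + R) \<or> (0 \<le> Z - w / 2 \<and> f (Z - w / 2) \<le> m0 + R)"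
  shows "\<exists>r. in_range j (win y r j) \<and> sgn_side r * sdiff F j (win y r j) \<le> mesh j * (mesh j * (4 * R / w))"
proof -
  let ?i = "i_hat y j" and ?m = "mesh j"
  have m: "0 < ?m" by (rule mesh_pos)
  have nn: "0 \<le> ?m * (?m * (4 * R / w))" using m w R by simp
  have ih: "1 \<le> ?i" "?i \<le> 2 ^ j" using i_hat_range[of y j] by auto
  have gd: "grid j (?i + 6) - grid j (?i - 7) = 13 * ?m" by (simp add: grid_def algebra_simps)
  from flat show ?thesis
  proof
    assume fl: "Z + w / 2 \<le> 1 \<and> f (Z + w / 2) \<le> m0 + R"
    show ?thesis
    proof (cases "grid j (?i + 6) \<le> Z + w / 4")
      case True
      hence "grid j (?i + 6) \<le> 1" using fl w by linarith
      hence ir: "in_range j (win y True j)" using ih by (simp add: in_range_def win_def grid_le_1_iff)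
      have "sdiff F j (win y True j) \<le> ?m * (?m * (4 * R / w))"
      proof (rule sdiff_bounds(1)[OF ir])
        fix t assume t: "grid j (win y True j) \<le> t" "t + ?m \<le> grid j (win y True j + 2)"
        have t0: "0 \<le> t" "t + ?m \<le> Z + w / 4" using t True in_rangeD[OF ir] unfolding win_simps(2,4) by linarith+
        \<comment> \<open>The window lies to the left of \<open>Z + w / 4\<close>, so its slopes are
          at most the slope over \<open>[Z + w / 4, Z + w / 2]\<close>, where \<open>f\<close> rises
          by at most \<open>R\<close>.\<close>
        have "(f (t + ?m) - f t) * (w / 4) \<le> (f (Z + w / 2) - f (Z + w / 4)) * ?m"
          using slope_mono[of t "t + ?m" "Z + w / 4" "Z + w / 2"] t0 m w fl by simp
        also have "\<dots> \<le> R * ?m" using m0_le[of "Z + w / 4"] fl w Z m by (intro mult_right_mono) auto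
        finally show "f (t + ?m) - f t \<le> ?m * (4 * R / w)" using w by (simp add: field_simps)
      qed
      thus ?thesis using ir by (intro exI[of _ True]) (simp add: sgn_side_def)
    next
      case False
      \<comment> \<open>Both windows together span 13 cells, less than \<open>w / 4\<close>. If the
        right one ends beyond \<open>Z + w / 4\<close>, the left one begins beyond
        \<open>Z\<close>.\<close>
      hence zw: "Z \<le> grid j (?i - 7)" using gd w by linarith
      hence "0 \<le> ?i - 7" using Z grid_nonneg_iff[of j "?i - 7"] by linarith
      hence ir: "in_range j (win y False j)" using ih by (simp add: in_range_def win_def)
      show ?thesis using wrong_side_drift(2)[OF ir] zw ir nn
        by (intro exI[of _ False]) (auto simp: win_def sgn_side_def)
    qed
  next
    assume fl: "0 \<le> Z - w / 2 \<and> f (Z - w / 2) \<le> m0 + R"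
    show ?thesis
    proof (cases "Z - w / 4 \<le> grid j (?i - 7)")
      case True
      hence "0 \<le> grid j (?i - 7)" using fl w by linarith
      hence ir: "in_range j (win y False j)" using ih by (simp add: in_range_def win_def grid_nonneg_iff)
      have "?m * - (?m * (4 * R / w)) \<le> sdiff F j (win y False j)"
      proof (rule sdiff_bounds(2)[OF ir])
        fix t assume t: "grid j (win y False j) \<le> t" "t + ?m \<le> grid j (win y False j + 2)"
        have t0: "Z - w / 4 \<le> t" "t + ?m \<le> 1" using t True in_rangeD[OF ir] unfolding win_simps(3,4) by linarith+
        have "(f (Z - w / 4) - f (Z - w / 2)) * ?m \<le> (f (t + ?m) - f t) * (w / 4)"
          using slope_mono[of "Z - w / 2" "Z - w / 4" t "t + ?m"] t0 m w fl by simp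
        moreover have "- R * ?m \<le> (f (Z - w / 4) - f (Z - w / 2)) * ?m"
          using m0_le[of "Z - w / 4"] fl w Z m by (intro mult_right_mono) auto
        ultimately have "- R * ?m \<le> (f (t + ?m) - f t) * (w / 4)" by linarith
        thus "- (?m * (4 * R / w)) \<le> f (t + ?m) - f t" using w by (simp add: field_simps)
      qed
      thus ?thesis using ir by (intro exI[of _ False]) (simp add: sgn_side_def)
    next
      case False
      hence zw: "grid j (?i + 6) \<le> Z" using gd w by linarith
      hence "?i + 6 \<le> 2 ^ j" using Z grid_le_1_iff[of j "?i + 6"] by linarith
      hence ir: "in_range j (win y True j)" using ih by (simp add: in_range_def win_def)
      show ?thesis using wrong_side_drift(1)[OF ir, unfolded win_simps(2)] zw ir nn
        by (intro exI[of _ True]) (auto simp: sgn_side_def)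
    qed
  qed
qed

text \<open>To the right of \<open>Z\<close> slopes are at least the mean slope
  \<open>S / (2 * h)\<close> over \<open>[Z, Z + 2 * h]\<close>, so \<open>f\<close> gains
  \<open>mesh j * S / (2 * h)\<close> from one cell to the next; integration over a cell brings the
  second factor \<open>mesh j\<close>. The existence of a cell \<open>a\<close> beyond
  \<open>b\<close> ensures \<open>Z + 2 * h \<le> 1\<close>.\<close>

lemma steep_right:
  assumes h: "0 < h" "2 * h \<le> mesh j" and st: "Z + 2 * h \<le> 1 \<Longrightarrow> m0 + S \<le> f (Z + 2 * h)" and S: "0 \<le> S"
    and ab: "b < a" "1 \<le> b" "a \<le> 2 ^ j" "Z \<le> grid j (b - 1)"
  shows "mesh j * (mesh j * S / (2 * h)) \<le> cell j a - cell j b"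
proof (rule cell_diff_bounds(2))
  let ?m = "mesh j"
  fix t assume t: "grid j (b - 1) \<le> t" "t \<le> grid j b"
  let ?d = "of_int (a - b) * ?m"
  have m: "0 < ?m" by (rule mesh_pos)
  have d: "?m \<le> ?d" using ab(1) m by simp
  have "t + ?d \<le> grid j b + ?d" using t by simp
  also have "\<dots> = grid j a" by (simp add: grid_def algebra_simps)
  also have "\<dots> \<le> 1" using ab by (simp add: grid_le_1_iff)
  finally have t1: "t + ?d \<le> 1" .
  have zt: "Z \<le> t" using ab t by simp
  have "m0 + S \<le> f (Z + 2 * h)" using st zt t1 d h by simp
  hence "S * ?m \<le> (f (Z + 2 * h) - f Z) * ?m" using m f_Z by (intro mult_right_mono) auto
  also have "\<dots> \<le> (f (t + ?m) - f t) * (2 * h)"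
    using slope_mono[of Z "Z + 2 * h" t "t + ?m"] Z zt t1 d h m by simp
  also have "\<dots> \<le> (f (t + ?d) - f t) * (2 * h)"
    using mono_right[of "t + ?m" "t + ?d"] zt t1 d h m by (intro mult_right_mono) auto
  finally show "?m * S / (2 * h) \<le> f (t + ?d) - f t" using h by (simp add: field_simps)
qed (use ab in auto)

lemma steep_left:
  assumes h: "0 < h" "2 * h \<le> mesh j" and st: "0 \<le> Z - 2 * h \<Longrightarrow> m0 + S \<le> f (Z - 2 * h)" and S: "0 \<le> S"
    and ab: "a < b" "1 \<le> a" "b \<le> 2 ^ j" "grid j b \<le> Z"
  shows "mesh j * (mesh j * S / (2 * h)) \<le> cell j a - cell j b"
proof (rule cell_diff_bounds(2))
  let ?m = "mesh j"
  fix t assume t: "grid j (b - 1) \<le> t" "t \<le> grid j b"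
  let ?d = "of_int (a - b) * ?m"
  have m: "0 < ?m" by (rule mesh_pos)
  have d: "?d \<le> - ?m"
  proof -
    have "real_of_int (a - b) \<le> -1" using ab(1) by linarith
    thus ?thesis using m mult_right_mono[of "real_of_int (a - b)" "-1" ?m] by simp
  qed
  have "0 \<le> grid j (a - 1)" using ab by (simp add: grid_nonneg_iff)
  also have "grid j (a - 1) = grid j (b - 1) + ?d" by (simp add: grid_def algebra_simps)
  also have "\<dots> \<le> t + ?d" using t by simp
  finally have t1: "0 \<le> t + ?d" .
  have zt: "t \<le> Z" using ab t by simp
  have "m0 + S \<le> f (Z - 2 * h)" using st zt t1 d h by simp
  hence "S * ?m \<le> (f (Z - 2 * h) - f Z) * ?m" using m f_Z by (intro mult_right_mono) auto
  also have "\<dots> \<le> (f (t - ?m) - f t) * (2 * h)"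
    using slope_mono[of "t - ?m" t "Z - 2 * h" Z] Z zt t1 d h m by (simp add: algebra_simps)
  also have "\<dots> \<le> (f (t + ?d) - f t) * (2 * h)"
    using mono_left[of "t + ?d" "t - ?m"] zt t1 d h m by (intro mult_right_mono) auto
  finally show "?m * S / (2 * h) \<le> f (t + ?d) - f t" using h by (simp add: field_simps)
qed (use ab in auto)

end

section \<open>Tail bounds for comparisons of cells and for chains of tests\<close>

context gauss_process
begin

text \<open>The factor 6 in \<open>sigma\<close> is 3 from the sample split times 2 from the
  difference of two independent cells.\<close>

lemma noise_scale:
  assumes "c = sqrt 3" "0 < \<epsilon>"
  shows "\<epsilon> * (c * sqrt (2 * mesh j)) = sigma \<epsilon> j"
  unfolding sigma_def using assms mesh_pos[of j]
  by (intro real_sqrt_unique[symmetric]) (simp_all add: power_mult_distrib)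

lemma prob_cell_diff_le:
  assumes c: "c = sqrt 3" and \<epsilon>: "0 < \<epsilon>"
    and a: "1 \<le> a" "a \<le> 2 ^ j" and b: "1 \<le> b" "b \<le> 2 ^ j" and ab: "a \<noteq> b"
    and D: "v * sigma \<epsilon> j \<le> D"
  shows "prob {\<omega> \<in> space M. D + \<epsilon> * ((X (grid j a) \<omega> - X (grid j (a - 1)) \<omega>) - (X (grid j b) \<omega> - X (grid j (b - 1)) \<omega>))
      \<le> t * sigma \<epsilon> j} \<le> Phi (t - v)"
proof -
  let ?s = "c * sqrt (2 * mesh j)"
  let ?n = "\<lambda>\<omega>. (X (grid j a) \<omega> - X (grid j (a - 1)) \<omega>) - (X (grid j b) \<omega> - X (grid j (b - 1)) \<omega>)"
  have s: "0 < ?s" using c_pos mesh_pos[of j] by simp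
  have meas[measurable]: "?n \<in> borel_measurable M"
    using a b by (intro borel_measurable_diff measurable_grid) auto
  have "prob {\<omega> \<in> space M. D + \<epsilon> * ?n \<omega> \<le> t * sigma \<epsilon> j} \<le> prob {\<omega> \<in> space M. ?n \<omega> \<le> ?s * (t - v)}"
  proof (rule finite_measure_mono)
    show "{\<omega> \<in> space M. D + \<epsilon> * ?n \<omega> \<le> t * sigma \<epsilon> j} \<subseteq> {\<omega> \<in> space M. ?n \<omega> \<le> ?s * (t - v)}"
    proof safe
      fix \<omega> assume "D + \<epsilon> * ?n \<omega> \<le> t * sigma \<epsilon> j"
      hence "\<epsilon> * ?n \<omega> \<le> (t - v) * sigma \<epsilon> j" using D by (simp add: left_diff_distrib)
      hence "\<epsilon> * ?n \<omega> \<le> \<epsilon> * (?s * (t - v))" unfolding noise_scale[OF c \<epsilon>, symmetric] by (simp add: ac_simps)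
      thus "?n \<omega> \<le> ?s * (t - v)" using \<epsilon> by simp
    qed
  qed measurable
  also have "\<dots> = measure (distr M borel ?n) {x. x \<le> ?s * (t - v)}"
    by (subst measure_distr) (auto intro!: arg_cong[where f=prob])
  also have "\<dots> = Phi (t - v)"
    unfolding distr_cell_diff[OF a b ab] by (rule measure_gauss_le[OF s])
  finally show ?thesis .
qed

text \<open>When the drift is at most \<open>2 - v\<close> standard deviations, exceeding the
  threshold of two takes a noise of more than \<open>v\<close>. With nonpositive drift
  \<open>v = 2\<close>, the source of \<open>Phi (- 2)\<close> in \<open>K_const\<close>; with drift
  up to the threshold \<open>v = 0\<close>, which gives \<open>1 / 2\<close> per level.\<close>

lemma prob_no_stop_windows:
  fixes w :: "nat \<Rightarrow> int" and r :: "nat \<Rightarrow> bool" and D :: "nat \<Rightarrow> real"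
  assumes c: "c = sqrt 3" and \<epsilon>: "0 < \<epsilon>" and fin: "finite A"
    and w: "\<And>j. j \<in> A \<Longrightarrow> in_range j (w j)"
    and disj: "\<And>j k. j \<in> A \<Longrightarrow> k \<in> A \<Longrightarrow> j < k \<Longrightarrow>
       grid k (w k + 2) \<le> grid j (w j) \<or> grid j (w j + 2) \<le> grid k (w k)"
    and D: "\<And>j. j \<in> A \<Longrightarrow> sgn_side (r j) * D j \<le> (2 - v) * sigma \<epsilon> j"
  shows "prob {\<omega> \<in> space M. \<forall>j\<in>A. 2 * sigma \<epsilon> j < sgn_side (r j) * (D j + \<epsilon> * sdiff (\<lambda>t. X t \<omega>) j (w j))}
     \<le> Phi (- v) ^ card A"
proof (cases "A = {}")
  case True thus ?thesis by (simp add: prob_space)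
next
  case False
  define B where "B j = {x. 2 * sigma \<epsilon> j < sgn_side (r j) * (D j + \<epsilon> * x)}" for j
  have Bm: "B j \<in> sets borel" for j unfolding B_def by measurable
  let ?Y = "\<lambda>j \<omega>. sdiff (\<lambda>t. X t \<omega>) j (w j)"
  have "{\<omega> \<in> space M. \<forall>j\<in>A. 2 * sigma \<epsilon> j < sgn_side (r j) * (D j + \<epsilon> * sdiff (\<lambda>t. X t \<omega>) j (w j))}
     = (\<Inter>j\<in>A. ?Y j -` B j \<inter> space M)"
    using False by (auto simp: B_def)
  also have "prob \<dots> = (\<Prod>j\<in>A. prob (?Y j -` B j \<inter> space M))"
    by (rule indep_varsD_finite[OF indep_sdiff[OF fin w disj] False fin]) (assumption | rule Bm)+
  also have "\<dots> \<le> (\<Prod>j\<in>A. Phi (- v))"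
  proof (rule prod_mono, safe)
    fix j assume j: "j \<in> A"
    let ?s = "c * sqrt (2 * mesh j)"
    have s: "0 < ?s" using c_pos mesh_pos[of j] by simp
    have ev: "\<epsilon> * (?s * v) = v * sigma \<epsilon> j" unfolding noise_scale[OF c \<epsilon>, symmetric] by (simp add: ac_simps)
    have "prob (?Y j -` B j \<inter> space M) = measure (gauss ?s) (B j)"
      unfolding distr_sdiff[OF w[OF j], symmetric] by (rule measure_distr[symmetric, OF measurable_sdiff[OF w[OF j]] Bm])
    also have "\<dots> \<le> Phi (- v)"
    proof (cases "r j")
      case True
      have "B j \<subseteq> {x. ?s * v < x}"
      proof
        fix x assume "x \<in> B j"
        hence "2 * sigma \<epsilon> j < D j + \<epsilon> * x" using True by (simp add: B_def sgn_side_def)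
        hence "\<epsilon> * (?s * v) < \<epsilon> * x" using D[OF j] True unfolding ev by (simp add: sgn_side_def left_diff_distrib)
        thus "x \<in> {x. ?s * v < x}" using \<epsilon> by simp
      qed
      hence "measure (gauss ?s) (B j) \<le> measure (gauss ?s) {x. ?s * v < x}"
        by (intro finite_measure.finite_measure_mono prob_space.finite_measure prob_space_gauss s) auto
      thus ?thesis using measure_gauss_greater[OF s] by simp
    next
      case False
      have "B j \<subseteq> {x. x < ?s * - v}"
      proof
        fix x assume "x \<in> B j"
        hence "2 * sigma \<epsilon> j < - D j - \<epsilon> * x" using False by (simp add: B_def sgn_side_def)
        hence "\<epsilon> * x < - (\<epsilon> * (?s * v))" using D[OF j] False unfolding ev by (simp add: sgn_side_def left_diff_distrib)
        hence "\<epsilon> * x < \<epsilon> * (?s * - v)" by simp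
        hence "x < ?s * - v" using \<epsilon> by (simp only: mult_less_cancel_left_pos)
        thus "x \<in> {x. x < ?s * - v}" by simp
      qed
      hence "measure (gauss ?s) (B j) \<le> measure (gauss ?s) {x. x < ?s * - v}"
        by (intro finite_measure.finite_measure_mono prob_space.finite_measure prob_space_gauss s) auto
      thus ?thesis using measure_gauss_less[OF s, of "- v"] by simp
    qed
    finally show "prob (?Y j -` B j \<inter> space M) \<le> Phi (- v)" .
  qed simp
  finally show ?thesis by simp
qed

end

section \<open>Measurability of the interval\<close>

text \<open>The value is a Hilbert choice, hence opaque; but it depends on the outcome only through
  the set of minimizers, which takes finitely many values and is measurable.\<close>

lemma measurable_arg_min_on:
  fixes X :: "int \<Rightarrow> 'b \<Rightarrow> ereal"
  assumes A: "finite A" and X[measurable]: "\<And>i. i \<in> A \<Longrightarrow> X i \<in> borel_measurable Q"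
  shows "(\<lambda>\<omega>. arg_min_on (\<lambda>i. X i \<omega>) A) \<in> Q \<rightarrow>\<^sub>M count_space UNIV"
proof -
  define G where "G \<omega> = {x \<in> A. \<forall>y\<in>A. \<not> X y \<omega> < X x \<omega>}" for \<omega>
  have eq: "arg_min_on (\<lambda>i. X i \<omega>) A = (SOME x. x \<in> G \<omega>)" for \<omega>
    unfolding arg_min_on_def arg_min_def is_arg_min_def G_def by (rule arg_cong[where f=Eps]) auto
  have "G \<in> Q \<rightarrow>\<^sub>M count_space (Pow A)"
  proof (rule iffD2[OF measurable_count_space_eq2])
    show "finite (Pow A)" using A by simp
    show "G \<in> space Q \<rightarrow> Pow A \<and> (\<forall>S\<in>Pow A. G -` {S} \<inter> space Q \<in> sets Q)"
    proof safe
      fix S assume S: "S \<subseteq> A"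
      have "G -` {S} \<inter> space Q = {\<omega> \<in> space Q. \<forall>x\<in>A. (x \<in> S) = (\<forall>y\<in>A. \<not> X y \<omega> < X x \<omega>)}"
      proof -
        have "G \<omega> \<subseteq> A" for \<omega> by (auto simp: G_def)
        hence "G \<omega> = S \<longleftrightarrow> (\<forall>x\<in>A. (x \<in> S) = (x \<in> G \<omega>))" for \<omega> using S by blast
        hence "G -` {S} \<inter> space Q = {\<omega> \<in> space Q. \<forall>x\<in>A. (x \<in> S) = (x \<in> G \<omega>)}" by blast
        thus ?thesis by (simp add: G_def cong: ball_cong)
      qed
      also have "\<dots> \<in> sets Q"
      proof (intro sets.sets_Collect_finite_All A)
        fix x assume x: "x \<in> A"
        have "{\<omega> \<in> space Q. \<forall>y\<in>A. \<not> X y \<omega> < X x \<omega>} \<in> sets Q"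
        proof (intro sets.sets_Collect_finite_All A)
          fix y assume y: "y \<in> A"
          show "{\<omega> \<in> space Q. \<not> X y \<omega> < X x \<omega>} \<in> sets Q"
            using X[OF x] X[OF y] by measurable
        qed
        from this sets.sets_Collect_neg[OF this]
        show "{\<omega> \<in> space Q. (x \<in> S) = (\<forall>y\<in>A. \<not> X y \<omega> < X x \<omega>)} \<in> sets Q"
          by (cases "x \<in> S") (simp_all only: simp_thms)
      qed
      finally show "G -` {S} \<inter> space Q \<in> sets Q" .
    qed (auto simp: G_def)
  qed
  from measurable_compose[OF this, of "\<lambda>S. SOME x. x \<in> S" "count_space UNIV"]
  have "(\<lambda>\<omega>. SOME x. x \<in> G \<omega>) \<in> Q \<rightarrow>\<^sub>M count_space UNIV" by simp
  thus ?thesis unfolding eq .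
qed

lemma measurable_i_hat:
  assumes y: "\<And>j i. (\<lambda>\<omega>. incr (y \<omega>) j i) \<in> borel_measurable Q"
  shows "(\<lambda>\<omega>. i_hat (y \<omega>) j) \<in> Q \<rightarrow>\<^sub>M count_space UNIV"
proof (induction j)
  case (Suc j)
  have "(\<lambda>\<omega>. arg_min_on (incr (y \<omega>) (Suc j)) {2 * k - 2 .. 2 * k + 1}) \<in> Q \<rightarrow>\<^sub>M count_space UNIV" for k
    by (rule measurable_arg_min_on) (use y in auto)
  from measurable_compose_countable[OF this Suc] show ?case by simp
qed simp

lemma measurable_T_stat:
  assumes yl: "\<And>j i. (\<lambda>\<omega>. incr (yl \<omega>) j i) \<in> borel_measurable Q"
    and ys[measurable]: "\<And>j i. (\<lambda>\<omega>. incr (ys \<omega>) j i) \<in> borel_measurable Q"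
  shows "(\<lambda>\<omega>. T_stat (yl \<omega>) (ys \<omega>) j) \<in> borel_measurable Q"
proof -
  have "(\<lambda>\<omega>. min (incr (ys \<omega>) j (k + 6) - incr (ys \<omega>) j (k + 5)) (incr (ys \<omega>) j (k - 6) - incr (ys \<omega>) j (k - 5)))
     \<in> borel_measurable Q" for k
    by measurable
  from measurable_compose_countable[OF this measurable_i_hat[OF yl, of j]]
  show ?thesis by (simp add: T_stat_def)
qed

lemma pred_no_stop:
  assumes "\<And>j i. (\<lambda>\<omega>. incr (yl \<omega>) j i) \<in> borel_measurable Q"
    and "\<And>j i. (\<lambda>\<omega>. incr (ys \<omega>) j i) \<in> borel_measurable Q"
  shows "Measurable.pred Q (\<lambda>\<omega>. no_stop \<epsilon> (yl \<omega>) (ys \<omega>) j)"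
proof -
  note [measurable] = measurable_T_stat[OF assms]
  show ?thesis unfolding no_stop_def by measurable
qed

lemma measurable_j_hat:
  assumes "0 < \<epsilon>" "\<And>j i. (\<lambda>\<omega>. incr (yl \<omega>) j i) \<in> borel_measurable Q"
    and "\<And>j i. (\<lambda>\<omega>. incr (ys \<omega>) j i) \<in> borel_measurable Q"
  shows "(\<lambda>\<omega>. j_hat \<epsilon> (yl \<omega>) (ys \<omega>)) \<in> Q \<rightarrow>\<^sub>M count_space UNIV"
proof -
  note [measurable] = pred_no_stop[OF assms(2,3)]
  show ?thesis unfolding j_hat_eq[OF assms(1)] by measurable
qed

text \<open>The indices over which the estimator is minimized. They may reach beyond the grid, where
  \<open>incr\<close> is infinite.\<close>

definition cells :: "nat \<Rightarrow> int \<Rightarrow> nat \<Rightarrow> int set" where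
  "cells j i J = {k. grid j (i - 5) * 2 ^ J < real_of_int k \<and> real_of_int k \<le> grid j (i + 4) * 2 ^ J}"

lemma grid_pow: "j \<le> J \<Longrightarrow> grid j k * 2 ^ J = real_of_int (k * 2 ^ (J - j))"
proof -
  assume "j \<le> J"
  hence "(2::real) ^ J = 2 ^ j * 2 ^ (J - j)" by (simp add: power_add[symmetric])
  thus ?thesis by (simp add: grid_def mesh_def)
qed

lemma cells_eq: "j \<le> J \<Longrightarrow> cells j i J = {(i - 5) * 2 ^ (J - j) <.. (i + 4) * 2 ^ (J - j)}"
  unfolding cells_def by (auto simp only: grid_pow of_int_less_iff of_int_le_iff greaterThanAtMost_iff mem_Collect_eq)

lemma finite_cells: "finite (cells j i J)"
proof (rule finite_subset)
  show "cells j i J \<subseteq> {\<lfloor>grid j (i - 5) * 2 ^ J\<rfloor> .. \<lfloor>grid j (i + 4) * 2 ^ J\<rfloor>}"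
    by (auto simp: cells_def floor_le_iff le_floor_iff)
qed simp

definition ci_center :: "(real \<Rightarrow> real) \<Rightarrow> nat \<Rightarrow> int set \<Rightarrow> real" where
  "ci_center ye J S = 1 / mesh J * real_of_ereal (Min (incr ye J ` S))"

definition ci_lo :: "real \<Rightarrow> real \<Rightarrow> nat \<Rightarrow> int \<Rightarrow> nat \<Rightarrow> (real \<Rightarrow> real) \<Rightarrow> real" where
  "ci_lo \<alpha> \<epsilon> j i J ye = ci_center ye J (cells j i J) - z_quantile (\<alpha> / 4) * (sqrt 3 * \<epsilon> / sqrt (mesh J)) - sqrt 3 * \<epsilon> / sqrt (mesh J)"

definition ci_hi :: "real \<Rightarrow> real \<Rightarrow> nat \<Rightarrow> int \<Rightarrow> nat \<Rightarrow> (real \<Rightarrow> real) \<Rightarrow> real" where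
  "ci_hi \<alpha> \<epsilon> j i J ye = ci_center ye J (cells j i J) + S_quantile (9 * 2 ^ (J - j)) (\<alpha> / 4) * (sqrt 3 * \<epsilon> / sqrt (mesh J))"

abbreviation "j_start \<alpha> \<epsilon> yl ys \<equiv> j_hat \<epsilon> yl ys - K_const (\<alpha> / 4) - 1"
abbreviation "j_fine \<alpha> \<epsilon> yl ys \<equiv> j_hat \<epsilon> yl ys + K_tilde (\<alpha> / 4)"

definition lo :: "real \<Rightarrow> real \<Rightarrow> (real \<Rightarrow> real) \<Rightarrow> (real \<Rightarrow> real) \<Rightarrow> (real \<Rightarrow> real) \<Rightarrow> real" where
  "lo \<alpha> \<epsilon> yl ys ye = ci_lo \<alpha> \<epsilon> (j_start \<alpha> \<epsilon> yl ys) (i_hat yl (j_start \<alpha> \<epsilon> yl ys)) (j_fine \<alpha> \<epsilon> yl ys) ye"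

definition hi :: "real \<Rightarrow> real \<Rightarrow> (real \<Rightarrow> real) \<Rightarrow> (real \<Rightarrow> real) \<Rightarrow> (real \<Rightarrow> real) \<Rightarrow> real" where
  "hi \<alpha> \<epsilon> yl ys ye = ci_hi \<alpha> \<epsilon> (j_start \<alpha> \<epsilon> yl ys) (i_hat yl (j_start \<alpha> \<epsilon> yl ys)) (j_fine \<alpha> \<epsilon> yl ys) ye"

lemma grid_width:
  assumes "j \<le> J"
  shows "nat \<lfloor>grid j (i + 4) * 2 ^ J - grid j (i - 5) * 2 ^ J\<rfloor> = 9 * 2 ^ (J - j)"
proof -
  have "grid j (i + 4) * 2 ^ J - grid j (i - 5) * 2 ^ J = real (9 * 2 ^ (J - j))"
    unfolding grid_pow[OF assms] by (simp add: algebra_simps)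
  thus ?thesis by (simp only: floor_of_nat nat_int)
qed

lemma CI_m_eq:
  "CI_m \<alpha> \<epsilon> y b1 b2 = {lo \<alpha> \<epsilon> (Y_l \<epsilon> y b1 b2) (Y_s \<epsilon> y b1 b2) (Y_e \<epsilon> y b1) .. hi \<alpha> \<epsilon> (Y_l \<epsilon> y b1 b2) (Y_s \<epsilon> y b1 b2) (Y_e \<epsilon> y b1)}"
  unfolding CI_m_def Let_def lo_def hi_def ci_lo_def ci_hi_def ci_center_def cells_def
  by (subst grid_width) auto

lemma i_hat_cong: "incr y = incr y' \<Longrightarrow> i_hat y j = i_hat y' j"
  by (induction j) auto

text \<open>The interval sees its three paths through dyadic increments only. This permits replacing
  them by their restrictions to the unit interval, which live in \<open>path_space\<close>.\<close>

lemma lo_hi_cong: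
  assumes "incr yl = incr yl'" "incr ys = incr ys'" "incr ye = incr ye'"
  shows "lo \<alpha> \<epsilon> yl ys ye = lo \<alpha> \<epsilon> yl' ys' ye'" "hi \<alpha> \<epsilon> yl ys ye = hi \<alpha> \<epsilon> yl' ys' ye'"
proof -
  have "T_stat yl ys = T_stat yl' ys'"
    unfolding T_stat_def fun_eq_iff assms(2) using i_hat_cong[OF assms(1)] by simp
  hence "j_hat \<epsilon> yl ys = j_hat \<epsilon> yl' ys'" by (simp add: j_hat_def)
  thus "lo \<alpha> \<epsilon> yl ys ye = lo \<alpha> \<epsilon> yl' ys' ye'" "hi \<alpha> \<epsilon> yl ys ye = hi \<alpha> \<epsilon> yl' ys' ye'"
    using i_hat_cong[OF assms(1)] by (simp_all add: lo_def hi_def ci_lo_def ci_hi_def ci_center_def assms(3))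
qed

text \<open>The stopping level and the localized index take countably many values; for each fixed
  pair the endpoints are a minimum of finitely many increments plus a constant.\<close>

lemma measurable_lo_hi:
  assumes \<epsilon>: "0 < \<epsilon>"
    and yl: "\<And>j i. (\<lambda>\<omega>. incr (yl \<omega>) j i) \<in> borel_measurable Q"
    and ys: "\<And>j i. (\<lambda>\<omega>. incr (ys \<omega>) j i) \<in> borel_measurable Q"
    and ye[measurable]: "\<And>j i. (\<lambda>\<omega>. incr (ye \<omega>) j i) \<in> borel_measurable Q"
  shows "(\<lambda>\<omega>. lo \<alpha> \<epsilon> (yl \<omega>) (ys \<omega>) (ye \<omega>)) \<in> borel_measurable Q"
    and "(\<lambda>\<omega>. hi \<alpha> \<epsilon> (yl \<omega>) (ys \<omega>) (ye \<omega>)) \<in> borel_measurable Q"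
proof -
  note j[measurable] = measurable_j_hat[OF \<epsilon> yl ys]
  have i[measurable]: "(\<lambda>\<omega>. i_hat (yl \<omega>) (j_start \<alpha> \<epsilon> (yl \<omega>) (ys \<omega>))) \<in> Q \<rightarrow>\<^sub>M count_space UNIV"
    by (rule measurable_compose_countable[OF measurable_i_hat[OF yl]]) measurable
  have c: "(\<lambda>\<omega>. ci_center (ye \<omega>) J (cells j i J)) \<in> borel_measurable Q" for J j i
    unfolding ci_center_def
    by (intro borel_measurable_times borel_measurable_const borel_measurable_real_of_ereal borel_measurable_Min finite_cells ye)
  have p: "(\<lambda>\<omega>. (j_hat \<epsilon> (yl \<omega>) (ys \<omega>), i_hat (yl \<omega>) (j_start \<alpha> \<epsilon> (yl \<omega>) (ys \<omega>)))) \<in> Q \<rightarrow>\<^sub>M count_space UNIV"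
    by measurable
  have "(\<lambda>\<omega>. ci_lo \<alpha> \<epsilon> (fst q - K_const (\<alpha> / 4) - 1) (snd q) (fst q + K_tilde (\<alpha> / 4)) (ye \<omega>)) \<in> borel_measurable Q" for q
    unfolding ci_lo_def by (rule borel_measurable_diff[OF borel_measurable_diff[OF c borel_measurable_const] borel_measurable_const])
  from measurable_compose_countable[where f="\<lambda>q \<omega>. ci_lo \<alpha> \<epsilon> (fst q - K_const (\<alpha> / 4) - 1) (snd q) (fst q + K_tilde (\<alpha> / 4)) (ye \<omega>)", OF this p]
  show "(\<lambda>\<omega>. lo \<alpha> \<epsilon> (yl \<omega>) (ys \<omega>) (ye \<omega>)) \<in> borel_measurable Q" unfolding lo_def fst_conv snd_conv .
  have "(\<lambda>\<omega>. ci_hi \<alpha> \<epsilon> (fst q - K_const (\<alpha> / 4) - 1) (snd q) (fst q + K_tilde (\<alpha> / 4)) (ye \<omega>)) \<in> borel_measurable Q" for q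
    unfolding ci_hi_def by (rule borel_measurable_add[OF c borel_measurable_const])
  from measurable_compose_countable[where f="\<lambda>q \<omega>. ci_hi \<alpha> \<epsilon> (fst q - K_const (\<alpha> / 4) - 1) (snd q) (fst q + K_tilde (\<alpha> / 4)) (ye \<omega>)", OF this p]
  show "(\<lambda>\<omega>. hi \<alpha> \<epsilon> (yl \<omega>) (ys \<omega>) (ye \<omega>)) \<in> borel_measurable Q" unfolding hi_def fst_conv snd_conv .
qed

section \<open>The modulus and the stopping level\<close>

context convex_min
begin

definition "gap u t = f t - max (f t) u"

lemma gap_bounds:
  assumes "0 \<le> t" "t \<le> 1" "m0 \<le> u"
  shows "\<bar>gap u t\<bar> \<le> u - m0"
  using m0_le[of t] assms unfolding gap_def by auto

lemma gap_sq_integrable: "integrable lborel (\<lambda>t. indicator {0..1} t * (gap u t)\<^sup>2)"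
proof (rule Bochner_Integration.integrable_bound)
  show "integrable lborel (\<lambda>t::real. (\<bar>m0\<bar> + \<bar>u\<bar>)\<^sup>2 * indicator {0..1} t)"
    by (intro integrable_mult_right integrable_real_indicator) auto
  have "(\<lambda>t. indicator {0..1} t * (indicator {0..1} t * f t - max (indicator {0..1} t * f t) u)\<^sup>2) \<in> borel_measurable borel"
    using f_measurable by measurable
  also have "(\<lambda>t. indicator {0..1} t * (indicator {0..1} t * f t - max (indicator {0..1} t * f t) u)\<^sup>2)
     = (\<lambda>t. indicator {0..1} t * (gap u t)\<^sup>2)"
    by (auto simp: fun_eq_iff gap_def indicator_def)
  finally show "(\<lambda>t. indicator {0..1} t * (gap u t)\<^sup>2) \<in> borel_measurable lborel" by simp
  show "AE x in lborel. norm (indicator {0..1} x * (gap u x)\<^sup>2) \<le> norm ((\<bar>m0\<bar> + \<bar>u\<bar>)\<^sup>2 * indicator {0..1} x)"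
  proof (rule AE_I2)
    fix x :: real
    have "(gap u x)\<^sup>2 \<le> (\<bar>m0\<bar> + \<bar>u\<bar>)\<^sup>2" if "0 \<le> x" "x \<le> 1"
    proof -
      have "\<bar>gap u x\<bar> \<le> \<bar>m0\<bar> + \<bar>u\<bar>" using m0_le[OF that] unfolding gap_def by auto
      thus ?thesis using abs_le_square_iff[of "gap u x" "\<bar>m0\<bar> + \<bar>u\<bar>"] by simp
    qed
    thus "norm (indicator {0..1} x * (gap u x)\<^sup>2) \<le> norm ((\<bar>m0\<bar> + \<bar>u\<bar>)\<^sup>2 * indicator {0..1} x)"
      by (auto simp: indicator_def)
  qed
qed

lemma L2_norm_gap: "L2_norm (gap u) = sqrt (\<integral>t. indicator {0..1} t * (gap u t)\<^sup>2 \<partial>lborel)"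
  by (simp add: L2_norm_def set_lebesgue_integral_def)

lemma L2_norm_gap_le:
  assumes w: "0 \<le> b - a" and B: "0 \<le> B" and le: "\<And>t. 0 \<le> t \<Longrightarrow> t \<le> 1 \<Longrightarrow> \<bar>gap u t\<bar> \<le> B"
    and out: "\<And>t. 0 \<le> t \<Longrightarrow> t \<le> 1 \<Longrightarrow> t \<notin> {a..b} \<Longrightarrow> gap u t = 0"
  shows "L2_norm (gap u) \<le> B * sqrt (b - a)"
proof -
  have "(\<integral>t. indicator {0..1} t * (gap u t)\<^sup>2 \<partial>lborel) \<le> (\<integral>t. B\<^sup>2 * indicator {a..b} t \<partial>lborel)"
  proof (rule integral_mono)
    show "integrable lborel (\<lambda>t. B\<^sup>2 * indicator {a..b} t)"
      by (intro integrable_mult_right integrable_real_indicator) (auto simp: emeasure_lborel_Icc_eq)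
    show "indicator {0..1} t * (gap u t)\<^sup>2 \<le> B\<^sup>2 * indicator {a..b} t" for t
    proof (cases "0 \<le> t \<and> t \<le> 1")
      case True
      have "(gap u t)\<^sup>2 \<le> B\<^sup>2" using le[of t] True B abs_le_square_iff[of "gap u t" B] by simp
      thus ?thesis using True out[of t] by (cases "t \<in> {a..b}") auto
    qed auto
  qed (rule gap_sq_integrable)
  also have "\<dots> = B\<^sup>2 * (b - a)" using w by simp
  finally have "L2_norm (gap u) \<le> sqrt (B\<^sup>2 * (b - a))" unfolding L2_norm_gap by simp
  also have "\<dots> = B * sqrt (b - a)" using B by (simp add: real_sqrt_mult)
  finally show ?thesis .
qed

text \<open>Above the maximum of \<open>f\<close> the truncation acts on the whole interval. This
  bounds the set whose supremum is \<open>rho_m\<close>.\<close>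

lemma L2_norm_gap_ge:
  assumes u: "fmax \<le> u"
  shows "u - fmax \<le> L2_norm (gap u)"
proof -
  have "(\<integral>t. (u - fmax)\<^sup>2 * indicator {0..1::real} t \<partial>lborel) \<le> (\<integral>t. indicator {0..1} t * (gap u t)\<^sup>2 \<partial>lborel)"
  proof (rule integral_mono)
    show "integrable lborel (\<lambda>t::real. (u - fmax)\<^sup>2 * indicator {0..1} t)"
      by (intro integrable_mult_right integrable_real_indicator) auto
    show "(u - fmax)\<^sup>2 * indicator {0..1} t \<le> indicator {0..1} t * (gap u t)\<^sup>2" for t
    proof (cases "0 \<le> t \<and> t \<le> 1")
      case True
      have "\<bar>u - fmax\<bar> \<le> \<bar>gap u t\<bar>" using f_le_fmax[of t] True u unfolding gap_def by auto
      hence "(u - fmax)\<^sup>2 \<le> (gap u t)\<^sup>2" by (simp add: abs_le_square_iff)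
      thus ?thesis using True by simp
    qed auto
  qed (rule gap_sq_integrable)
  hence "(u - fmax)\<^sup>2 \<le> (\<integral>t. indicator {0..1} t * (gap u t)\<^sup>2 \<partial>lborel)" by simp
  hence "sqrt ((u - fmax)\<^sup>2) \<le> L2_norm (gap u)" unfolding L2_norm_gap by (rule real_sqrt_le_mono)
  thus ?thesis using u by simp
qed

definition "rho_set \<epsilon> = {u - m0 | u. L2_norm (gap u) \<le> \<epsilon>}"

lemma rho_m_eq: "rho_m \<epsilon> f = Sup (rho_set \<epsilon>)"
  unfolding rho_m_def rho_set_def gap_def[abs_def] m0_def ..

lemma bdd_rho_set: "bdd_above (rho_set \<epsilon>)"
proof (rule bdd_aboveI)
  fix x assume "x \<in> rho_set \<epsilon>"
  then obtain u where "x = u - m0" "L2_norm (gap u) \<le> \<epsilon>" by (auto simp: rho_set_def)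
  thus "x \<le> max (fmax + \<epsilon> - m0) (fmax - m0)" using L2_norm_gap_ge[of u] by (cases "fmax \<le> u") auto
qed

text \<open>Truncation at height \<open>m0 + \<epsilon>\<close> changes \<open>f\<close> by at most
  \<epsilon> on an interval of length one.\<close>

lemma rho_ge_eps: assumes "0 < \<epsilon>" shows "\<epsilon> \<le> rho_m \<epsilon> f"
  unfolding rho_m_eq
proof (rule cSup_upper[OF _ bdd_rho_set])
  have "L2_norm (gap (m0 + \<epsilon>)) \<le> \<epsilon> * sqrt (1 - 0)"
    by (rule L2_norm_gap_le) (use gap_bounds[of _ "m0 + \<epsilon>"] assms in auto)
  thus "\<epsilon> \<in> rho_set \<epsilon>" unfolding rho_set_def by (auto intro!: exI[of _ "m0 + \<epsilon>"])
qed

text \<open>The factor 1 / 2 avoids the question whether the supremum is attained.\<close>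

lemma rho_attained:
  assumes "0 < \<epsilon>"
  obtains u where "rho_m \<epsilon> f / 2 \<le> u - m0" "L2_norm (gap u) \<le> \<epsilon>"
proof -
  have r: "rho_m \<epsilon> f / 2 < Sup (rho_set \<epsilon>)" using rho_ge_eps[OF assms] assms by (simp add: rho_m_eq)
  have "0 < Sup (rho_set \<epsilon>)" using rho_ge_eps[OF assms] assms by (simp add: rho_m_eq)
  moreover have "rho_set \<epsilon> \<noteq> {}"
  proof -
    have "L2_norm (gap (m0 + \<epsilon>)) \<le> \<epsilon> * sqrt (1 - 0)"
      by (rule L2_norm_gap_le) (use gap_bounds[of _ "m0 + \<epsilon>"] assms in auto)
    thus ?thesis by (auto simp: rho_set_def)
  qed
  ultimately obtain x where "x \<in> rho_set \<epsilon>" "rho_m \<epsilon> f / 2 < x"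
    using less_cSupD[OF _ r] by blast
  then obtain u where "x = u - m0" "L2_norm (gap u) \<le> \<epsilon>" "rho_m \<epsilon> f / 2 < x" unfolding rho_set_def by blast
  thus ?thesis using that[of u] by simp
qed

text \<open>Otherwise truncating at level \<open>m0 + 2 \<rho>\<close> would change \<open>f\<close> by at most \<open>2 \<rho>\<close> on an
  interval of length \<open>\<epsilon>\<^sup>2 / (4 \<rho>\<^sup>2)\<close>, that is by at most \<open>\<epsilon>\<close> in norm.\<close>

lemma flat_side:
  assumes \<epsilon>: "0 < \<epsilon>"
  defines "\<rho> \<equiv> rho_m \<epsilon> f"
  defines "w \<equiv> \<epsilon>\<^sup>2 / (4 * \<rho>\<^sup>2)"
  shows "(Z + w / 2 \<le> 1 \<and> f (Z + w / 2) \<le> m0 + 2 * \<rho>) \<or> (0 \<le> Z - w / 2 \<and> f (Z - w / 2) \<le> m0 + 2 * \<rho>)"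
proof (rule ccontr)
  assume neg: "\<not> ?thesis"
  have \<rho>: "0 < \<rho>" using rho_ge_eps[OF \<epsilon>] \<epsilon> by (simp add: \<rho>_def)
  have w: "0 < w" using \<epsilon> \<rho> by (simp add: w_def)
  have "L2_norm (gap (m0 + 2 * \<rho>)) \<le> (2 * \<rho>) * sqrt ((Z + w / 2) - (Z - w / 2))"
  proof (rule L2_norm_gap_le)
    fix t assume t: "0 \<le> t" "t \<le> 1" "t \<notin> {Z - w / 2 .. Z + w / 2}"
    hence "m0 + 2 * \<rho> \<le> f t"
    proof (cases "t < Z")
      case True
      hence "t \<le> Z - w / 2" using t by auto
      moreover have "m0 + 2 * \<rho> < f (Z - w / 2)" using neg calculation t by auto
      ultimately show ?thesis using mono_left[of t "Z - w / 2"] t w by simp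
    next
      case False
      hence "Z + w / 2 \<le> t" using t by auto
      moreover have "m0 + 2 * \<rho> < f (Z + w / 2)" using neg calculation t by auto
      ultimately show ?thesis using mono_right[of "Z + w / 2" t] t w by simp
    qed
    thus "gap (m0 + 2 * \<rho>) t = 0" by (simp add: gap_def)
  qed (use gap_bounds[of _ "m0 + 2 * \<rho>"] w \<rho> in auto)
  also have "(2 * \<rho>) * sqrt ((Z + w / 2) - (Z - w / 2)) = \<epsilon>"
    using \<epsilon> \<rho> by (simp add: w_def real_sqrt_divide real_sqrt_mult)
  finally have "2 * \<rho> \<in> rho_set \<epsilon>" by (auto simp: rho_set_def intro!: exI[of _ "m0 + 2 * \<rho>"])
  hence "2 * \<rho> \<le> \<rho>" unfolding \<rho>_def rho_m_eq by (rule cSup_upper[OF _ bdd_rho_set])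
  thus False using \<rho> by simp
qed

end

section \<open>Conditioning on the split paths\<close>

locale min_ci = white_noise_model M W B1 B2 + convex_min f
  for M :: "'a measure" and W B1 B2 :: "real \<Rightarrow> 'a \<Rightarrow> real" and f :: "real \<Rightarrow> real" +
  fixes \<epsilon> :: real
  assumes eps: "0 < \<epsilon>"
begin

abbreviation "y x \<equiv> (\<lambda>t. F t + \<epsilon> * x t)"
abbreviation "npath k \<omega> \<equiv> path_of (N k) \<omega>"
abbreviation "law k \<equiv> distr M path_space (path_of (N k))"

lemma path_at: "t \<in> {0..1} \<Longrightarrow> npath k \<omega> t = N k t \<omega>" by (simp add: path_of_def)

lemma measurable_path: "k < 3 \<Longrightarrow> npath k \<in> M \<rightarrow>\<^sub>M path_space"
  by (intro measurable_path_of measurable_split_noise)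

lemma prob_space_law: "k < 3 \<Longrightarrow> prob_space (law k)"
  by (intro W.prob_space_distr measurable_path)

lemma incr_cong:
  assumes "\<And>t. t \<in> {0..1} \<Longrightarrow> y1 t = y2 t" shows "incr y1 = incr y2"
  using assms grid_in_unit by (fastforce simp: incr_def fun_eq_iff)

lemma CI_random_eq:
  "CI_random W B1 B2 \<alpha> \<epsilon> f \<omega> = {lo \<alpha> \<epsilon> (y (npath 0 \<omega>)) (y (npath 1 \<omega>)) (y (npath 2 \<omega>)) .. hi \<alpha> \<epsilon> (y (npath 0 \<omega>)) (y (npath 1 \<omega>)) (y (npath 2 \<omega>))}"
proof -
  have h: "a + e * w + c * e * b + d * e * b' = a + e * (w + c * b + d * b')"
    "a + e * w + c * e * b - d * e * b' = a + e * (w + c * b - d * b')"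
    "a + e * w - c * e * b = a + e * (w - c * b)" for a e w b b' c d :: real
    by (simp_all add: algebra_simps)
  have "incr (Y_l \<epsilon> (\<lambda>t. obs W \<epsilon> f t \<omega>) (\<lambda>t. B1 t \<omega>) (\<lambda>t. B2 t \<omega>)) = incr (y (npath 0 \<omega>))"
    by (rule incr_cong) (simp only: Y_l_def obs_def F_def[symmetric] path_at One_nat_def split_noise_simps h)
  moreover have "incr (Y_s \<epsilon> (\<lambda>t. obs W \<epsilon> f t \<omega>) (\<lambda>t. B1 t \<omega>) (\<lambda>t. B2 t \<omega>)) = incr (y (npath 1 \<omega>))"
    by (rule incr_cong) (simp only: Y_s_def obs_def F_def[symmetric] path_at One_nat_def split_noise_simps h)
  moreover have "incr (Y_e \<epsilon> (\<lambda>t. obs W \<epsilon> f t \<omega>) (\<lambda>t. B1 t \<omega>)) = incr (y (npath 2 \<omega>))"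
    by (rule incr_cong) (simp only: Y_e_def obs_def F_def[symmetric] path_at One_nat_def split_noise_simps h)
  ultimately show ?thesis unfolding CI_random_def CI_m_eq
    by (intro arg_cong2[where f=atLeastAtMost] lo_hi_cong)
qed

lemma measurable_incr: "(\<lambda>x. incr (y x) j i) \<in> borel_measurable path_space"
proof (cases "i \<in> {1..2 ^ j}")
  case True
  have "(\<lambda>x. x (grid j i)) \<in> borel_measurable path_space" "(\<lambda>x. x (grid j (i - 1))) \<in> borel_measurable path_space"
    unfolding path_space_def using True by (auto intro!: measurable_component_singleton grid_in_unit)
  thus ?thesis using True unfolding incr_def by simp
qed (auto simp: incr_def)

lemma measurable_incr_comp: "g \<in> Q \<rightarrow>\<^sub>M path_space \<Longrightarrow> (\<lambda>\<omega>. incr (y (g \<omega>)) j i) \<in> borel_measurable Q"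
  by (rule measurable_compose[OF _ measurable_incr])

lemma distr_pair:
  "distr M (path_space \<Otimes>\<^sub>M path_space) (\<lambda>\<omega>. (npath 0 \<omega>, npath 1 \<omega>)) = law 0 \<Otimes>\<^sub>M law 1"
proof -
  have "W.indep_var path_space ((\<lambda>f. f 0) \<circ> (\<lambda>\<omega>. restrict (\<lambda>i. npath i \<omega>) {0})) path_space
     ((\<lambda>f. f 1) \<circ> (\<lambda>\<omega>. restrict (\<lambda>i. npath i \<omega>) {1}))"
    by (rule W.indep_var_compose[OF W.indep_var_restrict[OF indep_split_paths]]) auto
  hence "W.indep_var path_space (npath 0) path_space (npath 1)" by (simp add: comp_def)
  thus ?thesis unfolding W.indep_var_distribution_eq by simp
qed

text \<open>Freezes the localization sample: the event is first measured for a fixed path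
  \<open>x\<close> and then averaged over the law of \<open>x\<close>.\<close>

lemma emeasure_pair:
  assumes A: "A \<in> sets (path_space \<Otimes>\<^sub>M path_space)"
  shows "emeasure M {\<omega> \<in> space M. (npath 0 \<omega>, npath 1 \<omega>) \<in> A}
    = (\<integral>\<^sup>+x. emeasure M {\<omega> \<in> space M. (x, npath 1 \<omega>) \<in> A} \<partial>law 0)"
proof -
  interpret P1: prob_space "law 1" by (rule prob_space_law) simp
  note m[measurable] = measurable_path[of 0, simplified] measurable_path[of 1, simplified]
  have "emeasure M {\<omega> \<in> space M. (npath 0 \<omega>, npath 1 \<omega>) \<in> A} = emeasure (law 0 \<Otimes>\<^sub>M law 1) A"
    unfolding distr_pair[symmetric]
    by (subst emeasure_distr) (use A in \<open>auto intro!: arg_cong[where f="emeasure M"]\<close>)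
  also have "\<dots> = (\<integral>\<^sup>+x. emeasure (law 1) (Pair x -` A) \<partial>law 0)"
    by (rule P1.emeasure_pair_measure_alt) (use A in \<open>simp cong: sets_pair_measure_cong\<close>)
  also have "\<dots> = (\<integral>\<^sup>+x. emeasure M {\<omega> \<in> space M. (x, npath 1 \<omega>) \<in> A} \<partial>law 0)"
  proof (rule nn_integral_cong)
    fix x
    have "Pair x -` A \<in> sets path_space" by (rule sets_Pair1[OF A])
    thus "emeasure (law 1) (Pair x -` A) = emeasure M {\<omega> \<in> space M. (x, npath 1 \<omega>) \<in> A}"
      by (subst emeasure_distr) (auto intro!: arg_cong[where f="emeasure M"])
  qed
  finally show ?thesis .
qed

lemma emeasure_triple:
  assumes A: "A \<in> sets (path_space \<Otimes>\<^sub>M (path_space \<Otimes>\<^sub>M path_space))"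
  shows "emeasure M {\<omega> \<in> space M. (npath 0 \<omega>, npath 1 \<omega>, npath 2 \<omega>) \<in> A}
    = (\<integral>\<^sup>+x. \<integral>\<^sup>+z. emeasure M {\<omega> \<in> space M. (x, z, npath 2 \<omega>) \<in> A} \<partial>law 1 \<partial>law 0)"
proof -
  interpret P1: prob_space "law 1" by (rule prob_space_law) simp
  interpret P2: prob_space "law 2" by (rule prob_space_law) simp
  interpret P12: pair_prob_space "law 1" "law 2" ..
  note m[measurable] = measurable_path[of 0, simplified] measurable_path[of 1, simplified] measurable_path[of 2, simplified]
  have "distr M (path_space \<Otimes>\<^sub>M (path_space \<Otimes>\<^sub>M path_space)) (\<lambda>\<omega>. (npath 0 \<omega>, npath 1 \<omega>, npath 2 \<omega>)) = law 0 \<Otimes>\<^sub>M (law 1 \<Otimes>\<^sub>M law 2)"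
    by (rule W.distr_indep_triple[OF indep_split_paths])
  hence "emeasure M {\<omega> \<in> space M. (npath 0 \<omega>, npath 1 \<omega>, npath 2 \<omega>) \<in> A} = emeasure (law 0 \<Otimes>\<^sub>M (law 1 \<Otimes>\<^sub>M law 2)) A"
    by (subst \<open>_ = law 0 \<Otimes>\<^sub>M (law 1 \<Otimes>\<^sub>M law 2)\<close>[symmetric], subst emeasure_distr)
      (use A in \<open>auto intro!: arg_cong[where f="emeasure M"]\<close>)
  also have "\<dots> = (\<integral>\<^sup>+x. emeasure (law 1 \<Otimes>\<^sub>M law 2) (Pair x -` A) \<partial>law 0)"
    by (rule P12.emeasure_pair_measure_alt) (use A in \<open>simp cong: sets_pair_measure_cong\<close>)
  also have "\<dots> = (\<integral>\<^sup>+x. \<integral>\<^sup>+z. emeasure M {\<omega> \<in> space M. (x, z, npath 2 \<omega>) \<in> A} \<partial>law 1 \<partial>law 0)"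
  proof (rule nn_integral_cong)
    fix x
    have Ax: "Pair x -` A \<in> sets (path_space \<Otimes>\<^sub>M path_space)" by (rule sets_Pair1[OF A])
    have "emeasure (law 1 \<Otimes>\<^sub>M law 2) (Pair x -` A) = (\<integral>\<^sup>+z. emeasure (law 2) (Pair z -` Pair x -` A) \<partial>law 1)"
      by (rule P2.emeasure_pair_measure_alt) (use Ax in \<open>simp cong: sets_pair_measure_cong\<close>)
    also have "\<dots> = (\<integral>\<^sup>+z. emeasure M {\<omega> \<in> space M. (x, z, npath 2 \<omega>) \<in> A} \<partial>law 1)"
    proof (rule nn_integral_cong)
      fix z
      have "Pair z -` Pair x -` A \<in> sets path_space" by (rule sets_Pair1[OF Ax])
      thus "emeasure (law 2) (Pair z -` Pair x -` A) = emeasure M {\<omega> \<in> space M. (x, z, npath 2 \<omega>) \<in> A}"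
        by (subst emeasure_distr) (auto intro!: arg_cong[where f="emeasure M"])
    qed
    finally show "emeasure (law 1 \<Otimes>\<^sub>M law 2) (Pair x -` A) = (\<integral>\<^sup>+z. emeasure M {\<omega> \<in> space M. (x, z, npath 2 \<omega>) \<in> A} \<partial>law 1)" .
  qed
  finally show ?thesis .
qed

lemma sdiff_y: "in_range j w \<Longrightarrow> sdiff (y (npath k \<omega>)) j w = sdiff F j w + \<epsilon> * sdiff (\<lambda>t. N k t \<omega>) j w"
proof -
  assume "in_range j w"
  hence "grid j w \<in> {0..1}" "grid j (w + 1) \<in> {0..1}" "grid j (w + 2) \<in> {0..1}"
    by (auto simp: in_range_def grid_nonneg_iff grid_le_1_iff)
  from this[THEN path_at, of k \<omega>] show ?thesis
    unfolding sdiff_def by (simp only:) (simp add: right_diff_distrib distrib_left)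
qed

text \<open>Not stopping at a level requires both of its tests to exceed the threshold, so one
  favourable side per level suffices for an upper bound. As \<open>yl\<close> is fixed, so are the
  chosen windows, and they are disjoint for any choice of sides.\<close>

lemma prob_no_stop_le:
  assumes fin: "finite A"
    and A: "\<And>j. j \<in> A \<Longrightarrow> \<exists>r. in_range j (win yl r j) \<and> sgn_side r * sdiff F j (win yl r j) \<le> (2 - v) * sigma \<epsilon> j"
  shows "emeasure M {\<omega> \<in> space M. \<forall>j\<in>A. no_stop \<epsilon> yl (y (npath 1 \<omega>)) j} \<le> ennreal (Phi (- v) ^ card A)"
proof -
  interpret G: gauss_process M "sqrt 3" "N 1" by (rule gauss_process_split_noise) simp
  obtain r where r: "\<And>j. j \<in> A \<Longrightarrow> in_range j (win yl (r j) j)"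
      "\<And>j. j \<in> A \<Longrightarrow> sgn_side (r j) * sdiff F j (win yl (r j) j) \<le> (2 - v) * sigma \<epsilon> j"
    using A by metis
  let ?E = "{\<omega> \<in> space M. \<forall>j\<in>A. 2 * sigma \<epsilon> j < sgn_side (r j) * (sdiff F j (win yl (r j) j) + \<epsilon> * sdiff (\<lambda>t. N 1 t \<omega>) j (win yl (r j) j))}"
  have "?E \<in> sets M"
  proof (intro sets.sets_Collect_finite_All fin)
    fix j assume j: "j \<in> A"
    note [measurable] = G.measurable_sdiff[OF r(1)[OF j]]
    show "{\<omega> \<in> space M. 2 * sigma \<epsilon> j < sgn_side (r j) * (sdiff F j (win yl (r j) j) + \<epsilon> * sdiff (\<lambda>t. N 1 t \<omega>) j (win yl (r j) j))} \<in> sets M"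
      by measurable
  qed
  moreover have "{\<omega> \<in> space M. \<forall>j\<in>A. no_stop \<epsilon> yl (y (npath 1 \<omega>)) j} \<subseteq> ?E"
  proof safe
    fix \<omega> j assume *: "\<forall>j\<in>A. no_stop \<epsilon> yl (y (npath 1 \<omega>)) j" and j: "j \<in> A"
    have "ereal (2 * sigma \<epsilon> j) < ereal (sgn_side (r j) * sdiff (y (npath 1 \<omega>)) j (win yl (r j) j))"
      using * j T_stat_le[OF r(1)[OF j], of "y (npath 1 \<omega>)"] unfolding no_stop_def by (blast intro: less_le_trans)
    thus "2 * sigma \<epsilon> j < sgn_side (r j) * (sdiff F j (win yl (r j) j) + \<epsilon> * sdiff (\<lambda>t. N 1 t \<omega>) j (win yl (r j) j))"
      unfolding sdiff_y[OF r(1)[OF j]] by simp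
  qed
  ultimately have "emeasure M {\<omega> \<in> space M. \<forall>j\<in>A. no_stop \<epsilon> yl (y (npath 1 \<omega>)) j} \<le> emeasure M ?E"
    by (intro emeasure_mono)
  also have "\<dots> \<le> ennreal (Phi (- v) ^ card A)"
    unfolding W.emeasure_eq_measure
    by (intro ennreal_leI G.prob_no_stop_windows[OF refl eps fin r(1) _ r(2)] windows_disjoint)
  finally show ?thesis .
qed

lemma pred_no_stop_path:
  assumes "g \<in> Q \<rightarrow>\<^sub>M path_space" "h \<in> Q \<rightarrow>\<^sub>M path_space"
  shows "Measurable.pred Q (\<lambda>\<omega>. no_stop \<epsilon> (y (g \<omega>)) (y (h \<omega>)) j)"
  by (rule pred_no_stop; rule measurable_incr_comp; rule assms)

lemma emeasure_no_stop_le: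
  assumes fin: "finite A"
    and A: "\<And>x j. j \<in> A \<Longrightarrow> \<exists>r. in_range j (win (y x) r j) \<and> sgn_side r * sdiff F j (win (y x) r j) \<le> (2 - v) * sigma \<epsilon> j"
  shows "emeasure M {\<omega> \<in> space M. \<forall>j\<in>A. no_stop \<epsilon> (y (npath 0 \<omega>)) (y (npath 1 \<omega>)) j} \<le> ennreal (Phi (- v) ^ card A)"
proof -
  interpret P0: prob_space "law 0" by (rule prob_space_law) simp
  let ?A = "{p \<in> space (path_space \<Otimes>\<^sub>M path_space). \<forall>j\<in>A. no_stop \<epsilon> (y (fst p)) (y (snd p)) j}"
  note m = measurable_path[of 0, simplified] measurable_path[of 1, simplified]
  have Am: "?A \<in> sets (path_space \<Otimes>\<^sub>M path_space)"
    by (intro sets.sets_Collect_finite_All fin predE pred_no_stop_path measurable_fst measurable_snd)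
  have eq: "{\<omega> \<in> space M. \<forall>j\<in>A. no_stop \<epsilon> (y (npath 0 \<omega>)) (y (npath 1 \<omega>)) j} = {\<omega> \<in> space M. (npath 0 \<omega>, npath 1 \<omega>) \<in> ?A}"
    using measurable_space[OF m(1)] measurable_space[OF m(2)] by (auto simp: space_pair_measure)
  have "emeasure M {\<omega> \<in> space M. (npath 0 \<omega>, npath 1 \<omega>) \<in> ?A} = (\<integral>\<^sup>+x. emeasure M {\<omega> \<in> space M. (x, npath 1 \<omega>) \<in> ?A} \<partial>law 0)"
    by (rule emeasure_pair[OF Am])
  also have "\<dots> \<le> (\<integral>\<^sup>+x. ennreal (Phi (- v) ^ card A) \<partial>law 0)"
  proof (rule nn_integral_mono)
    fix x assume x: "x \<in> space (law 0)"
    have "{\<omega> \<in> space M. (x, npath 1 \<omega>) \<in> ?A} = {\<omega> \<in> space M. \<forall>j\<in>A. no_stop \<epsilon> (y x) (y (npath 1 \<omega>)) j}"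
      using x measurable_space[OF m(2)] by (auto simp: space_pair_measure)
    thus "emeasure M {\<omega> \<in> space M. (x, npath 1 \<omega>) \<in> ?A} \<le> ennreal (Phi (- v) ^ card A)"
      using prob_no_stop_le[OF fin A] by simp
  qed
  also have "\<dots> = ennreal (Phi (- v) ^ card A)" using P0.emeasure_space_1 by simp
  finally show ?thesis unfolding eq .
qed

definition "\<rho> = rho_m \<epsilon> f"
text \<open>The length on which a change of size \<open>2 * \<rho>\<close> has norm exactly
  \<epsilon>. It converts the modulus into a dyadic scale.\<close>

definition "width = \<epsilon>\<^sup>2 / (4 * \<rho>\<^sup>2)"

lemma rho_pos: "0 < \<rho>" "\<epsilon> \<le> \<rho>" using rho_ge_eps[OF eps] eps by (simp_all add: \<rho>_def)

lemma width_pos: "0 < width" using eps rho_pos by (simp add: width_def)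

lemma width_le_1: "width \<le> 1"
proof -
  have "\<epsilon>\<^sup>2 \<le> \<rho>\<^sup>2" using rho_pos eps by (intro power_mono) auto
  thus ?thesis using rho_pos by (simp add: width_def divide_le_eq) (use zero_le_power2[of \<rho>] in linarith)
qed

lemma sqrt_width: "2 * \<rho> * sqrt width = \<epsilon>"
  using eps rho_pos by (simp add: width_def real_sqrt_divide real_sqrt_mult)

lemma drift_small:
  assumes j: "64 * mesh j \<le> width"
  shows "\<exists>r. in_range j (win (y x) r j) \<and> sgn_side r * sdiff F j (win (y x) r j) \<le> 2 * sigma \<epsilon> j"
proof -
  have fs: "(Z + width / 2 \<le> 1 \<and> f (Z + width / 2) \<le> m0 + 2 * \<rho>) \<or> (0 \<le> Z - width / 2 \<and> f (Z - width / 2) \<le> m0 + 2 * \<rho>)"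
    using flat_side[OF eps] by (simp add: \<rho>_def width_def)
  let ?m = "mesh j"
  have m: "0 < ?m" by (rule mesh_pos)
  have "?m * (?m * (4 * (2 * \<rho>) / width)) \<le> 2 * sigma \<epsilon> j"
  proof -
    \<comment> \<open>In these variables the drift bound is
      \<open>8 * \<rho> * a ^ 4 / b\<^sup>2\<close>. The hypothesis says
      \<open>8 * a \<le> b\<close>, so this is at most \<open>\<rho> * a * b\<close>, and
      \<open>2 * \<rho> * b = \<epsilon>\<close>.\<close>
    define a b where "a = sqrt ?m" and "b = sqrt width"
    have ab: "0 < a" "0 < b" and sq: "?m = a * a" "width = b * b"
      using m width_pos by (simp_all add: a_def b_def)
    have "sqrt (64 * ?m) \<le> sqrt width" using j by simp
    hence mw: "8 * a \<le> b" by (simp add: real_sqrt_mult a_def b_def)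
    have "(8 * a) * (a * a) \<le> b * (b * b)" using mw ab by (intro mult_mono) auto
    hence "\<rho> * a * ((8 * a) * (a * a)) \<le> \<rho> * a * (b * (b * b))" using rho_pos ab by (intro mult_left_mono) auto
    hence "?m * (?m * (4 * (2 * \<rho>) / width)) \<le> \<rho> * a * b"
      unfolding sq using ab by (simp add: divide_simps) (simp add: ac_simps)
    also have "\<dots> \<le> sqrt ?m * \<epsilon>" 
    proof -
      have "a * (2 * \<rho> * b) = a * \<epsilon>" unfolding b_def by (rule arg_cong[OF sqrt_width])
      moreover have "0 \<le> \<rho> * a * b" using rho_pos ab by simp
      moreover have "a * (2 * \<rho> * b) = \<rho> * a * b + \<rho> * a * b" by simp
      ultimately show ?thesis unfolding a_def[symmetric] by linarith
    qed
    also have "\<dots> \<le> 2 * (sqrt 6 * (sqrt ?m * \<epsilon>))"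
    proof -
      have "1 \<le> sqrt (6::real)" by simp
      hence "1 \<le> 2 * sqrt (6::real)" by linarith
      thus ?thesis using mult_right_mono[of 1 "2 * sqrt 6" "sqrt ?m * \<epsilon>"] m eps by simp
    qed
    also have "\<dots> = 2 * sigma \<epsilon> j" using eps by (simp add: sigma_def real_sqrt_mult)
    finally show ?thesis .
  qed
  with drift_flat[OF width_pos j _ fs, of "y x"] rho_pos show ?thesis by (meson le_less order_trans zero_less_numeral mult_nonneg_nonneg)
qed

lemma emeasure_no_stop_flat:
  assumes "64 * mesh a \<le> width"
  shows "emeasure M {\<omega> \<in> space M. \<forall>j\<in>{a..<a + k}. no_stop \<epsilon> (y (npath 0 \<omega>)) (y (npath 1 \<omega>)) j} \<le> ennreal ((1 / 2) ^ k)"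
proof -
  have "emeasure M {\<omega> \<in> space M. \<forall>j\<in>{a..<a + k}. no_stop \<epsilon> (y (npath 0 \<omega>)) (y (npath 1 \<omega>)) j} \<le> ennreal (Phi (- 0) ^ card {a..<a + k})"
  proof (rule emeasure_no_stop_le)
    fix x j assume "j \<in> {a..<a + k}"
    hence "64 * mesh j \<le> width" using assms mesh_antimono[of a j] by simp
    from drift_small[OF this]
    show "\<exists>r. in_range j (win (y x) r j) \<and> sgn_side r * sdiff F j (win (y x) r j) \<le> (2 - 0) * sigma \<epsilon> j" by simp
  qed simp
  thus ?thesis by (simp add: Phi_0)
qed

text \<open>The first inequality makes the tests likely to stop from level \<open>a\<close> on; the
  second keeps \<open>2 ^ a\<close> comparable to \<open>1 / width\<close>, which the length bound
  needs.\<close>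

lemma ex_fine_level: obtains a where "64 * mesh a \<le> width" "width \<le> 128 * mesh a"
proof -
  have "\<exists>a. 64 * mesh a \<le> width"
  proof -
    obtain n where "64 / width < 2 ^ n" using real_arch_pow[of 2 "64 / width"] by auto
    thus ?thesis using width_pos by (intro exI[of _ n]) (simp add: mesh_def field_simps)
  qed
  define a where "a = (LEAST a. 64 * mesh a \<le> width)"
  have a: "64 * mesh a \<le> width" unfolding a_def by (rule LeastI_ex) fact
  have "width \<le> 128 * mesh a"
  proof (cases a)
    case 0 thus ?thesis using width_le_1 by (simp add: mesh_def)
  next
    case (Suc b)
    hence "\<not> 64 * mesh b \<le> width" unfolding a_def using not_less_Least[of b] by (metis lessI)
    thus ?thesis using Suc by (simp add: mesh_Suc[of b])
  qed
  with a show ?thesis using that by blast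
qed

text \<open>For every \<open>k\<close> the event is contained in one of probability at most
  \<open>(1 / 2) ^ k\<close>, a run of \<open>k\<close> fine levels without a stop.\<close>

lemma AE_stops: "AE \<omega> in M. \<exists>j. \<not> no_stop \<epsilon> (y (npath 0 \<omega>)) (y (npath 1 \<omega>)) j"
proof -
  obtain a where a: "64 * mesh a \<le> width" by (rule ex_fine_level)
  have ns[measurable]: "Measurable.pred M (\<lambda>\<omega>. no_stop \<epsilon> (y (npath 0 \<omega>)) (y (npath 1 \<omega>)) j)" for j
    by (intro pred_no_stop_path measurable_path) simp_all
  let ?N = "{\<omega> \<in> space M. \<forall>j. no_stop \<epsilon> (y (npath 0 \<omega>)) (y (npath 1 \<omega>)) j}"
  have Nm: "?N \<in> sets M" by measurable
  have "emeasure M ?N \<le> ennreal ((1 / 2) ^ k)" for k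
  proof -
    have "emeasure M ?N \<le> emeasure M {\<omega> \<in> space M. \<forall>j\<in>{a..<a + k}. no_stop \<epsilon> (y (npath 0 \<omega>)) (y (npath 1 \<omega>)) j}"
      using ns by (intro emeasure_mono) (auto intro!: sets.sets_Collect_finite_All predE)
    also have "\<dots> \<le> ennreal ((1 / 2) ^ k)" by (rule emeasure_no_stop_flat[OF a])
    finally show ?thesis .
  qed
  moreover have "(\<lambda>k. ennreal ((1 / 2) ^ k)) \<longlonglongrightarrow> ennreal 0"
    by (intro tendsto_ennrealI LIMSEQ_power_zero) simp
  ultimately have "emeasure M ?N \<le> ennreal 0" by (intro LIMSEQ_le_const[of "\<lambda>k. ennreal ((1 / 2) ^ k)"]) blast+
  hence "emeasure M ?N = 0" by simp
  thus ?thesis using Nm by (subst AE_iff_measurable[OF _ refl]) auto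
qed

end

section \<open>Coverage\<close>

lemma exp_square_le: "exp (- ((real k + 3)\<^sup>2 / 2)) \<le> (1 / 2) ^ (k + 3)"
proof -
  have "real k + 3 \<le> (real k + 3)\<^sup>2 / 2" by (simp add: power2_eq_square algebra_simps)
  hence "exp (- ((real k + 3)\<^sup>2 / 2)) \<le> exp (- (real k + 3))" by simp
  also have "\<dots> = exp (- 1) ^ (k + 3)" by (simp add: exp_of_nat_mult[symmetric])
  also have "\<dots> \<le> (1 / 2) ^ (k + 3)"
  proof (rule power_mono)
    have "2 \<le> exp (1::real)" using exp_ge_add_one_self[of 1] by simp
    thus "exp (- 1) \<le> (1 / 2 :: real)" by (simp add: exp_minus field_simps)
  qed simp
  finally show ?thesis .
qed

context min_ci
begin

text \<open>For frozen \<open>Y_l\<close> the first level \<open>j1\<close> whose hull misses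
  \<open>Z\<close> is a fixed number. Every \<open>j0\<close> in the event is at least
  \<open>j1\<close>, so the union over \<open>j0\<close> costs nothing: the \<open>K_const\<close>
  levels after \<open>j1\<close> must all fail to stop, each against nonpositive drift on one
  side.\<close>

lemma emeasure_hull_failure:
  assumes \<beta>: "0 < \<beta>" "\<beta> < 1"
  defines "A \<equiv> {p \<in> space (path_space \<Otimes>\<^sub>M path_space).
     \<exists>j0. Z \<notin> loc_hull (y (fst p)) j0 \<and> (\<forall>j\<in>{..j0 + K_const \<beta>}. no_stop \<epsilon> (y (fst p)) (y (snd p)) j)}"
  shows "A \<in> sets (path_space \<Otimes>\<^sub>M path_space)"
    and "emeasure M {\<omega> \<in> space M. (npath 0 \<omega>, npath 1 \<omega>) \<in> A} \<le> ennreal \<beta>"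
proof -
  interpret P0: prob_space "law 0" by (rule prob_space_law) simp
  note m = measurable_path[of 0, simplified] measurable_path[of 1, simplified]
  have ns[measurable]: "Measurable.pred (path_space \<Otimes>\<^sub>M path_space) (\<lambda>p. no_stop \<epsilon> (y (fst p)) (y (snd p)) j)" for j
    by (intro pred_no_stop_path measurable_fst measurable_snd)
  have [measurable]: "Measurable.pred (path_space \<Otimes>\<^sub>M path_space) (\<lambda>p. Z \<notin> loc_hull (y (fst p)) j)" for j
  proof -
    have "(\<lambda>p. i_hat (y (fst p)) j) \<in> path_space \<Otimes>\<^sub>M path_space \<rightarrow>\<^sub>M count_space UNIV"
      by (intro measurable_i_hat measurable_incr_comp measurable_fst)
    from measurable_compose[OF this, of "\<lambda>i. Z \<notin> {grid (Suc j) (2 * i - 9) .. grid (Suc j) (2 * i + 7)}" "count_space UNIV"]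
    show ?thesis by (simp add: loc_hull_def)
  qed
  show Am: "A \<in> sets (path_space \<Otimes>\<^sub>M path_space)" unfolding A_def by measurable
  have "emeasure M {\<omega> \<in> space M. (npath 0 \<omega>, npath 1 \<omega>) \<in> A} = (\<integral>\<^sup>+x. emeasure M {\<omega> \<in> space M. (x, npath 1 \<omega>) \<in> A} \<partial>law 0)"
    by (rule emeasure_pair[OF Am])
  also have "\<dots> \<le> (\<integral>\<^sup>+x. ennreal \<beta> \<partial>law 0)"
  proof (rule nn_integral_mono)
    fix x
    show "emeasure M {\<omega> \<in> space M. (x, npath 1 \<omega>) \<in> A} \<le> ennreal \<beta>"
    proof (cases "\<exists>j0. Z \<notin> loc_hull (y x) j0")
      case False
      hence "{\<omega> \<in> space M. (x, npath 1 \<omega>) \<in> A} = {}" by (auto simp: A_def)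
      thus ?thesis by (simp only: emeasure_empty zero_le)
    next
      case True
      define j1 where "j1 = (LEAST j. Z \<notin> loc_hull (y x) j)"
      have j1: "Z \<notin> loc_hull (y x) j1" unfolding j1_def by (rule LeastI_ex[OF True])
      have j1le: "j1 \<le> j" if "Z \<notin> loc_hull (y x) j" for j unfolding j1_def by (rule Least_le) (rule that)
      let ?S = "{\<omega> \<in> space M. \<forall>j\<in>{j1<..j1 + K_const \<beta>}. no_stop \<epsilon> (y x) (y (npath 1 \<omega>)) j}"
      have sub: "{\<omega> \<in> space M. (x, npath 1 \<omega>) \<in> A} \<subseteq> ?S"
      proof
        fix \<omega> assume "\<omega> \<in> {\<omega> \<in> space M. (x, npath 1 \<omega>) \<in> A}"
        then obtain j0 where w: "\<omega> \<in> space M" and j0: "Z \<notin> loc_hull (y x) j0"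
          "\<forall>j\<in>{..j0 + K_const \<beta>}. no_stop \<epsilon> (y x) (y (npath 1 \<omega>)) j" by (auto simp: A_def)
        show "\<omega> \<in> ?S" using w j0(2) j1le[OF j0(1)] by simp
      qed
      show ?thesis
      proof (cases "x \<in> space path_space")
        case x: True
        have "Measurable.pred M (\<lambda>\<omega>. no_stop \<epsilon> (y x) (y (npath 1 \<omega>)) j)" for j
          by (rule pred_no_stop_path[of "\<lambda>_. x"]) (use x m in auto)
        hence "?S \<in> sets M" by (intro sets.sets_Collect_finite_All predE) auto
        hence "emeasure M {\<omega> \<in> space M. (x, npath 1 \<omega>) \<in> A} \<le> emeasure M ?S"
          by (rule emeasure_mono[OF sub])
        also have "\<dots> \<le> ennreal (Phi (- 2) ^ card {j1<..j1 + K_const \<beta>})"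
        proof (rule prob_no_stop_le)
          fix j assume "j \<in> {j1<..j1 + K_const \<beta>}"
          with drift_outside_hull[OF j1, of j]
          show "\<exists>r. in_range j (win (y x) r j) \<and> sgn_side r * sdiff F j (win (y x) r j) \<le> (2 - 2) * sigma \<epsilon> j" by simp
        qed simp
        also have "\<dots> \<le> ennreal \<beta>" using Phi_K_const[OF \<beta>] by (simp add: ennreal_leI)
        finally show ?thesis .
      next
        case False
        hence "{\<omega> \<in> space M. (x, npath 1 \<omega>) \<in> A} = {}" by (auto simp: A_def space_pair_measure)
        thus ?thesis by (simp only: emeasure_empty zero_le)
      qed
    qed
  qed
  also have "\<dots> = ennreal \<beta>" using P0.emeasure_space_1 by simp
  finally show "emeasure M {\<omega> \<in> space M. (npath 0 \<omega>, npath 1 \<omega>) \<in> A} \<le> ennreal \<beta>" .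
qed

text \<open>The index of a cell that contains \<open>Z\<close>; the maximum with 1 matters at
  \<open>Z = 0\<close>, where the ceiling is 0.\<close>

definition star :: "nat \<Rightarrow> int" where "star j = max 1 \<lceil>Z * 2 ^ j\<rceil>"

lemma star_range: "1 \<le> star j" "star j \<le> 2 ^ j"
proof -
  have "Z * 2 ^ j \<le> 1 * 2 ^ j" using Z by (intro mult_right_mono) auto
  hence "Z * 2 ^ j \<le> of_int (2 ^ j)" by simp
  hence "\<lceil>Z * 2 ^ j\<rceil> \<le> 2 ^ j" by (simp only: ceiling_le_iff)
  thus "1 \<le> star j" "star j \<le> 2 ^ j" by (simp_all add: star_def)
qed

lemma grid_star: "grid j (star j - 1) \<le> Z" "Z \<le> grid j (star j)"
proof -
  have "real_of_int (star j - 1) \<le> Z * 2 ^ j" using Z(1) by (auto simp: star_def max_def)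
  thus "grid j (star j - 1) \<le> Z" by (simp add: grid_def mesh_def field_simps)
  have "Z * 2 ^ j \<le> real_of_int (star j)" unfolding star_def by linarith
  thus "Z \<le> grid j (star j)" by (simp add: grid_def mesh_def field_simps)
qed

lemma star_Suc: "star (Suc j) = 2 * star j - 1 \<or> star (Suc j) = 2 * star j"
proof -
  have "\<lceil>2 * x\<rceil> = 2 * \<lceil>x\<rceil> - 1 \<or> \<lceil>2 * x\<rceil> = 2 * \<lceil>x\<rceil>" for x :: real by linarith
  from this[of "Z * 2 ^ j"] have c: "\<lceil>Z * 2 ^ Suc j\<rceil> = 2 * \<lceil>Z * 2 ^ j\<rceil> - 1 \<or> \<lceil>Z * 2 ^ Suc j\<rceil> = 2 * \<lceil>Z * 2 ^ j\<rceil>"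
    by (simp add: ac_simps)
  have "0 \<le> \<lceil>Z * 2 ^ j\<rceil>" using Z by (simp add: le_ceiling_iff less_le_trans[of "-1" 0])
  thus ?thesis using c unfolding star_def by (auto simp: max_def)
qed

text \<open>\<open>lbad\<close> is a wrong comparison, made by the localization sample, of two cells that lie on the
  same side of \<open>Z\<close>; \<open>sbad\<close> is a stop triggered near \<open>Z\<close> by the stopping sample.\<close>

definition lbad :: "(real \<Rightarrow> real) \<Rightarrow> nat \<Rightarrow> bool" where
  "lbad yl j \<longleftrightarrow> (\<exists>d\<in>{1, -1}. \<exists>e\<in>{2, 3, 4}. 1 \<le> star j + d * e \<and> star j + d * e \<le> 2 ^ j \<and>
     incr yl j (star j + d * e) \<le> incr yl j (star j + d))"

text \<open>The place that \<open>win\<close> takes when \<open>i_hat\<close> is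
  \<open>star j + d\<close>. Since \<open>d\<close> will have only three possible values, an early
  stop can be bounded through fixed windows, without reference to \<open>Y_l\<close>.\<close>

definition swin :: "bool \<Rightarrow> nat \<Rightarrow> int \<Rightarrow> int" where
  "swin r j d = (if r then star j + d + 4 else star j + d - 7)"

definition sbad :: "(real \<Rightarrow> real) \<Rightarrow> nat \<Rightarrow> bool" where
  "sbad ys j \<longleftrightarrow> (\<exists>d\<in>{-1, 0, 1}. \<exists>r\<in>{True, False}. in_range j (swin r j d) \<and>
     sgn_side r * sdiff ys j (swin r j d) \<le> 2 * sigma \<epsilon> j)"

text \<open>From an index within 1 of \<open>star\<close>, the children are within 4 of the next
  \<open>star\<close>. A child at distance 2, 3 or 4 can be selected only if it beats the cell at
  distance 1 on the same side, which is a candidate as well; this is exactly what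
  \<open>lbad\<close> describes.\<close>

lemma i_hat_near_star:
  assumes "\<And>j'. j' \<le> j \<Longrightarrow> \<not> lbad yl j'"
  shows "\<bar>i_hat yl j - star j\<bar> \<le> 1"
  using assms
proof (induction j)
  case 0
  have "star 0 = 1" using star_range[of 0] by simp
  thus ?case by simp
next
  case (Suc j)
  hence IH: "\<bar>i_hat yl j - star j\<bar> \<le> 1" by simp
  let ?i = "i_hat yl j" and ?k = "i_hat yl (Suc j)" and ?s = "star (Suc j)"
  have k: "2 * ?i - 2 \<le> ?k" "?k \<le> 2 * ?i + 1" using i_hat_Suc_mem[of yl j] by auto
  have kr: "1 \<le> ?k" "?k \<le> 2 ^ Suc j" using i_hat_range[of yl "Suc j"] by auto
  have nb: "incr yl (Suc j) (?s + d) < incr yl (Suc j) (?s + d * e)"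
    if "d \<in> {1, -1}" "e \<in> {2, 3, 4}" "1 \<le> ?s + d * e" "?s + d * e \<le> 2 ^ Suc j" for d e
    using Suc.prems[of "Suc j"] that unfolding lbad_def not_le[symmetric] by blast
  have mn: "incr yl (Suc j) ?k \<le> incr yl (Suc j) i" if "2 * ?i - 2 \<le> i" "i \<le> 2 * ?i + 1" for i
    using i_hat_Suc_min[of i yl j] that by simp
  show ?case
  proof (rule ccontr)
    assume "\<not> \<bar>?k - ?s\<bar> \<le> 1"
    then consider "?s + 2 \<le> ?k" | "?k \<le> ?s - 2" by linarith
    thus False
    proof cases
      case 1
      hence e: "?k - ?s \<in> {2, 3, 4}" using k IH star_Suc[of j] by auto
      have "incr yl (Suc j) (?s + 1) < incr yl (Suc j) ?k" using nb[of 1 "?k - ?s"] e kr by simp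
      moreover have "incr yl (Suc j) ?k \<le> incr yl (Suc j) (?s + 1)"
        using 1 k IH star_Suc[of j] by (intro mn) linarith+
      ultimately show False by simp
    next
      case 2
      hence e: "?s - ?k \<in> {2, 3, 4}" using k IH star_Suc[of j] by auto
      have "incr yl (Suc j) (?s - 1) < incr yl (Suc j) ?k" using nb[of "-1" "?s - ?k"] e kr by simp
      moreover have "incr yl (Suc j) ?k \<le> incr yl (Suc j) (?s - 1)"
        using 2 k IH star_Suc[of j] by (intro mn) linarith+
      ultimately show False by simp
    qed
  qed
qed

lemma no_stop_if_good:
  assumes "\<And>j'. j' \<le> j \<Longrightarrow> \<not> lbad yl j'" and "\<not> sbad ys j"
  shows "no_stop \<epsilon> yl ys j"
  unfolding no_stop_def
proof (rule T_stat_ge)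
  fix r assume r: "in_range j (win yl r j)"
  define d where "d = i_hat yl j - star j"
  have "\<bar>i_hat yl j - star j\<bar> \<le> 1" by (rule i_hat_near_star) (rule assms(1))
  hence d: "d \<in> {-1, 0, 1}" unfolding d_def by auto
  have w: "win yl r j = swin r j d" by (simp add: win_def swin_def d_def)
  have "r \<in> {True, False}" by simp
  with assms(2) r d show "2 * sigma \<epsilon> j < sgn_side r * sdiff ys j (win yl r j)"
    unfolding sbad_def w not_le[symmetric] by blast
qed

text \<open>The square of drift over noise equals \<open>r ^ 3 / 8\<close>, so the quotient itself
  is at least \<open>r\<close> as soon as \<open>r\<close> reaches 8.\<close>

lemma steep_numeric:
  assumes h: "0 < h" and m: "mesh j = r * h" and r: "8 \<le> r" "v \<le> r"
  shows "v * sigma \<epsilon> j \<le> mesh j * (mesh j * (sqrt 3 * \<epsilon> / sqrt h) / (2 * h))"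
proof -
  let ?D = "mesh j * (mesh j * (sqrt 3 * \<epsilon> / sqrt h) / (2 * h))"
  have D: "?D = r * r * h * (sqrt 3 * \<epsilon> / sqrt h) / 2" using h unfolding m by (simp add: field_simps)
  have sq1: "?D\<^sup>2 = (3 / 4) * r ^ 4 * h * \<epsilon>\<^sup>2"
    unfolding D using h by (simp add: power_mult_distrib power_divide field_simps eval_nat_numeral)
  have sq2: "(r * sigma \<epsilon> j)\<^sup>2 = 6 * r ^ 3 * h * \<epsilon>\<^sup>2"
    using h r unfolding sigma_def m by (simp add: power_mult_distrib eval_nat_numeral)
  have "6 * r ^ 3 * h * \<epsilon>\<^sup>2 \<le> (3 / 4) * r ^ 4 * h * \<epsilon>\<^sup>2"
  proof -
    have "6 * r ^ 3 \<le> (3 / 4) * r ^ 4" using r mult_right_mono[of 8 r "r ^ 3"] by (simp add: eval_nat_numeral)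
    thus ?thesis using h by (intro mult_right_mono) auto
  qed
  hence "(r * sigma \<epsilon> j)\<^sup>2 \<le> ?D\<^sup>2" unfolding sq1 sq2 .
  moreover have "0 \<le> ?D" unfolding D using h r eps by simp
  ultimately have "r * sigma \<epsilon> j \<le> ?D" by (rule power2_le_imp_le)
  moreover have "v * sigma \<epsilon> j \<le> r * sigma \<epsilon> j" using r sigma_pos[OF eps, of j] by (intro mult_right_mono) auto
  ultimately show ?thesis by linarith
qed

text \<open>On each side that stays in the unit interval, the rise of \<open>f\<close> over two fine
  cells exceeds the standard deviation of a fine cell mean. The distance is two cells because the
  first full cell on one side of \<open>Z\<close> ends within two cells of it.\<close>

definition steep :: "nat \<Rightarrow> bool" where
  "steep J \<longleftrightarrow> (Z + 2 * mesh J \<le> 1 \<longrightarrow> m0 + sqrt 3 * \<epsilon> / sqrt (mesh J) < f (Z + 2 * mesh J)) \<and>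
     (0 \<le> Z - 2 * mesh J \<longrightarrow> m0 + sqrt 3 * \<epsilon> / sqrt (mesh J) < f (Z - 2 * mesh J))"

text \<open>On a coarser level the comparison point lies farther from \<open>Z\<close>, where
  \<open>f\<close> is larger, and the cell means have less noise.\<close>

lemma steep_antimono:
  assumes "J \<le> J'" "steep J'" shows "steep J"
proof -
  have m: "mesh J' \<le> mesh J" "0 < mesh J'" using mesh_antimono[OF assms(1)] mesh_pos by auto
  have s: "sqrt 3 * \<epsilon> / sqrt (mesh J) \<le> sqrt 3 * \<epsilon> / sqrt (mesh J')"
    using m eps by (intro divide_left_mono) auto
  show ?thesis
    unfolding steep_def
  proof (intro conjI impI)
    assume "Z + 2 * mesh J \<le> 1"
    thus "m0 + sqrt 3 * \<epsilon> / sqrt (mesh J) < f (Z + 2 * mesh J)"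
      using assms(2) s m mono_right[of "Z + 2 * mesh J'" "Z + 2 * mesh J"] unfolding steep_def by auto
  next
    assume "0 \<le> Z - 2 * mesh J"
    thus "m0 + sqrt 3 * \<epsilon> / sqrt (mesh J) < f (Z - 2 * mesh J)"
      using assms(2) s m mono_left[of "Z - 2 * mesh J" "Z - 2 * mesh J'"] unfolding steep_def by auto
  qed
qed

lemma steep_cell_gap:
  assumes st: "steep J" and m: "mesh j = r * mesh J" and r: "8 \<le> r" "v \<le> r"
    and ab: "1 \<le> a" "a \<le> 2 ^ j" "1 \<le> b" "b \<le> 2 ^ j"
    and side: "(b < a \<and> star j < b) \<or> (a < b \<and> b < star j)"
  shows "v * sigma \<epsilon> j \<le> cell j a - cell j b"
proof -
  let ?h = "mesh J" and ?S = "sqrt 3 * \<epsilon> / sqrt (mesh J)"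
  have h: "0 < ?h" "2 * ?h \<le> mesh j" using mesh_pos r by (simp_all add: m)
  have S: "0 \<le> ?S" using eps mesh_pos[of J] by simp
  have "mesh j * (mesh j * ?S / (2 * ?h)) \<le> cell j a - cell j b"
    using side
  proof
    assume s: "b < a \<and> star j < b"
    have "grid j (star j) \<le> grid j (b - 1)" using s by (simp add: grid_le_iff)
    hence "Z \<le> grid j (b - 1)" using grid_star(2)[of j] by simp
    with s show ?thesis
      using st ab by (intro steep_right[OF h _ S]) (auto simp: steep_def)
  next
    assume s: "a < b \<and> b < star j"
    have "grid j b \<le> grid j (star j - 1)" using s by (simp add: grid_le_iff)
    hence "grid j b \<le> Z" using grid_star(1)[of j] by simp
    with s show ?thesis
      using st ab by (intro steep_left[OF h _ S]) (auto simp: steep_def)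
  qed
  with steep_numeric[OF h(1) m r] show ?thesis by linarith
qed

lemma incr_path:
  "1 \<le> i \<Longrightarrow> i \<le> 2 ^ j \<Longrightarrow> incr (y (npath k \<omega>)) j i = ereal (cell j i + \<epsilon> * (N k (grid j i) \<omega> - N k (grid j (i - 1)) \<omega>))"
proof -
  assume "1 \<le> i" "i \<le> 2 ^ j"
  moreover from this have "grid j i \<in> {0..1}" "grid j (i - 1) \<in> {0..1}"
    by (auto simp: grid_nonneg_iff grid_le_1_iff)
  ultimately show ?thesis by (simp add: incr_def path_at right_diff_distrib)
qed

text \<open>A union bound over six pairs \<open>(d, e)\<close>. Each comparison errs with
  probability at most \<open>Phi (- v)\<close>, weakened here to the form shared with the stopping
  tests.\<close>

lemma emeasure_lbad:
  assumes st: "steep J" and m: "mesh j = r * mesh J" and r: "8 \<le> r" "v \<le> r"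
  shows "{\<omega> \<in> space M. lbad (y (npath 0 \<omega>)) j} \<in> sets M"
    and "emeasure M {\<omega> \<in> space M. lbad (y (npath 0 \<omega>)) j} \<le> ennreal (6 * Phi (2 - v))"
proof -
  interpret G: gauss_process M "sqrt 3" "N 0" by (rule gauss_process_split_noise) simp
  define E where "E = (\<lambda>(d, e). {\<omega> \<in> space M. 1 \<le> star j + d * e \<and> star j + d * e \<le> 2 ^ j \<and>
     incr (y (npath 0 \<omega>)) j (star j + d * e) \<le> incr (y (npath 0 \<omega>)) j (star j + d)})"
  let ?I = "{1, -1} \<times> {2, 3, 4} :: (int \<times> int) set"
  have eq: "{\<omega> \<in> space M. lbad (y (npath 0 \<omega>)) j} = (\<Union>p\<in>?I. E p)" by (auto simp: lbad_def E_def)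
  note [measurable] = measurable_incr_comp[OF measurable_path[of 0, simplified]]
  have Em: "E p \<in> sets M" for p unfolding E_def by (cases p) simp
  show "{\<omega> \<in> space M. lbad (y (npath 0 \<omega>)) j} \<in> sets M" unfolding eq using Em by blast
  have Ep: "emeasure M (E p) \<le> ennreal (Phi (2 - v))" if p: "p \<in> ?I" for p
  proof -
    obtain d e where pe: "p = (d, e)" "d \<in> {1, -1}" "e \<in> {2, 3, 4}" using p by auto
    show ?thesis
    proof (cases "1 \<le> star j + d * e \<and> star j + d * e \<le> 2 ^ j")
      case True
      let ?a = "star j + d * e" and ?b = "star j + d"
      have ab: "1 \<le> ?a" "?a \<le> 2 ^ j" "1 \<le> ?b" "?b \<le> 2 ^ j" "?a \<noteq> ?b"
        and side: "(?b < ?a \<and> star j < ?b) \<or> (?a < ?b \<and> ?b < star j)"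
        using True pe star_range[of j] by auto
      have "E p = {\<omega> \<in> space M. (cell j ?a - cell j ?b) + \<epsilon> * ((N 0 (grid j ?a) \<omega> - N 0 (grid j (?a - 1)) \<omega>) - (N 0 (grid j ?b) \<omega> - N 0 (grid j (?b - 1)) \<omega>)) \<le> 0 * sigma \<epsilon> j}"
        using True unfolding E_def pe(1) split_conv
        by (simp only: incr_path[OF ab(1,2)] incr_path[OF ab(3,4)] ereal_less_eq) (auto simp: algebra_simps)
      hence "emeasure M (E p) \<le> ennreal (Phi (0 - v))"
        using G.prob_cell_diff_le[OF refl eps ab steep_cell_gap[OF st m r ab(1-4) side], of 0]
        by (simp add: W.emeasure_eq_measure ennreal_leI)
      also have "\<dots> \<le> ennreal (Phi (2 - v))" by (intro ennreal_leI Phi_mono) simp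
      finally show ?thesis .
    next
      case False
      hence "E p = {}" by (auto simp: E_def pe(1))
      thus ?thesis by simp
    qed
  qed
  have "emeasure M (\<Union>p\<in>?I. E p) \<le> (\<Sum>p\<in>?I. emeasure M (E p))"
    by (rule emeasure_subadditive_finite) (use Em in auto)
  also have "\<dots> \<le> (\<Sum>p\<in>?I. ennreal (Phi (2 - v)))" by (rule sum_mono[OF Ep])
  also have "\<dots> = ennreal (6 * Phi (2 - v))" by (simp add: ennreal_mult'' Phi_nonneg)
  finally show "emeasure M {\<omega> \<in> space M. lbad (y (npath 0 \<omega>)) j} \<le> ennreal (6 * Phi (2 - v))" unfolding eq .
qed

text \<open>Three offsets and two sides give six tests; the threshold of two standard deviations
  reduces \<open>v\<close> to \<open>v - 2\<close>. The windows are far enough out for both tested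
  cells to lie strictly on one side of \<open>star\<close> even when the offset is 1.\<close>

lemma emeasure_sbad:
  assumes st: "steep J" and m: "mesh j = r * mesh J" and r: "8 \<le> r" "v \<le> r"
  shows "{\<omega> \<in> space M. sbad (y (npath 1 \<omega>)) j} \<in> sets M"
    and "emeasure M {\<omega> \<in> space M. sbad (y (npath 1 \<omega>)) j} \<le> ennreal (6 * Phi (2 - v))"
proof -
  interpret G: gauss_process M "sqrt 3" "N 1" by (rule gauss_process_split_noise) simp
  define E where "E = (\<lambda>(d, s). {\<omega> \<in> space M. in_range j (swin s j d) \<and>
     sgn_side s * sdiff (y (npath 1 \<omega>)) j (swin s j d) \<le> 2 * sigma \<epsilon> j})"
  let ?I = "{-1, 0, 1} \<times> {True, False} :: (int \<times> bool) set"
  have eq: "{\<omega> \<in> space M. sbad (y (npath 1 \<omega>)) j} = (\<Union>p\<in>?I. E p)" unfolding sbad_def E_def by blast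
  have key: "E p \<in> sets M \<and> emeasure M (E p) \<le> ennreal (Phi (2 - v))" if p: "p \<in> ?I" for p
  proof -
    obtain d s where pe: "p = (d, s)" and d: "d \<in> {-1, 0, 1}" using p by blast
    show ?thesis
    proof (cases "in_range j (swin s j d)")
      case True
      let ?w = "swin s j d"
      \<comment> \<open>Oriented so that \<open>a\<close> is the cell farther from \<open>Z\<close>;
        its drift is then the larger one on either side.\<close>
      define a b where "a = (if s then ?w + 2 else ?w + 1)" and "b = (if s then ?w + 1 else ?w + 2)"
      have ab: "1 \<le> a" "a \<le> 2 ^ j" "1 \<le> b" "b \<le> 2 ^ j" "a \<noteq> b"
        using True by (auto simp: a_def b_def in_range_def)
      have side: "(b < a \<and> star j < b) \<or> (a < b \<and> b < star j)"
        using d by (auto simp: a_def b_def swin_def)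
      have g: "?w + 2 - 1 = ?w + 1" "?w + 1 - 1 = ?w" by auto
      have "sgn_side s * sdiff (y (npath 1 \<omega>)) j ?w = (cell j a - cell j b) + \<epsilon> * ((N 1 (grid j a) \<omega> - N 1 (grid j (a - 1)) \<omega>) - (N 1 (grid j b) \<omega> - N 1 (grid j (b - 1)) \<omega>))" for \<omega>
        using True sdiff_y[of j ?w 1 \<omega>] unfolding a_def b_def sgn_side_def
        by (cases s) (simp_all add: sdiff_def g[simplified] algebra_simps)
      hence Eq: "E p = {\<omega> \<in> space M. (cell j a - cell j b) + \<epsilon> * ((N 1 (grid j a) \<omega> - N 1 (grid j (a - 1)) \<omega>) - (N 1 (grid j b) \<omega> - N 1 (grid j (b - 1)) \<omega>)) \<le> 2 * sigma \<epsilon> j}"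
        using True unfolding E_def pe(1) split_conv by simp
      have [measurable]: "N 1 (grid j a) \<in> borel_measurable M" "N 1 (grid j (a - 1)) \<in> borel_measurable M"
        "N 1 (grid j b) \<in> borel_measurable M" "N 1 (grid j (b - 1)) \<in> borel_measurable M"
        by (intro G.measurable_grid; use ab in linarith)+
      have "E p \<in> sets M" unfolding Eq by measurable
      moreover have "emeasure M (E p) \<le> ennreal (Phi (2 - v))"
        unfolding Eq W.emeasure_eq_measure
        by (intro ennreal_leI G.prob_cell_diff_le[OF refl eps ab steep_cell_gap[OF st m r ab(1-4) side]])
      ultimately show ?thesis by simp
    next
      case False
      hence "E p = {}" by (auto simp: E_def pe(1))
      thus ?thesis by simp
    qed
  qed
  show "{\<omega> \<in> space M. sbad (y (npath 1 \<omega>)) j} \<in> sets M" unfolding eq using key by blast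
  have "emeasure M (\<Union>p\<in>?I. E p) \<le> (\<Sum>p\<in>?I. emeasure M (E p))"
    by (rule emeasure_subadditive_finite) (use key in auto)
  also have "\<dots> \<le> (\<Sum>p\<in>?I. ennreal (Phi (2 - v)))" by (rule sum_mono) (use key in simp)
  also have "\<dots> = ennreal (6 * Phi (2 - v))" by (simp add: ennreal_mult'' Phi_nonneg)
  finally show "emeasure M {\<omega> \<in> space M. sbad (y (npath 1 \<omega>)) j} \<le> ennreal (6 * Phi (2 - v))" unfolding eq .
qed

text \<open>The noise of a cell mean grows without bound as cells shrink, whereas \<open>f\<close>
  is bounded; and once cells are shorter than \<open>1 / 4\<close>, at least one of the two
  comparison points lies in the unit interval.\<close>

lemma ex_not_steep: "\<exists>j. \<not> steep (j + n)"
proof (rule ccontr)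
  assume "\<not> ?thesis"
  hence st: "steep (j + n)" for j by simp
  obtain k where k: "(fmax - m0) / (sqrt 3 * \<epsilon>) < 2 ^ k" using real_arch_pow[of 2] by auto
  let ?J = "(2 * k + 2) + n"
  have m: "mesh ?J \<le> 1 / 2 ^ (2 * k + 2)" using mesh_antimono[of "2 * k + 2" ?J] by (simp add: mesh_def)
  have h2: "4 * mesh ?J \<le> 1" using mesh_antimono[of 2 ?J] by (simp add: mesh_def)
  have "(1::real) / 2 ^ (2 * k + 2) = (1 / 2 ^ k)\<^sup>2 / 4" by (simp add: power_add power_divide power_even_eq)
  hence h: "0 < mesh ?J" "4 * mesh ?J \<le> 1" "mesh ?J \<le> (1 / 2 ^ k)\<^sup>2"
    using m h2 mesh_pos[of ?J] zero_le_power2[of "1 / 2 ^ k :: real"] by linarith+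
  have "sqrt (mesh ?J) \<le> 1 / 2 ^ k" using h(3) by (metis real_sqrt_le_mono real_sqrt_unique zero_le_divide_1_iff zero_le_numeral zero_le_power)
  hence "2 ^ k \<le> 1 / sqrt (mesh ?J)" using h(1) by (simp add: field_simps)
  hence "sqrt 3 * \<epsilon> * 2 ^ k \<le> sqrt 3 * \<epsilon> * (1 / sqrt (mesh ?J))" using eps by (intro mult_left_mono) auto
  moreover have "fmax - m0 < sqrt 3 * \<epsilon> * 2 ^ k" using k eps by (simp add: divide_less_eq ac_simps)
  ultimately have S: "fmax - m0 < sqrt 3 * \<epsilon> / sqrt (mesh ?J)" by simp
  have "Z + 2 * mesh ?J \<le> 1 \<or> 0 \<le> Z - 2 * mesh ?J" using h(2) by linarith
  thus False
    using st[of "2 * k + 2"] S h(1) Z f_le_fmax[of "Z + 2 * mesh ?J"] f_le_fmax[of "Z - 2 * mesh ?J"]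
    unfolding steep_def by auto
qed

lemma pred_lbad: "g \<in> Q \<rightarrow>\<^sub>M path_space \<Longrightarrow> Measurable.pred Q (\<lambda>\<omega>. lbad (y (g \<omega>)) j)"
proof -
  assume g: "g \<in> Q \<rightarrow>\<^sub>M path_space"
  note [measurable] = measurable_incr_comp[OF g]
  show ?thesis unfolding lbad_def by (intro pred_intros_finite(4) finite.intros) measurable
qed

lemma pred_sbad: "g \<in> Q \<rightarrow>\<^sub>M path_space \<Longrightarrow> Measurable.pred Q (\<lambda>\<omega>. sbad (y (g \<omega>)) j)"
proof -
  assume g: "g \<in> Q \<rightarrow>\<^sub>M path_space"
  have sm: "Measurable.pred Q (\<lambda>\<omega>. in_range j w \<and> sgn_side r * sdiff (y (g \<omega>)) j w \<le> t)" for w r t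
  proof (cases "in_range j w")
    case True
    have "(\<lambda>x. x (grid j i)) \<in> borel_measurable path_space" if "0 \<le> i" "i \<le> 2 ^ j" for i
      unfolding path_space_def using that by (intro measurable_component_singleton grid_in_unit)
    from this[of w] this[of "w + 1"] this[of "w + 2"] True
    have [measurable]: "(\<lambda>\<omega>. g \<omega> (grid j w)) \<in> borel_measurable Q" "(\<lambda>\<omega>. g \<omega> (grid j (w + 1))) \<in> borel_measurable Q"
      "(\<lambda>\<omega>. g \<omega> (grid j (w + 2))) \<in> borel_measurable Q"
      by (auto simp: in_range_def intro: measurable_compose[OF g])
    show ?thesis using True unfolding sdiff_def by simp
  qed simp
  show ?thesis unfolding sbad_def by (intro pred_intros_finite(4) finite.intros sm)
qed

text \<open>With \<open>n = K_tilde\<close>, the first level at which stopping is harmless: final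
  cells, \<open>n\<close> levels finer, are no longer steep.\<close>

definition "j_steep n = (LEAST j. \<not> steep (j + n))"

lemma not_steep_j_steep: "\<not> steep (j_steep n + n)"
  unfolding j_steep_def by (rule LeastI_ex[OF ex_not_steep])

lemma steep_below: "j < j_steep n \<Longrightarrow> steep (j + n)"
  unfolding j_steep_def using not_less_Least by blast

lemma geometric_half: "(\<Sum>k<n. (1 / 2 :: real) ^ (k + 3)) \<le> 1 / 4"
proof -
  have "(\<Sum>k<n. (1 / 2 :: real) ^ (k + 3)) = 1 / 4 - (1 / 2) ^ (n + 2)"
    by (induction n) (simp_all add: power_add eval_nat_numeral)
  thus ?thesis by simp
qed

text \<open>The finest level known to be steep is \<open>K_tilde + k\<close> levels below level
  \<open>j\<close>, where \<open>k\<close> counts the levels from \<open>j\<close> to the last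
  dangerous one. Hence \<open>r\<close> is \<open>2 ^ (K_tilde \<beta> + k)\<close>, which allows
  \<open>v = 5 + z + k\<close>. The twelve possible errors together have probability at most
  \<open>12 * Phi (- (z + k + 3))\<close>; as \<open>Phi (- z) = \<beta> / 3\<close> this is at most
  \<open>4 * \<beta> * (1 / 2) ^ (k + 3)\<close>, and the sum over \<open>k\<close> is at most
  \<beta>.\<close>

lemma emeasure_early:
  assumes \<beta>: "0 < \<beta>" "\<beta> < 1"
  defines "A \<equiv> {p \<in> space (path_space \<Otimes>\<^sub>M path_space).
     \<exists>j\<in>{..<j_steep (K_tilde \<beta>)}. lbad (y (fst p)) j \<or> sbad (y (snd p)) j}"
  shows "A \<in> sets (path_space \<Otimes>\<^sub>M path_space)"
    and "emeasure M {\<omega> \<in> space M. (npath 0 \<omega>, npath 1 \<omega>) \<in> A} \<le> ennreal \<beta>"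
proof -
  note [measurable] = pred_lbad[OF measurable_fst] pred_sbad[OF measurable_snd]
  have m: "npath 0 \<in> M \<rightarrow>\<^sub>M path_space" "npath 1 \<in> M \<rightarrow>\<^sub>M path_space" by (rule measurable_path, simp)+
  show Am: "A \<in> sets (path_space \<Otimes>\<^sub>M path_space)" unfolding A_def by measurable
  define js where "js = j_steep (K_tilde \<beta>)"
  define z where "z = z_quantile (\<beta> / 3)"
  have z: "0 < z" "Phi (- z) = \<beta> / 3"
    using z_quantile_pos[of "\<beta> / 3"] Phi_z_quantile[of "\<beta> / 3"] \<beta> by (simp_all add: z_def Phi_uminus)
  let ?E = "\<lambda>j. {\<omega> \<in> space M. lbad (y (npath 0 \<omega>)) j} \<union> {\<omega> \<in> space M. sbad (y (npath 1 \<omega>)) j}"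
  have Em: "?E j \<in> sets M" for j
    by (intro sets.Un predE pred_lbad pred_sbad m)
  have Ej: "emeasure M (?E j) \<le> ennreal (4 * \<beta> * (1 / 2) ^ (js - Suc j + 3))" if j: "j < js" for j
  proof -
    define k where "k = js - Suc j"
    define J where "J = (js - 1) + K_tilde \<beta>"
    define r where "r = (2::real) ^ K_tilde \<beta> * 2 ^ k"
    have st: "steep J" unfolding J_def by (rule steep_below) (use j in \<open>simp add: js_def\<close>)
    have "J = j + (K_tilde \<beta> + k)" using j by (simp add: J_def k_def)
    hence mj: "mesh j = r * mesh J" by (simp add: r_def mesh_add power_add)
    have q: "16 \<le> (2::real) ^ K_tilde \<beta>" "4 * (2 + z) \<le> 2 ^ K_tilde \<beta>"
      using K_tilde_ge[OF \<beta>] by (simp_all add: z_def)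
    have "1 + real k \<le> 2 ^ k"
      using of_nat_less_two_power[of k] by (metis Suc_leI of_nat_Suc of_nat_le_iff of_nat_numeral of_nat_power less_exp)
    hence "2 ^ K_tilde \<beta> * (1 + real k) \<le> r" unfolding r_def by (intro mult_left_mono) auto
    moreover have "2 ^ K_tilde \<beta> + 16 * real k \<le> 2 ^ K_tilde \<beta> * (1 + real k)"
      using mult_right_mono[OF q(1), of "real k"] by (simp add: algebra_simps)
    ultimately have rr: "2 ^ K_tilde \<beta> + 16 * real k \<le> r" by (rule order_trans[rotated])
    have "0 \<le> real k" by simp
    hence "5 + z + real k \<le> 2 ^ K_tilde \<beta> + 16 * real k" using q(2) z(1) by argo
    with rr have r2: "5 + z + real k \<le> r" by (rule order_trans[rotated])
    have "8 \<le> 2 ^ K_tilde \<beta> + 16 * real k" using q(1) \<open>0 \<le> real k\<close> by argo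
    with rr have r1: "8 \<le> r" by (rule order_trans[rotated])
    note r = r1 r2
    have Phi: "Phi (2 - (5 + z + real k)) \<le> \<beta> / 3 * (1 / 2) ^ (k + 3)"
    proof -
      have "Phi (2 - (5 + z + real k)) = Phi (- (z + (real k + 3)))" by (simp add: algebra_simps)
      also have "\<dots> \<le> exp (- ((real k + 3)\<^sup>2 / 2)) * Phi (- z)" by (rule Phi_tail_shift) (use z in auto)
      also have "\<dots> \<le> (1 / 2) ^ (k + 3) * Phi (- z)" by (rule mult_right_mono[OF exp_square_le Phi_nonneg])
      finally show ?thesis by (simp add: z(2) ac_simps)
    qed
    have "emeasure M (?E j) \<le> emeasure M {\<omega> \<in> space M. lbad (y (npath 0 \<omega>)) j} + emeasure M {\<omega> \<in> space M. sbad (y (npath 1 \<omega>)) j}"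
      by (intro emeasure_subadditive predE pred_lbad pred_sbad m)
    also have "\<dots> \<le> ennreal (6 * Phi (2 - (5 + z + real k))) + ennreal (6 * Phi (2 - (5 + z + real k)))"
      by (intro add_mono emeasure_lbad(2)[OF st mj r] emeasure_sbad(2)[OF st mj r])
    also have "\<dots> = ennreal (12 * Phi (2 - (5 + z + real k)))"
      by (simp add: ennreal_plus[symmetric] Phi_nonneg del: ennreal_plus)
    also have "\<dots> \<le> ennreal (4 * \<beta> * (1 / 2) ^ (k + 3))"
      by (rule ennreal_leI) (use Phi in simp)
    finally show ?thesis by (simp add: k_def)
  qed
  have "emeasure M {\<omega> \<in> space M. (npath 0 \<omega>, npath 1 \<omega>) \<in> A} \<le> emeasure M (\<Union>j\<in>{..<js}. ?E j)"
    using Em by (intro emeasure_mono sets.finite_UN) (auto simp: A_def js_def)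
  also have "\<dots> \<le> (\<Sum>j\<in>{..<js}. emeasure M (?E j))"
    using Em by (intro emeasure_subadditive_finite) auto
  also have "\<dots> \<le> (\<Sum>j\<in>{..<js}. ennreal (4 * \<beta> * (1 / 2) ^ (js - Suc j + 3)))"
    by (rule sum_mono) (use Ej in simp)
  also have "\<dots> = ennreal (\<Sum>j<js. 4 * \<beta> * (1 / 2) ^ (js - Suc j + 3))"
    using \<beta> by (intro sum_ennreal) auto
  also have "(\<Sum>j<js. 4 * \<beta> * (1 / 2) ^ (js - Suc j + 3)) = 4 * \<beta> * (\<Sum>j<js. (1 / 2) ^ (j + 3))"
    using sum.nat_diff_reindex[of "\<lambda>k. (1 / 2 :: real) ^ (k + 3)" js] by (simp add: sum_distrib_left[symmetric])
  also have "ennreal \<dots> \<le> ennreal \<beta>"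
    using mult_left_mono[OF geometric_half[of js], of "4 * \<beta>"] \<beta> by (intro ennreal_leI) simp
  finally show "emeasure M {\<omega> \<in> space M. (npath 0 \<omega>, npath 1 \<omega>) \<in> A} \<le> ennreal \<beta>" .
qed

text \<open>Indices off the grid carry infinity, so the minimum over \<open>C\<close> is a minimum
  over its part \<open>R\<close> inside the grid; a nonempty \<open>R\<close> makes it finite and
  hence safe under \<open>real_of_ereal\<close>.\<close>

lemma ci_center_attained:
  assumes "R = C \<inter> {1..2 ^ J}" "R \<noteq> {}" "finite C"
  shows "\<exists>k\<in>R. mesh J * ci_center ye J C = ye (grid J k) - ye (grid J (k - 1)) \<and>
    (\<forall>l\<in>R. ye (grid J k) - ye (grid J (k - 1)) \<le> ye (grid J l) - ye (grid J (l - 1)))"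
proof -
  have ne: "C \<noteq> {}" using assms by auto
  have "Min (incr ye J ` C) \<in> incr ye J ` C" using assms ne by (intro Min_in) auto
  then obtain k where k: "k \<in> C" "Min (incr ye J ` C) = incr ye J k" by auto
  have le: "incr ye J k \<le> incr ye J l" if "l \<in> C" for l
    unfolding k(2)[symmetric] using assms that by (intro Min_le) auto
  obtain l0 where l0: "l0 \<in> R" using assms(2) by blast
  have "incr ye J k < \<infinity>" using le[of l0] l0 assms(1) by (auto simp: incr_def)
  hence kR: "k \<in> {1..2 ^ J}" by (auto simp: incr_def split: if_splits)
  show ?thesis
  proof (intro bexI[of _ k] conjI ballI)
    show "k \<in> R" using k kR assms(1) by simp
    show "mesh J * ci_center ye J C = ye (grid J k) - ye (grid J (k - 1))"
      using kR mesh_pos[of J] unfolding ci_center_def k(2) by (simp add: incr_def)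
    fix l assume "l \<in> R"
    thus "ye (grid J k) - ye (grid J (k - 1)) \<le> ye (grid J l) - ye (grid J (l - 1))"
      using le[of l] kR assms(1) by (simp add: incr_def)
  qed
qed

section \<open>The two endpoint errors of the estimation sample\<close>

abbreviation "sc J \<equiv> sqrt 3 * \<epsilon> / sqrt (mesh J)"

lemma mesh_scale: "mesh J * sc J = \<epsilon> * (sqrt 3 * sqrt (mesh J))"
proof -
  have "mesh J = sqrt (mesh J) * sqrt (mesh J)" using mesh_pos[of J] by simp
  thus ?thesis using mesh_pos[of J] by (simp add: divide_simps)
qed

lemma y_path_cell:
  assumes "1 \<le> k" "k \<le> 2 ^ J"
  shows "y (npath n \<omega>) (grid J k) - y (npath n \<omega>) (grid J (k - 1))
    = cell J k + \<epsilon> * (N n (grid J k) \<omega> - N n (grid J (k - 1)) \<omega>)"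
  using incr_path[OF assms, of n \<omega>] assms by (simp add: incr_def)

text \<open>The minimum is at most the value at the single cell \<open>k0\<close>, whose mean is at
  most one standard deviation above \<open>m0\<close>. The lower endpoint subtracts that amount, so
  it overshoots only if one Gaussian exceeds its quantile.\<close>

lemma cover_lower:
  assumes \<alpha>: "0 < \<alpha>" "\<alpha> < 1"
    and k0: "k0 \<in> cells j i J" "1 \<le> k0" "k0 \<le> 2 ^ J" "cell J k0 \<le> mesh J * (m0 + sc J)"
  shows "emeasure M {\<omega> \<in> space M. m0 < ci_lo \<alpha> \<epsilon> j i J (y (npath 2 \<omega>))} \<le> ennreal (\<alpha> / 4)"
proof -
  interpret G: gauss_process M "sqrt 3" "N 2" by (rule gauss_process_split_noise) simp
  let ?n = "\<lambda>\<omega>. N 2 (grid J k0) \<omega> - N 2 (grid J (k0 - 1)) \<omega>"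
  let ?s = "sqrt 3 * sqrt (mesh J)" and ?z = "z_quantile (\<alpha> / 4)"
  have s: "0 < ?s" using mesh_pos[of J] by simp
  have nm[measurable]: "?n \<in> borel_measurable M" using k0 by (intro borel_measurable_diff G.measurable_grid) auto
  have "{\<omega> \<in> space M. m0 < ci_lo \<alpha> \<epsilon> j i J (y (npath 2 \<omega>))} \<subseteq> {\<omega> \<in> space M. ?s * ?z < ?n \<omega>}"
  proof safe
    fix \<omega> assume lo: "m0 < ci_lo \<alpha> \<epsilon> j i J (y (npath 2 \<omega>))"
    have R: "k0 \<in> cells j i J \<inter> {1..2 ^ J}" using k0 by simp
    hence ne: "cells j i J \<inter> {1..2 ^ J} \<noteq> {}" by blast
    obtain k where k: "mesh J * ci_center (y (npath 2 \<omega>)) J (cells j i J) = y (npath 2 \<omega>) (grid J k) - y (npath 2 \<omega>) (grid J (k - 1))"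
       "\<forall>l\<in>cells j i J \<inter> {1..2 ^ J}. y (npath 2 \<omega>) (grid J k) - y (npath 2 \<omega>) (grid J (k - 1)) \<le> y (npath 2 \<omega>) (grid J l) - y (npath 2 \<omega>) (grid J (l - 1))"
      using ci_center_attained[OF refl ne finite_cells, of "y (npath 2 \<omega>)"] by (elim bexE conjE)
    have "mesh J * ci_center (y (npath 2 \<omega>)) J (cells j i J) \<le> cell J k0 + \<epsilon> * ?n \<omega>"
      unfolding k(1) y_path_cell[OF k0(2,3), symmetric] by (rule bspec[OF k(2) R])
    moreover have "mesh J * m0 < mesh J * ci_lo \<alpha> \<epsilon> j i J (y (npath 2 \<omega>))"
      using lo mesh_pos[of J] by simp
    moreover have "mesh J * ci_lo \<alpha> \<epsilon> j i J (y (npath 2 \<omega>)) = mesh J * ci_center (y (npath 2 \<omega>)) J (cells j i J) - ?z * (mesh J * sc J) - mesh J * sc J"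
      unfolding ci_lo_def by (simp add: right_diff_distrib ac_simps)
    moreover have "mesh J * (m0 + sc J) = mesh J * m0 + mesh J * sc J" by (simp add: distrib_left)
    ultimately have "?z * (mesh J * sc J) < \<epsilon> * ?n \<omega>" using k0(4) by linarith
    hence "\<epsilon> * (?s * ?z) < \<epsilon> * ?n \<omega>" unfolding mesh_scale by (simp only: ac_simps)
    thus "?s * ?z < ?n \<omega>" using eps by (simp only: mult_less_cancel_left_pos)
  qed
  hence "emeasure M {\<omega> \<in> space M. m0 < ci_lo \<alpha> \<epsilon> j i J (y (npath 2 \<omega>))} \<le> emeasure M {\<omega> \<in> space M. ?s * ?z < ?n \<omega>}"
    by (rule emeasure_mono) measurable
  also have "\<dots> = ennreal (measure (distr M borel ?n) {x. ?s * ?z < x})"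
    unfolding W.emeasure_eq_measure by (subst measure_distr) (simp_all add: vimage_def Int_def conj_commute)
  also have "\<dots> = ennreal (\<alpha> / 4)"
    unfolding G.distr_cell[OF k0(2,3)] measure_gauss_greater[OF s]
    using Phi_z_quantile[of "\<alpha> / 4"] \<alpha> by (simp add: Phi_uminus)
  finally show ?thesis .
qed

text \<open>Every cell mean of \<open>f\<close> is at least \<open>m0\<close>, so the upper endpoint
  falls below \<open>m0\<close> only if the smallest noise is below minus the quantile of a maximum.
  The search region has \<open>9 * 2 ^ (J - j)\<close> indices; those off the grid only reduce the
  number of noises.\<close>

lemma cover_upper:
  assumes \<alpha>: "0 < \<alpha>" "\<alpha> < 1" and j: "j \<le> J" and i: "1 \<le> i" "i \<le> 2 ^ j"
  shows "emeasure M {\<omega> \<in> space M. ci_hi \<alpha> \<epsilon> j i J (y (npath 2 \<omega>)) < m0} \<le> ennreal (\<alpha> / 4)"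
proof -
  interpret G: gauss_process M "sqrt 3" "N 2" by (rule gauss_process_split_noise) simp
  let ?s = "sqrt 3 * sqrt (mesh J)"
  define n where "n = (9::nat) * 2 ^ (J - j)"
  define q where "q = S_quantile n (\<alpha> / 4)"
  have s: "0 < ?s" using mesh_pos[of J] by simp
  define R where "R = cells j i J \<inter> {1..2 ^ J}"
  define I where "I = (\<lambda>k. nat (k - 1)) ` R"
  define D where "D i \<omega> = N 2 (grid J (int i + 1)) \<omega> - N 2 (grid J (int i)) \<omega>" for i \<omega>
  define B where "B = {x. ?s * - q \<le> x}"
  have finR: "finite R" "finite I" using finite_cells unfolding R_def I_def by auto
  have "card (cells j i J) = n" unfolding cells_eq[OF j] n_def by (simp add: algebra_simps nat_mult_distrib nat_power_eq)
  hence "card R \<le> n" using card_mono[OF finite_cells, of R j i J] by (auto simp: R_def)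
  hence cI: "card I \<le> n" unfolding I_def using card_image_le[OF finR(1), of "\<lambda>k. nat (k - 1)"] by linarith
  have "i * 2 ^ (J - j) \<in> R"
  proof -
    have "i * 2 ^ (J - j) \<le> 2 ^ j * 2 ^ (J - j)" using i by (intro mult_right_mono) auto
    also have "\<dots> = (2::int) ^ J" using j by (simp add: power_add[symmetric])
    finally have "i * 2 ^ (J - j) \<le> 2 ^ J" .
    moreover have "1 * 1 \<le> i * 2 ^ (J - j)" using i by (intro mult_mono) auto
    moreover have "(i - 5) * 2 ^ (J - j) < i * 2 ^ (J - j)" "i * 2 ^ (J - j) \<le> (i + 4) * 2 ^ (J - j)" by simp_all
    ultimately show ?thesis unfolding R_def cells_eq[OF j] by simp
  qed
  hence neR: "R \<noteq> {}" "I \<noteq> {}" by (auto simp: I_def)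
  have sub: "I \<subseteq> {..<2 ^ J}" by (auto simp: I_def R_def nat_less_iff)
  have Dm: "D i \<in> borel_measurable M" if "i \<in> I" for i
    using G.grid_indep[of J] sub that unfolding W.indep_vars_def2 D_def by auto
  have Bm: "B \<in> sets borel" unfolding B_def by measurable
  have pD: "W.prob (D i -` B \<inter> space M) = Phi q" if "i \<in> I" for i
  proof -
    have "i < 2 ^ J" using sub that by auto
    hence "int i < int (2 ^ J)" by (simp only: of_nat_less_iff)
    moreover have "int (2 ^ J) = 2 ^ J" by simp
    ultimately have i: "1 \<le> int i + 1" "int i + 1 \<le> 2 ^ J" by linarith+
    have "distr M borel (D i) = gauss ?s" using G.distr_cell[OF i] by (simp add: D_def[abs_def])
    hence "measure (gauss ?s) B = W.prob (D i -` B \<inter> space M)" using measure_distr[OF Dm[OF that] Bm] by simp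
    thus ?thesis using measure_gauss_ge[OF s, of "- q"] by (simp add: B_def)
  qed
  have good: "1 - \<alpha> / 4 \<le> W.prob (\<Inter>i\<in>I. D i -` B \<inter> space M)"
  proof -
    have "W.prob (\<Inter>i\<in>I. D i -` B \<inter> space M) = (\<Prod>i\<in>I. W.prob (D i -` B \<inter> space M))"
      by (rule W.indep_varsD[OF G.grid_indep[of J, folded D_def] neR(2) finR(2) sub]) (rule Bm)
    also have "\<dots> = Phi q ^ card I" by (simp add: pD)
    also have "\<dots> \<ge> Phi q ^ n" using cI Phi_nonneg Phi_le_1 by (intro power_decreasing) auto
    moreover have "1 - \<alpha> / 4 \<le> Phi q ^ n" unfolding q_def by (rule Phi_S_quantile) (use \<alpha> in \<open>auto simp: n_def\<close>)
    ultimately show ?thesis by linarith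
  qed
  have Gm: "(\<Inter>i\<in>I. D i -` B \<inter> space M) \<in> sets M"
    using finR(2) neR(2) by (intro sets.finite_INT measurable_sets[OF Dm Bm]) auto
  have "{\<omega> \<in> space M. ci_hi \<alpha> \<epsilon> j i J (y (npath 2 \<omega>)) < m0} \<subseteq> space M - (\<Inter>i\<in>I. D i -` B \<inter> space M)"
  proof
    fix \<omega> assume w: "\<omega> \<in> {\<omega> \<in> space M. ci_hi \<alpha> \<epsilon> j i J (y (npath 2 \<omega>)) < m0}"
    hence hi: "ci_hi \<alpha> \<epsilon> j i J (y (npath 2 \<omega>)) < m0" and sp: "\<omega> \<in> space M" by auto
    obtain k where k: "k \<in> R" "mesh J * ci_center (y (npath 2 \<omega>)) J (cells j i J) = y (npath 2 \<omega>) (grid J k) - y (npath 2 \<omega>) (grid J (k - 1))"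
      using ci_center_attained[OF R_def neR(1) finite_cells, of "y (npath 2 \<omega>)"] by (elim bexE conjE)
    have kr: "1 \<le> k" "k \<le> 2 ^ J" using k(1) by (auto simp: R_def)
    let ?n = "N 2 (grid J k) \<omega> - N 2 (grid J (k - 1)) \<omega>"
    have "mesh J * m0 + \<epsilon> * ?n \<le> mesh J * ci_center (y (npath 2 \<omega>)) J (cells j i J)"
      unfolding k(2) y_path_cell[OF kr] using cell_bounds(2)[OF kr] by simp
    moreover have "mesh J * ci_hi \<alpha> \<epsilon> j i J (y (npath 2 \<omega>)) = mesh J * ci_center (y (npath 2 \<omega>)) J (cells j i J) + q * (mesh J * sc J)"
      unfolding ci_hi_def q_def n_def by (simp add: distrib_left ac_simps)
    moreover have "mesh J * ci_hi \<alpha> \<epsilon> j i J (y (npath 2 \<omega>)) < mesh J * m0" using hi mesh_pos[of J] by simp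
    ultimately have "\<epsilon> * ?n < - (q * (mesh J * sc J))" by linarith
    hence "\<epsilon> * ?n < \<epsilon> * (?s * - q)" unfolding mesh_scale by (simp add: ac_simps)
    hence "?n < ?s * - q" using eps by (simp only: mult_less_cancel_left_pos)
    moreover have "D (nat (k - 1)) \<omega> = ?n" using kr by (simp add: D_def)
    ultimately have "D (nat (k - 1)) \<omega> \<notin> B" by (simp add: B_def)
    moreover have "nat (k - 1) \<in> I" using k(1) by (auto simp: I_def)
    ultimately show "\<omega> \<in> space M - (\<Inter>i\<in>I. D i -` B \<inter> space M)" using sp by blast
  qed
  hence "emeasure M {\<omega> \<in> space M. ci_hi \<alpha> \<epsilon> j i J (y (npath 2 \<omega>)) < m0} \<le> emeasure M (space M - (\<Inter>i\<in>I. D i -` B \<inter> space M))"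
    by (rule emeasure_mono) (use Gm in auto)
  also have "\<dots> = ennreal (1 - W.prob (\<Inter>i\<in>I. D i -` B \<inter> space M))"
    unfolding W.emeasure_eq_measure W.prob_compl[OF Gm] ..
  also have "\<dots> \<le> ennreal (\<alpha> / 4)" using good by (intro ennreal_leI) simp
  finally show ?thesis .
qed

text \<open>The cell adjacent to \<open>Z\<close> on the flat side; it stays inside the search region because
  \<open>loc_hull\<close> leaves a margin of half a coarse cell.\<close>

lemma ex_low_cell:
  assumes js: "j_steep n \<le> jh" and n: "4 \<le> n" and j0: "j0 \<le> jh" and Zh: "Z \<in> loc_hull yl j0"
  shows "\<exists>k0\<in>cells j0 (i_hat yl j0) (jh + n). 1 \<le> k0 \<and> k0 \<le> 2 ^ (jh + n) \<and>
     cell (jh + n) k0 \<le> mesh (jh + n) * (m0 + sc (jh + n))"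
proof -
  let ?J = "jh + n" and ?i = "i_hat yl j0"
  let ?h = "mesh ?J" and ?g = "mesh (Suc j0)"
  have h: "0 < ?h" by (rule mesh_pos)
  \<comment> \<open>The search region exceeds the hull by \<open>?g\<close> at either end. Four fine
    cells fit into this margin, and the chosen cell lies within two fine cells of
    \<open>Z\<close>.\<close>
  have "?h \<le> mesh (Suc j0 + 2)" using j0 n by (intro mesh_antimono) simp
  moreover have "mesh (Suc j0 + 2) = ?g / 4" unfolding mesh_add by simp
  ultimately have hg: "4 * ?h \<le> ?g" by linarith
  have Zr: "of_int (2 * ?i - 9) * ?g \<le> Z" "Z \<le> of_int (2 * ?i + 7) * ?g"
    using Zh by (auto simp: loc_hull_def grid_def)
  have cl: "k0 \<in> cells j0 ?i ?J" if "of_int (2 * ?i - 10) * ?g < of_int k0 * ?h" "of_int k0 * ?h \<le> of_int (2 * ?i + 8) * ?g" for k0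
  proof -
    have p: "0 < (2::real) ^ ?J" "?h * 2 ^ ?J = 1" by (simp_all add: mesh_def)
    have g: "grid j0 (?i - 5) = of_int (2 * ?i - 10) * ?g" "grid j0 (?i + 4) = of_int (2 * ?i + 8) * ?g"
      unfolding grid_Suc[of j0] by (simp_all add: grid_def)
    have k: "of_int k0 = of_int k0 * ?h * 2 ^ ?J" using p(2) by (simp add: mult.assoc)
    show ?thesis unfolding cells_def mem_Collect_eq g
      by (subst (1 2) k) (use that p(1) in \<open>auto intro: mult_strict_right_mono mult_right_mono\<close>)
  qed
  have "\<not> steep ?J" using steep_antimono[of "j_steep n + n" ?J] not_steep_j_steep js by auto
  then consider (r) "Z + 2 * ?h \<le> 1" "f (Z + 2 * ?h) \<le> m0 + sc ?J" | (l) "0 \<le> Z - 2 * ?h" "f (Z - 2 * ?h) \<le> m0 + sc ?J"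
    unfolding steep_def by (auto simp: not_less)
  thus ?thesis
  proof cases
    case r
    \<comment> \<open>Rounding up puts the left end of cell \<open>c + 1\<close> into
      \<open>[Z, Z + h)\<close>, so the cell stays in \<open>[Z, Z + 2 h]\<close>, where
      \<open>f\<close> is low.\<close>
    define c where "c = \<lceil>Z / ?h\<rceil>"
    have c: "Z \<le> of_int c * ?h" "of_int c * ?h < Z + ?h"
    proof -
      have "Z / ?h \<le> of_int c" "of_int c < Z / ?h + 1" unfolding c_def by linarith+
      thus "Z \<le> of_int c * ?h" "of_int c * ?h < Z + ?h" using h by (simp_all add: field_simps)
    qed
    have gc: "grid ?J (c + 1) = of_int c * ?h + ?h" "grid ?J (c + 1 - 1) = of_int c * ?h"
      by (simp_all add: grid_def algebra_simps)
    have "0 \<le> of_int c * ?h" using c Z by linarith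
    hence "0 \<le> grid ?J c" by (simp add: grid_def)
    hence c0: "0 \<le> c" by (simp add: grid_nonneg_iff)
    have "grid ?J (c + 1) \<le> 1" unfolding gc using c r by linarith
    hence c1: "c + 1 \<le> 2 ^ ?J" by (simp add: grid_le_1_iff)
    have "c + 1 \<in> cells j0 ?i ?J"
    proof (rule cl)
      have e: "of_int (c + 1) * ?h = of_int c * ?h + ?h" by (simp add: algebra_simps)
      have e2: "of_int (2 * ?i - 10) * ?g = of_int (2 * ?i - 9) * ?g - ?g" "of_int (2 * ?i + 8) * ?g = of_int (2 * ?i + 7) * ?g + ?g"
        by (simp_all add: algebra_simps)
      show "of_int (2 * ?i - 10) * ?g < of_int (c + 1) * ?h" "of_int (c + 1) * ?h \<le> of_int (2 * ?i + 8) * ?g"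
        unfolding e e2 using c Zr hg h by linarith+
    qed
    moreover have "cell ?J (c + 1) \<le> ?h * (m0 + sc ?J)"
    proof (rule cell_bounds(1))
      fix t assume "grid ?J (c + 1 - 1) \<le> t" "t \<le> grid ?J (c + 1)"
      hence "Z \<le> t" "t \<le> Z + 2 * ?h" unfolding gc using c by linarith+
      thus "f t \<le> m0 + sc ?J" using mono_right[of t "Z + 2 * ?h"] r by simp
    qed (use c0 c1 in auto)
    ultimately show ?thesis using c0 c1 by (intro bexI[of _ "c + 1"]) auto
  next
    case l
    define c where "c = \<lfloor>Z / ?h\<rfloor>"
    have c: "of_int c * ?h \<le> Z" "Z < of_int c * ?h + ?h"
    proof -
      have "of_int c \<le> Z / ?h" "Z / ?h < of_int c + 1" unfolding c_def by linarith+
      thus "of_int c * ?h \<le> Z" "Z < of_int c * ?h + ?h" using h by (simp_all add: field_simps)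
    qed
    have gc: "grid ?J c = of_int c * ?h" "grid ?J (c - 1) = of_int c * ?h - ?h"
      by (simp_all add: grid_def algebra_simps)
    have "0 \<le> grid ?J (c - 1)" unfolding gc using c l by linarith
    hence c0: "1 \<le> c" by (simp add: grid_nonneg_iff)
    have "grid ?J c \<le> 1" unfolding gc using c Z by linarith
    hence c1: "c \<le> 2 ^ ?J" by (simp add: grid_le_1_iff)
    have "c \<in> cells j0 ?i ?J"
    proof (rule cl)
      have e2: "of_int (2 * ?i - 10) * ?g = of_int (2 * ?i - 9) * ?g - ?g" "of_int (2 * ?i + 8) * ?g = of_int (2 * ?i + 7) * ?g + ?g"
        by (simp_all add: algebra_simps)
      show "of_int (2 * ?i - 10) * ?g < of_int c * ?h" "of_int c * ?h \<le> of_int (2 * ?i + 8) * ?g"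
        unfolding e2 using c Zr hg h by linarith+
    qed
    moreover have "cell ?J c \<le> ?h * (m0 + sc ?J)"
    proof (rule cell_bounds(1))
      fix t assume "grid ?J (c - 1) \<le> t" "t \<le> grid ?J c"
      hence "Z - 2 * ?h \<le> t" "t \<le> Z" unfolding gc using c by linarith+
      thus "f t \<le> m0 + sc ?J" using mono_left[of "Z - 2 * ?h" t] l by simp
    qed (use c0 c1 in auto)
    ultimately show ?thesis using c0 c1 by (intro bexI[of _ c]) auto
  qed
qed

end

text \<open>The positive part in the starting level makes the number of searched cells depend on the
  stopping level when that is small. The maximum over the finitely many depths \<open>d\<close>
  removes this dependence.\<close>

definition len_const :: "real \<Rightarrow> real" where
  "len_const \<alpha> = (Max ((\<lambda>d. \<bar>S_quantile (9 * 2 ^ d) (\<alpha> / 4)\<bar>) ` {..K_tilde (\<alpha> / 4) + K_const (\<alpha> / 4) + 1})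
     + \<bar>z_quantile (\<alpha> / 4)\<bar> + 1) * (sqrt 3 * sqrt (2 ^ K_tilde (\<alpha> / 4)))"

lemma len_const_pos: "0 < len_const \<alpha>"
proof -
  have "\<bar>S_quantile (9 * 2 ^ d) (\<alpha> / 4)\<bar> \<le> Max ((\<lambda>d. \<bar>S_quantile (9 * 2 ^ d) (\<alpha> / 4)\<bar>) ` {..K_tilde (\<alpha> / 4) + K_const (\<alpha> / 4) + 1})"
    if "d \<le> K_tilde (\<alpha> / 4) + K_const (\<alpha> / 4) + 1" for d
    using that by (intro Max_ge) auto
  from order_trans[OF abs_ge_zero this[of 0]]
  have "0 \<le> Max ((\<lambda>d. \<bar>S_quantile (9 * 2 ^ d) (\<alpha> / 4)\<bar>) ` {..K_tilde (\<alpha> / 4) + K_const (\<alpha> / 4) + 1})" by blast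
  thus ?thesis unfolding len_const_def by (intro mult_pos_pos) auto
qed

context min_ci
begin

text \<open>No level before \<open>j_steep n\<close> stops, which gives the first claim. If the hull
  of level \<open>j_hat - K - 1\<close> missed \<open>Z\<close>, the levels up to
  \<open>j_hat - 1\<close> would form the excluded run without a stop; for small
  \<open>j_hat\<close> that level is 0, and its hull contains the whole unit interval.\<close>

lemma good_levels:
  assumes A1: "\<not> (\<exists>j0. Z \<notin> loc_hull yl j0 \<and> (\<forall>j\<in>{..j0 + K}. no_stop \<epsilon> yl ys j))"
    and A2: "\<not> (\<exists>j\<in>{..<j_steep n}. lbad yl j \<or> sbad ys j)"
    and A0: "\<not> (\<forall>j. no_stop \<epsilon> yl ys j)"
  shows "j_steep n \<le> j_hat \<epsilon> yl ys" and "Z \<in> loc_hull yl (j_hat \<epsilon> yl ys - K - 1)"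
proof -
  let ?jh = "j_hat \<epsilon> yl ys"
  have stop: "\<not> no_stop \<epsilon> yl ys ?jh" using A0 stop_at_j_hat[OF eps] by blast
  show "j_steep n \<le> ?jh"
  proof (rule ccontr)
    assume "\<not> ?thesis"
    hence "no_stop \<epsilon> yl ys ?jh" using A2 by (intro no_stop_if_good) auto
    thus False using stop by simp
  qed
  show "Z \<in> loc_hull yl (?jh - K - 1)"
  proof (cases "?jh \<le> K + 1")
    case True
    thus ?thesis using unit_subset_hull_0[of yl] Z by auto
  next
    case False
    hence "no_stop \<epsilon> yl ys j" if "j \<le> (?jh - K - 1) + K" for j
      using that by (intro no_stop_less_j_hat[OF eps]) auto
    thus ?thesis using A1 by auto
  qed
qed

theorem coverage:
  assumes \<alpha>: "0 < \<alpha>" "\<alpha> < 1"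
  shows "1 - \<alpha> \<le> measure M {\<omega> \<in> space M. minimum f \<in> CI_random W B1 B2 \<alpha> \<epsilon> f \<omega>}"
proof -
  let ?P = "path_space" let ?P2 = "?P \<Otimes>\<^sub>M ?P" let ?P3 = "?P \<Otimes>\<^sub>M ?P2"
  let ?K = "K_const (\<alpha> / 4)" and ?n = "K_tilde (\<alpha> / 4)"
  have \<beta>: "0 < \<alpha> / 4" "\<alpha> / 4 < 1" using \<alpha> by auto
  have m: "npath 0 \<in> M \<rightarrow>\<^sub>M ?P" "npath 1 \<in> M \<rightarrow>\<^sub>M ?P" "npath 2 \<in> M \<rightarrow>\<^sub>M ?P" by (rule measurable_path, simp)+
  interpret P0: prob_space "law 0" by (rule prob_space_law) simp
  interpret P1: prob_space "law 1" by (rule prob_space_law) simp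
  define A1 where "A1 = {p \<in> space ?P2. \<exists>j0. Z \<notin> loc_hull (y (fst p)) j0 \<and> (\<forall>j\<in>{..j0 + ?K}. no_stop \<epsilon> (y (fst p)) (y (snd p)) j)}"
  define A2 where "A2 = {p \<in> space ?P2. \<exists>j\<in>{..<j_steep ?n}. lbad (y (fst p)) j \<or> sbad (y (snd p)) j}"
  define A0 where "A0 = {p \<in> space ?P2. \<forall>j. no_stop \<epsilon> (y (fst p)) (y (snd p)) j}"
  define U where "U = A1 \<union> A2 \<union> A0"
  note A1 = emeasure_hull_failure[OF \<beta>, folded A1_def]
  note A2 = emeasure_early[OF \<beta>, folded A2_def]
  have [measurable]: "Measurable.pred ?P2 (\<lambda>p. no_stop \<epsilon> (y (fst p)) (y (snd p)) j)" for j
    by (intro pred_no_stop_path measurable_fst measurable_snd)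
  have A0m: "A0 \<in> sets ?P2" unfolding A0_def by measurable
  have Um: "U \<in> sets ?P2" unfolding U_def using A1(1) A2(1) A0m by auto
  have pm: "(\<lambda>\<omega>. (npath 0 \<omega>, npath 1 \<omega>)) \<in> M \<rightarrow>\<^sub>M ?P2" using m by (intro measurable_Pair)
  have sm: "{\<omega> \<in> space M. (npath 0 \<omega>, npath 1 \<omega>) \<in> B} \<in> sets M" if "B \<in> sets ?P2" for B
    by (rule measurable_sets_Collect[OF pm]) (use that in auto)
  have e0: "emeasure M {\<omega> \<in> space M. (npath 0 \<omega>, npath 1 \<omega>) \<in> A0} = 0"
  proof -
    have "AE \<omega> in M. \<omega> \<notin> {\<omega> \<in> space M. (npath 0 \<omega>, npath 1 \<omega>) \<in> A0}"
      using AE_stops by eventually_elim (auto simp: A0_def)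
    thus ?thesis using sm[OF A0m] by (subst (asm) AE_iff_measurable[OF _ refl]) (auto intro!: arg_cong[where f="emeasure M"])
  qed
  have PU: "emeasure M {\<omega> \<in> space M. (npath 0 \<omega>, npath 1 \<omega>) \<in> U} \<le> ennreal (\<alpha> / 2)"
  proof -
    let ?S = "\<lambda>B. {\<omega> \<in> space M. (npath 0 \<omega>, npath 1 \<omega>) \<in> B}"
    have eq: "?S U = ?S A1 \<union> ?S A2 \<union> ?S A0" by (auto simp: U_def)
    have "emeasure M (?S U) \<le> emeasure M (?S A1 \<union> ?S A2) + emeasure M (?S A0)"
      unfolding eq by (intro emeasure_subadditive sets.Un sm A1(1) A2(1) A0m)
    also have "\<dots> \<le> (emeasure M (?S A1) + emeasure M (?S A2)) + 0"
      unfolding e0 by (intro add_mono order_refl emeasure_subadditive sm A1(1) A2(1))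
    also have "\<dots> \<le> (ennreal (\<alpha> / 4) + ennreal (\<alpha> / 4)) + 0"
      by (intro add_mono A1(2) A2(2) order_refl)
    also have "\<dots> = ennreal (\<alpha> / 2)" using \<alpha> by (simp add: ennreal_plus[symmetric] del: ennreal_plus)
    finally show ?thesis .
  qed
  define A where "A = {p \<in> space ?P3. \<not> (lo \<alpha> \<epsilon> (y (fst p)) (y (fst (snd p))) (y (snd (snd p))) \<le> m0 \<and>
     m0 \<le> hi \<alpha> \<epsilon> (y (fst p)) (y (fst (snd p))) (y (snd (snd p))))}"
  have Am: "A \<in> sets ?P3"
  proof -
    have p: "fst \<in> ?P3 \<rightarrow>\<^sub>M ?P" "(\<lambda>p. fst (snd p)) \<in> ?P3 \<rightarrow>\<^sub>M ?P" "(\<lambda>p. snd (snd p)) \<in> ?P3 \<rightarrow>\<^sub>M ?P" by measurable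
    note [measurable] = measurable_lo_hi[OF eps measurable_incr_comp[OF p(1)] measurable_incr_comp[OF p(2)] measurable_incr_comp[OF p(3)], of \<alpha>]
    show ?thesis unfolding A_def by measurable
  qed
  \<comment> \<open>For frozen \<open>x\<close> and \<open>z\<close> outside \<open>U\<close> the
    stopping level and the search region are constants, and a suitable cell \<open>k0\<close>
    exists; only the two endpoint errors of the third path remain, \<alpha> / 4 each.\<close>
  have sec: "emeasure M {\<omega> \<in> space M. (x, z, npath 2 \<omega>) \<in> A} \<le> indicator U (x, z) + ennreal (\<alpha> / 2)"
    if x: "x \<in> space ?P" and z: "z \<in> space ?P" for x z
  proof (cases "(x, z) \<in> U")
    case True
    have "emeasure M {\<omega> \<in> space M. (x, z, npath 2 \<omega>) \<in> A} \<le> 1" by (rule W.emeasure_le_1)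
    thus ?thesis using True by (simp add: add_increasing2)
  next
    case False
    hence g: "\<not> (\<exists>j0. Z \<notin> loc_hull (y x) j0 \<and> (\<forall>j\<in>{..j0 + ?K}. no_stop \<epsilon> (y x) (y z) j))"
      "\<not> (\<exists>j\<in>{..<j_steep ?n}. lbad (y x) j \<or> sbad (y z) j)" "\<not> (\<forall>j. no_stop \<epsilon> (y x) (y z) j)"
      using x z by (auto simp: U_def A1_def A2_def A0_def space_pair_measure)
    let ?jh = "j_hat \<epsilon> (y x) (y z)" let ?j0 = "?jh - ?K - 1" let ?J = "?jh + ?n" let ?i = "i_hat (y x) ?j0"
    have n4: "4 \<le> ?n" unfolding K_tilde_def by linarith
    obtain k0 where k0: "k0 \<in> cells ?j0 ?i ?J" "1 \<le> k0" "k0 \<le> 2 ^ ?J" "cell ?J k0 \<le> mesh ?J * (m0 + sc ?J)"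
      using ex_low_cell[OF good_levels(1)[OF g] n4 _ good_levels(2)[OF g]] by auto
    have i: "1 \<le> ?i" "?i \<le> 2 ^ ?j0" using i_hat_range by auto
    have le: "?j0 \<le> ?J" by simp
    let ?L = "{\<omega> \<in> space M. m0 < lo \<alpha> \<epsilon> (y x) (y z) (y (npath 2 \<omega>))}"
    let ?H = "{\<omega> \<in> space M. hi \<alpha> \<epsilon> (y x) (y z) (y (npath 2 \<omega>)) < m0}"
    have lm: "(\<lambda>\<omega>. lo \<alpha> \<epsilon> (y x) (y z) (y (npath 2 \<omega>))) \<in> borel_measurable M"
       "(\<lambda>\<omega>. hi \<alpha> \<epsilon> (y x) (y z) (y (npath 2 \<omega>))) \<in> borel_measurable M"
      by (rule measurable_lo_hi[OF eps _ _ measurable_incr_comp[OF m(3)]]; rule borel_measurable_const)+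
    have LH: "?L \<in> sets M" "?H \<in> sets M"
      using lm by measurable
    have "{\<omega> \<in> space M. (x, z, npath 2 \<omega>) \<in> A} \<subseteq> ?L \<union> ?H"
    proof
      fix \<omega> assume w: "\<omega> \<in> {\<omega> \<in> space M. (x, z, npath 2 \<omega>) \<in> A}"
      note w = conjunct1[OF w[unfolded mem_Collect_eq]] conjunct2[OF w[unfolded mem_Collect_eq]]
      from w(2) have "\<not> (lo \<alpha> \<epsilon> (y x) (y z) (y (npath 2 \<omega>)) \<le> m0 \<and> m0 \<le> hi \<alpha> \<epsilon> (y x) (y z) (y (npath 2 \<omega>)))"
        unfolding A_def mem_Collect_eq fst_conv snd_conv by (rule conjunct2)
      hence "m0 < lo \<alpha> \<epsilon> (y x) (y z) (y (npath 2 \<omega>)) \<or> hi \<alpha> \<epsilon> (y x) (y z) (y (npath 2 \<omega>)) < m0"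
        by (simp only: de_Morgan_conj not_le)
      thus "\<omega> \<in> ?L \<union> ?H"
        using w(1) by (simp only: Un_iff mem_Collect_eq simp_thms)
    qed
    hence "emeasure M {\<omega> \<in> space M. (x, z, npath 2 \<omega>) \<in> A} \<le> emeasure M (?L \<union> ?H)"
      by (rule emeasure_mono[OF _ sets.Un[OF LH]])
    also have "\<dots> \<le> emeasure M ?L + emeasure M ?H" by (rule emeasure_subadditive[OF LH])
    also have "\<dots> \<le> ennreal (\<alpha> / 4) + ennreal (\<alpha> / 4)"
      unfolding lo_def hi_def by (intro add_mono cover_lower[OF \<alpha> k0] cover_upper[OF \<alpha> le i])
    also have "\<dots> = ennreal (\<alpha> / 2)" using \<alpha> by (simp add: ennreal_plus[symmetric] del: ennreal_plus)
    finally show ?thesis using False by simp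
  qed
  have Us: "(\<lambda>z. indicator U (x, z) :: ennreal) \<in> borel_measurable (law 1)" if "x \<in> space ?P" for x
  proof -
    have "Pair x -` U \<in> sets (law 1)" using sets_Pair1[OF Um] by simp
    hence "(indicator (Pair x -` U) :: _ \<Rightarrow> ennreal) \<in> borel_measurable (law 1)" by simp
    moreover have "(\<lambda>z. indicator U (x, z) :: ennreal) = indicator (Pair x -` U)"
      by (rule ext) (simp add: indicator_def)
    ultimately show ?thesis by (simp only:)
  qed
  have "emeasure M {\<omega> \<in> space M. (npath 0 \<omega>, npath 1 \<omega>, npath 2 \<omega>) \<in> A}
     = (\<integral>\<^sup>+x. \<integral>\<^sup>+z. emeasure M {\<omega> \<in> space M. (x, z, npath 2 \<omega>) \<in> A} \<partial>law 1 \<partial>law 0)"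
    by (rule emeasure_triple[OF Am])
  also have "\<dots> \<le> (\<integral>\<^sup>+x. \<integral>\<^sup>+z. (indicator U (x, z) + ennreal (\<alpha> / 2)) \<partial>law 1 \<partial>law 0)"
    by (intro nn_integral_mono sec) auto
  also have "\<dots> = (\<integral>\<^sup>+x. emeasure M {\<omega> \<in> space M. (x, npath 1 \<omega>) \<in> U} + ennreal (\<alpha> / 2) \<partial>law 0)"
  proof (rule nn_integral_cong)
    fix x assume "x \<in> space (law 0)"
    hence x: "x \<in> space ?P" by simp
    have Ux: "Pair x -` U \<in> sets ?P" by (rule sets_Pair1[OF Um])
    have "(\<integral>\<^sup>+z. (indicator U (x, z) + ennreal (\<alpha> / 2)) \<partial>law 1) = (\<integral>\<^sup>+z. indicator U (x, z) \<partial>law 1) + (\<integral>\<^sup>+z. ennreal (\<alpha> / 2) \<partial>law 1)"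
      by (rule nn_integral_add[OF Us[OF x]]) simp
    also have "(\<integral>\<^sup>+z. indicator U (x, z) \<partial>law 1) = (\<integral>\<^sup>+z. indicator (Pair x -` U) z \<partial>law 1)"
      by (rule nn_integral_cong) (simp add: indicator_def)
    also have "\<dots> = emeasure (law 1) (Pair x -` U)" using Ux by (intro nn_integral_indicator) simp
    also have "\<dots> = emeasure M (npath 1 -` (Pair x -` U) \<inter> space M)" by (rule emeasure_distr[OF m(2) Ux])
    also have "npath 1 -` (Pair x -` U) \<inter> space M = {\<omega> \<in> space M. (x, npath 1 \<omega>) \<in> U}" by auto
    also have "(\<integral>\<^sup>+z. ennreal (\<alpha> / 2) \<partial>law 1) = ennreal (\<alpha> / 2)" using P1.emeasure_space_1 by simp
    finally show "(\<integral>\<^sup>+z. (indicator U (x, z) + ennreal (\<alpha> / 2)) \<partial>law 1) = emeasure M {\<omega> \<in> space M. (x, npath 1 \<omega>) \<in> U} + ennreal (\<alpha> / 2)" .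
  qed
  also have "\<dots> = (\<integral>\<^sup>+x. emeasure M {\<omega> \<in> space M. (x, npath 1 \<omega>) \<in> U} \<partial>law 0) + (\<integral>\<^sup>+x. ennreal (\<alpha> / 2) \<partial>law 0)"
  proof (rule nn_integral_add)
    have "(\<lambda>x. emeasure (law 1) (Pair x -` U)) \<in> borel_measurable (law 0)"
      by (rule P1.measurable_emeasure_Pair) (use Um in \<open>simp cong: sets_pair_measure_cong\<close>)
    moreover have "emeasure (law 1) (Pair x -` U) = emeasure M {\<omega> \<in> space M. (x, npath 1 \<omega>) \<in> U}" for x
      by (subst emeasure_distr[OF m(2) sets_Pair1[OF Um]]) (auto intro!: arg_cong[where f="emeasure M"])
    ultimately show "(\<lambda>x. emeasure M {\<omega> \<in> space M. (x, npath 1 \<omega>) \<in> U}) \<in> borel_measurable (law 0)" by simp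
  qed simp
  also have "\<dots> \<le> ennreal (\<alpha> / 2) + ennreal (\<alpha> / 2)"
    using PU P0.emeasure_space_1 unfolding emeasure_pair[OF Um] by (intro add_mono) simp_all
  also have "\<dots> = ennreal \<alpha>" using \<alpha> by (simp add: ennreal_plus[symmetric] del: ennreal_plus)
  finally have fail: "emeasure M {\<omega> \<in> space M. (npath 0 \<omega>, npath 1 \<omega>, npath 2 \<omega>) \<in> A} \<le> ennreal \<alpha>" .
  let ?F = "{\<omega> \<in> space M. (npath 0 \<omega>, npath 1 \<omega>, npath 2 \<omega>) \<in> A}"
  have Fm: "?F \<in> sets M"
    by (rule measurable_sets_Collect[of _ _ ?P3]) (use m Am in \<open>auto intro!: measurable_Pair\<close>)
  have "{\<omega> \<in> space M. minimum f \<in> CI_random W B1 B2 \<alpha> \<epsilon> f \<omega>} = space M - ?F"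
    unfolding CI_random_eq using measurable_space[OF m(1)] measurable_space[OF m(2)] measurable_space[OF m(3)]
    by (auto simp: A_def space_pair_measure m0_def)
  moreover have "W.prob ?F \<le> \<alpha>" using fail \<alpha> by (simp add: W.emeasure_eq_measure)
  ultimately show ?thesis using W.prob_compl[OF Fm] by simp
qed

section \<open>Expected length\<close>

lemma length_le:
  "hi \<alpha> \<epsilon> yl ys ye - lo \<alpha> \<epsilon> yl ys ye \<le> len_const \<alpha> * \<epsilon> * sqrt (2 ^ j_hat \<epsilon> yl ys)"
proof -
  let ?K = "K_const (\<alpha> / 4)" and ?n = "K_tilde (\<alpha> / 4)" and ?jh = "j_hat \<epsilon> yl ys"
  let ?d = "?jh + ?n - (?jh - ?K - 1)"
  let ?S = "Max ((\<lambda>d. \<bar>S_quantile (9 * 2 ^ d) (\<alpha> / 4)\<bar>) ` {..?n + ?K + 1})"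
  have "?d \<le> ?n + ?K + 1" by simp
  hence S: "\<bar>S_quantile (9 * 2 ^ ?d) (\<alpha> / 4)\<bar> \<le> ?S" by (intro Max_ge) auto
  have sc: "sc (?jh + ?n) = (sqrt 3 * sqrt (2 ^ ?n)) * (\<epsilon> * sqrt (2 ^ ?jh))"
    by (simp add: mesh_def real_sqrt_divide real_sqrt_mult power_add)
  have p: "0 \<le> sc (?jh + ?n)" using eps mesh_pos[of "?jh + ?n"] by simp
  have "hi \<alpha> \<epsilon> yl ys ye - lo \<alpha> \<epsilon> yl ys ye = (S_quantile (9 * 2 ^ ?d) (\<alpha> / 4) + z_quantile (\<alpha> / 4) + 1) * sc (?jh + ?n)"
    unfolding hi_def lo_def ci_hi_def ci_lo_def by (simp add: algebra_simps)
  also have "\<dots> \<le> (?S + \<bar>z_quantile (\<alpha> / 4)\<bar> + 1) * sc (?jh + ?n)"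
    using S p by (intro mult_right_mono) linarith+
  also have "\<dots> = len_const \<alpha> * \<epsilon> * sqrt (2 ^ ?jh)" unfolding sc len_const_def by (simp add: ac_simps)
  finally show ?thesis .
qed

text \<open>The ratio \<open>sqrt 2 / 2\<close> is replaced by the rational \<open>3 / 4\<close>, so
  that the series can be summed exactly.\<close>

lemma sqrt2_pow_le: "sqrt (2 ^ (a + Suc k)) * (1 / 2) ^ Suc k \<le> sqrt (2 ^ a) * (3 / 4) ^ Suc k"
proof -
  have "sqrt 2 \<le> (3 / 2 :: real)" by (rule real_le_lsqrt) (simp_all add: power2_eq_square)
  hence "sqrt 2 / 2 \<le> (3 / 4 :: real)" by simp
  hence "(sqrt 2 / 2) ^ Suc k \<le> (3 / 4 :: real) ^ Suc k" by (intro power_mono) auto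
  moreover have "sqrt (2 ^ (a + Suc k)) * (1 / 2) ^ Suc k = sqrt (2 ^ a) * (sqrt 2 / 2) ^ Suc k"
    by (simp only: power_add real_sqrt_mult real_sqrt_power power_divide power_one mult.assoc) simp
  ultimately show ?thesis by (simp only:) (rule mult_left_mono, auto)
qed

lemma term_le_suminf: "g k \<le> suminf g" for g :: "nat \<Rightarrow> ennreal"
  using sum_le_suminf[OF summableI, of "{k}" g] by simp

text \<open>A stopping level \<open>a + k + 1\<close> requires the \<open>k + 1\<close> levels from
  \<open>a\<close> on to pass without a stop. The growth \<open>sqrt 2\<close> and the probability
  \<open>1 / 2\<close> per level give a convergent geometric series, of value 3 times the leading
  term; levels up to \<open>a\<close> add 1.\<close>

lemma nn_integral_sqrt_j_hat:
  assumes a: "64 * mesh a \<le> width"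
  shows "(\<integral>\<^sup>+\<omega>. ennreal (sqrt (2 ^ j_hat \<epsilon> (y (npath 0 \<omega>)) (y (npath 1 \<omega>)))) \<partial>M) \<le> ennreal (4 * sqrt (2 ^ a))"
proof -
  let ?E = "\<lambda>k. {\<omega> \<in> space M. \<forall>j\<in>{a..<a + Suc k}. no_stop \<epsilon> (y (npath 0 \<omega>)) (y (npath 1 \<omega>)) j}"
  have m: "npath 0 \<in> M \<rightarrow>\<^sub>M path_space" "npath 1 \<in> M \<rightarrow>\<^sub>M path_space" by (rule measurable_path, simp)+
  have Em: "?E k \<in> sets M" for k
    by (intro sets.sets_Collect_finite_All predE pred_no_stop_path m) simp
  have "(\<integral>\<^sup>+\<omega>. ennreal (sqrt (2 ^ j_hat \<epsilon> (y (npath 0 \<omega>)) (y (npath 1 \<omega>)))) \<partial>M)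
    \<le> (\<integral>\<^sup>+\<omega>. ennreal (sqrt (2 ^ a)) + (\<Sum>k. ennreal (sqrt (2 ^ (a + Suc k))) * indicator (?E k) \<omega>) \<partial>M)"
  proof (rule nn_integral_mono)
    fix \<omega> assume w: "\<omega> \<in> space M"
    let ?jh = "j_hat \<epsilon> (y (npath 0 \<omega>)) (y (npath 1 \<omega>))"
    show "ennreal (sqrt (2 ^ ?jh)) \<le> ennreal (sqrt (2 ^ a)) + (\<Sum>k. ennreal (sqrt (2 ^ (a + Suc k))) * indicator (?E k) \<omega>)"
    proof (cases "?jh \<le> a")
      case True
      hence "sqrt (2 ^ ?jh) \<le> sqrt (2 ^ a :: real)" by (simp add: power_increasing)
      thus ?thesis by (intro add_increasing2 ennreal_leI) auto
    next
      case False
      define k where "k = ?jh - Suc a"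
      have k: "?jh = a + Suc k" using False by (simp add: k_def)
      have "\<omega> \<in> ?E k" using w k no_stop_less_j_hat[OF eps] by auto
      hence "ennreal (sqrt (2 ^ ?jh)) = ennreal (sqrt (2 ^ (a + Suc k))) * indicator (?E k) \<omega>" using k by simp
      also have "\<dots> \<le> (\<Sum>k. ennreal (sqrt (2 ^ (a + Suc k))) * indicator (?E k) \<omega>)"
        by (rule term_le_suminf)
      finally show ?thesis by (simp add: add_increasing)
    qed
  qed
  also have "\<dots> = ennreal (sqrt (2 ^ a)) + (\<Sum>k. ennreal (sqrt (2 ^ (a + Suc k))) * emeasure M (?E k))"
    using Em by (simp add: nn_integral_add nn_integral_suminf nn_integral_cmult W.emeasure_space_1)
  also have "\<dots> \<le> ennreal (sqrt (2 ^ a)) + (\<Sum>k. ennreal (sqrt (2 ^ a) * (3 / 4) ^ Suc k))"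
  proof (intro add_mono order_refl suminf_le summableI)
    fix k
    have "ennreal (sqrt (2 ^ (a + Suc k))) * emeasure M (?E k) \<le> ennreal (sqrt (2 ^ (a + Suc k))) * ennreal ((1 / 2) ^ Suc k)"
      by (intro mult_left_mono emeasure_no_stop_flat[OF a]) simp
    also have "\<dots> = ennreal (sqrt (2 ^ (a + Suc k)) * (1 / 2) ^ Suc k)" by (simp add: ennreal_mult'[symmetric])
    also have "\<dots> \<le> ennreal (sqrt (2 ^ a) * (3 / 4) ^ Suc k)" by (rule ennreal_leI[OF sqrt2_pow_le])
    finally show "ennreal (sqrt (2 ^ (a + Suc k))) * emeasure M (?E k) \<le> ennreal (sqrt (2 ^ a) * (3 / 4) ^ Suc k)" .
  qed
  also have "(\<Sum>k. ennreal (sqrt (2 ^ a) * (3 / 4) ^ Suc k)) = ennreal (sqrt (2 ^ a) * 3)"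
  proof -
    have "(\<lambda>k. (3 / 4 :: real) ^ k) sums 4" using geometric_sums[of "3 / 4 :: real"] by simp
    from sums_mult[OF this, of "sqrt (2 ^ a) * (3 / 4)"]
    have "(\<lambda>k. sqrt (2 ^ a) * (3 / 4 :: real) ^ Suc k) sums (sqrt (2 ^ a) * 3)" by (simp add: ac_simps)
    thus ?thesis by (intro suminf_ennreal_eq) auto
  qed
  also have "ennreal (sqrt (2 ^ a)) + ennreal (sqrt (2 ^ a) * 3) = ennreal (4 * sqrt (2 ^ a))"
    by (simp add: ennreal_plus[symmetric] del: ennreal_plus)
  finally show ?thesis .
qed

theorem expected_length:
  "(\<integral>\<^sup>+\<omega>. interval_length (CI_random W B1 B2 \<alpha> \<epsilon> f \<omega>) \<partial>M) \<le> ennreal (96 * len_const \<alpha> * rho_m \<epsilon> f)"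
proof -
  obtain a where a: "64 * mesh a \<le> width" "width \<le> 128 * mesh a" by (rule ex_fine_level)
  have m: "npath 0 \<in> M \<rightarrow>\<^sub>M path_space" "npath 1 \<in> M \<rightarrow>\<^sub>M path_space" by (rule measurable_path, simp)+
  have jm: "(\<lambda>\<omega>. j_hat \<epsilon> (y (npath 0 \<omega>)) (y (npath 1 \<omega>))) \<in> M \<rightarrow>\<^sub>M count_space UNIV"
    by (rule measurable_j_hat[OF eps measurable_incr_comp[OF m(1)] measurable_incr_comp[OF m(2)]])
  have sm: "(\<lambda>\<omega>. ennreal (sqrt (2 ^ j_hat \<epsilon> (y (npath 0 \<omega>)) (y (npath 1 \<omega>))))) \<in> borel_measurable M"
    by (rule measurable_compose[OF jm]) simp
  have l0: "0 \<le> len_const \<alpha> * \<epsilon>" using len_const_pos[of \<alpha>] eps by simp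
  have "(\<integral>\<^sup>+\<omega>. interval_length (CI_random W B1 B2 \<alpha> \<epsilon> f \<omega>) \<partial>M)
     \<le> (\<integral>\<^sup>+\<omega>. ennreal (len_const \<alpha> * \<epsilon>) * ennreal (sqrt (2 ^ j_hat \<epsilon> (y (npath 0 \<omega>)) (y (npath 1 \<omega>)))) \<partial>M)"
  proof (rule nn_integral_mono)
    fix \<omega>
    have "interval_length (CI_random W B1 B2 \<alpha> \<epsilon> f \<omega>) \<le> ennreal (hi \<alpha> \<epsilon> (y (npath 0 \<omega>)) (y (npath 1 \<omega>)) (y (npath 2 \<omega>)) - lo \<alpha> \<epsilon> (y (npath 0 \<omega>)) (y (npath 1 \<omega>)) (y (npath 2 \<omega>)))"
      unfolding CI_random_eq interval_length_def by (simp add: emeasure_lborel_Icc_eq)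
    also have "\<dots> \<le> ennreal (len_const \<alpha> * \<epsilon> * sqrt (2 ^ j_hat \<epsilon> (y (npath 0 \<omega>)) (y (npath 1 \<omega>))))"
      by (rule ennreal_leI[OF length_le])
    finally show "interval_length (CI_random W B1 B2 \<alpha> \<epsilon> f \<omega>) \<le> ennreal (len_const \<alpha> * \<epsilon>) * ennreal (sqrt (2 ^ j_hat \<epsilon> (y (npath 0 \<omega>)) (y (npath 1 \<omega>))))"
      using l0 by (simp add: ennreal_mult')
  qed
  also have "\<dots> = ennreal (len_const \<alpha> * \<epsilon>) * (\<integral>\<^sup>+\<omega>. ennreal (sqrt (2 ^ j_hat \<epsilon> (y (npath 0 \<omega>)) (y (npath 1 \<omega>)))) \<partial>M)"
    by (rule nn_integral_cmult[OF sm])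
  also have "\<dots> \<le> ennreal (len_const \<alpha> * \<epsilon>) * ennreal (4 * sqrt (2 ^ a))"
    by (intro mult_left_mono nn_integral_sqrt_j_hat[OF a(1)]) simp
  also have "\<dots> = ennreal (len_const \<alpha> * (4 * (\<epsilon> * sqrt (2 ^ a))))"
    using l0 by (simp add: ennreal_mult'[symmetric] ac_simps)
  also have "\<dots> \<le> ennreal (96 * len_const \<alpha> * rho_m \<epsilon> f)"
  proof (rule ennreal_leI)
    \<comment> \<open>The bound 128 is rounded up to the square of 12; then 96 is 4 times 2 times
      12.\<close>
    have "width * 2 ^ a \<le> 144" using a(2) by (simp add: mesh_def field_simps)
    hence "sqrt (width * 2 ^ a) \<le> sqrt (12\<^sup>2)" by (intro real_sqrt_le_mono) simp
    hence w: "sqrt width * sqrt (2 ^ a) \<le> 12" by (simp add: real_sqrt_mult)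
    have "\<epsilon> * sqrt (2 ^ a) = 2 * \<rho> * (sqrt width * sqrt (2 ^ a))"
      by (subst sqrt_width[symmetric]) (simp only: mult.assoc)
    also have "\<dots> \<le> 2 * \<rho> * 12" using w rho_pos by (intro mult_left_mono) auto
    finally have "4 * (\<epsilon> * sqrt (2 ^ a)) \<le> 96 * \<rho>" by simp
    hence "len_const \<alpha> * (4 * (\<epsilon> * sqrt (2 ^ a))) \<le> len_const \<alpha> * (96 * \<rho>)"
      using len_const_pos[of \<alpha>] by (intro mult_left_mono) auto
    thus "len_const \<alpha> * (4 * (\<epsilon> * sqrt (2 ^ a))) \<le> 96 * len_const \<alpha> * rho_m \<epsilon> f"
      by (simp add: \<rho>_def ac_simps)
  qed
  finally show ?thesis .
qed

end

section \<open>Total variation between two drifts\<close>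

text \<open>The sets that can be approximated under both measures by the same member of the algebra
  form a sigma-algebra. The common approximant is what a comparison of the two measures
  requires.\<close>

lemma approx_by_algebra:
  assumes alg: "algebra \<Omega> G"
    and \<mu>: "finite_measure \<mu>" "sets \<mu> = sigma_sets \<Omega> G" and \<nu>: "finite_measure \<nu>" "sets \<nu> = sigma_sets \<Omega> G"
    and A: "A \<in> sigma_sets \<Omega> G"
  shows "\<forall>e>0. \<exists>C\<in>G. measure \<mu> (sym_diff A C) < e \<and> measure \<nu> (sym_diff A C) < e"
  using A
proof induction
  interpret G: algebra \<Omega> G by fact
  {
    case (Basic a)
    thus ?case by (auto intro!: bexI[of _ a])
  next
    case Empty
    show ?case by (auto intro!: bexI[of _ "{}"])
  next
    case (Compl a)
    show ?case
    proof (intro allI impI)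
      fix e :: real assume "0 < e"
      then obtain C where C: "C \<in> G" "measure \<mu> (sym_diff a C) < e" "measure \<nu> (sym_diff a C) < e"
        using Compl.IH by blast
      have "a \<subseteq> \<Omega>" using sigma_sets_into_sp[OF G.space_closed Compl.hyps] .
      moreover have "C \<subseteq> \<Omega>" using G.space_closed C(1) by auto
      ultimately have "sym_diff (\<Omega> - a) (\<Omega> - C) = sym_diff a C" by auto
      thus "\<exists>C\<in>G. measure \<mu> (sym_diff (\<Omega> - a) C) < e \<and> measure \<nu> (sym_diff (\<Omega> - a) C) < e"
        using C by (intro bexI[of _ "\<Omega> - C"]) auto
    qed
  next
    case (Union a)
    have am: "a i \<in> sets \<mu>" "a i \<in> sets \<nu>" for i using Union.hyps \<mu> \<nu> by auto
    have Gm: "C \<in> sets \<mu>" "C \<in> sets \<nu>" if "C \<in> G" for C using that \<mu> \<nu> by auto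
    have lim: "eventually (\<lambda>n. measure \<kappa> (\<Union>(range a) - (\<Union>i<n. a i)) < e) sequentially"
      if \<kappa>: "finite_measure \<kappa>" and ak: "\<And>i. a i \<in> sets \<kappa>" and e: "0 < e" for \<kappa> :: "'a measure" and e :: real
    proof -
      interpret K: finite_measure \<kappa> by fact
      have un: "(\<Union>i<n. a i) \<in> sets \<kappa>" "\<Union>(range a) \<in> sets \<kappa>" for n using ak by auto
      have "(\<lambda>n. measure \<kappa> (\<Union>i<n. a i)) \<longlonglongrightarrow> measure \<kappa> (\<Union>n. \<Union>i<n. a i)"
        using ak by (intro K.finite_Lim_measure_incseq incseq_SucI UN_mono) auto
      also have "(\<Union>n. \<Union>i<n. a i) = \<Union>(range a)" by auto
      finally have "eventually (\<lambda>n. measure \<kappa> (\<Union>(range a)) - e < measure \<kappa> (\<Union>i<n. a i)) sequentially"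
        using e by (intro order_tendstoD(1)) auto
      thus ?thesis
      proof eventually_elim
        case (elim n)
        have "measure \<kappa> (\<Union>(range a) - (\<Union>i<n. a i)) = measure \<kappa> (\<Union>(range a)) - measure \<kappa> (\<Union>i<n. a i)"
          by (rule K.finite_measure_Diff) (use un in auto)
        thus ?case using elim by simp
      qed
    qed
    show ?case
    proof (intro allI impI)
      fix e :: real assume e: "0 < e"
      have "eventually (\<lambda>n. measure \<mu> (\<Union>(range a) - (\<Union>i<n. a i)) < e / 2 \<and> measure \<nu> (\<Union>(range a) - (\<Union>i<n. a i)) < e / 2) sequentially"
        using lim[OF \<mu>(1) am(1), of "e / 2"] lim[OF \<nu>(1) am(2), of "e / 2"] e by (intro eventually_conj) auto
      then obtain n where n: "measure \<mu> (\<Union>(range a) - (\<Union>i<n. a i)) < e / 2" "measure \<nu> (\<Union>(range a) - (\<Union>i<n. a i)) < e / 2"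
        by (auto simp: eventually_sequentially)
      define d where "d = e / (2 * (real n + 1))"
      have d: "0 < d" using e by (simp add: d_def)
      have "\<forall>i. \<exists>C\<in>G. measure \<mu> (sym_diff (a i) C) < d \<and> measure \<nu> (sym_diff (a i) C) < d"
        using Union.IH d by blast
      then obtain C where C: "\<And>i. C i \<in> G" "\<And>i. measure \<mu> (sym_diff (a i) (C i)) < d" "\<And>i. measure \<nu> (sym_diff (a i) (C i)) < d"
        by metis
      have CG: "(\<Union>i<n. C i) \<in> G" using C(1) by (intro G.finite_UN) auto
      have bound: "measure \<kappa> (sym_diff (\<Union>(range a)) (\<Union>i<n. C i)) < e"
        if \<kappa>: "finite_measure \<kappa>" and ak: "\<And>i. a i \<in> sets \<kappa>" and Ck: "\<And>i. C i \<in> sets \<kappa>"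
          and t: "measure \<kappa> (\<Union>(range a) - (\<Union>i<n. a i)) < e / 2" and Cd: "\<And>i. measure \<kappa> (sym_diff (a i) (C i)) < d"
        for \<kappa> :: "'a measure"
      proof -
        interpret K: finite_measure \<kappa> by fact
        let ?S = "\<Union>i<n. sym_diff (a i) (C i)"
        have Sm: "?S \<in> sets \<kappa>" using ak Ck by auto
        have Tm: "\<Union>(range a) - (\<Union>i<n. a i) \<in> sets \<kappa>" using ak by auto
        have "measure \<kappa> (sym_diff (\<Union>(range a)) (\<Union>i<n. C i)) \<le> measure \<kappa> ((\<Union>(range a) - (\<Union>i<n. a i)) \<union> ?S)"
          by (rule K.finite_measure_mono) (use Sm Tm in auto)
        also have "\<dots> \<le> measure \<kappa> (\<Union>(range a) - (\<Union>i<n. a i)) + measure \<kappa> ?S"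
          by (rule measure_Un_le[OF Tm Sm])
        also have "measure \<kappa> ?S \<le> (\<Sum>i<n. measure \<kappa> (sym_diff (a i) (C i)))"
          using ak Ck by (intro K.finite_measure_subadditive_finite) auto
        also have "\<dots> \<le> (\<Sum>i<n. d)" by (intro sum_mono less_imp_le Cd)
        also have "\<dots> \<le> e / 2"
        proof -
          have "real n * d \<le> (real n + 1) * d" using d by (intro mult_right_mono) auto
          also have "\<dots> = e / 2" by (simp add: d_def field_simps)
          finally show ?thesis by simp
        qed
        finally show ?thesis using t by simp
      qed
      have "measure \<mu> (sym_diff (\<Union>(range a)) (\<Union>i<n. C i)) < e" "measure \<nu> (sym_diff (\<Union>(range a)) (\<Union>i<n. C i)) < e"
        by (rule bound[OF \<mu>(1) am(1) Gm(1)[OF C(1)] n(1) C(2)], rule bound[OF \<nu>(1) am(2) Gm(2)[OF C(1)] n(2) C(3)])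
      thus "\<exists>C\<in>G. measure \<mu> (sym_diff (\<Union>(range a)) C) < e \<and> measure \<nu> (sym_diff (\<Union>(range a)) C) < e"
        using CG by blast
    qed
  }
qed

text \<open>Allows a comparison of path laws through finite-dimensional likelihood ratios alone,
  without a density on the path space.\<close>

lemma measure_le_from_algebra:
  assumes alg: "algebra \<Omega> G"
    and \<mu>: "finite_measure \<mu>" "sets \<mu> = sigma_sets \<Omega> G" and \<nu>: "finite_measure \<nu>" "sets \<nu> = sigma_sets \<Omega> G"
    and G: "\<And>C. C \<in> G \<Longrightarrow> measure \<mu> C \<le> measure \<nu> C + \<delta>" and A: "A \<in> sigma_sets \<Omega> G"
  shows "measure \<mu> A \<le> measure \<nu> A + \<delta>"
proof (rule field_le_epsilon)
  fix e :: real assume "0 < e"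
  then obtain C where C: "C \<in> G" "measure \<mu> (sym_diff A C) < e / 2" "measure \<nu> (sym_diff A C) < e / 2"
    using approx_by_algebra[OF alg \<mu> \<nu> A] by (meson half_gt_zero)
  interpret m: finite_measure \<mu> by fact
  interpret n: finite_measure \<nu> by fact
  have Am: "A \<in> sets \<mu>" "A \<in> sets \<nu>" "C \<in> sets \<mu>" "C \<in> sets \<nu>" using A C(1) \<mu> \<nu> by auto
  have "measure \<mu> A \<le> measure \<mu> (C \<union> sym_diff A C)" using Am by (intro m.finite_measure_mono) auto
  also have "\<dots> \<le> measure \<mu> C + measure \<mu> (sym_diff A C)" using Am by (intro measure_Un_le) auto
  also have "measure \<mu> C \<le> measure \<nu> C + \<delta>" by (rule G[OF C(1)])
  also have "measure \<nu> C \<le> measure \<nu> (A \<union> sym_diff A C)" using Am by (intro n.finite_measure_mono) auto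
  also have "\<dots> \<le> measure \<nu> A + measure \<nu> (sym_diff A C)" using Am by (intro measure_Un_le) auto
  finally show "measure \<mu> A \<le> measure \<nu> A + \<delta> + e" using C by simp
qed

lemma path_space_generator:
  obtains G where "algebra (space path_space) G" "sets path_space = sigma_sets (space path_space) G"
    "\<And>C. C \<in> G \<Longrightarrow> \<exists>J B. finite J \<and> J \<subseteq> {0..1} \<and> B \<in> sets (PiM J (\<lambda>_. borel)) \<and> C = prod_emb {0..1} (\<lambda>_. borel) J B"
proof -
  have m: "(\<lambda>\<omega>::real. \<lambda>t\<in>H. \<omega>) \<in> std_normal_distribution \<rightarrow>\<^sub>M PiM H (\<lambda>_. borel :: real measure)" for H :: "real set"
    by (intro measurable_restrict) simp
  \<comment> \<open>Any consistent family serves, here the laws of constant paths with a random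
    value: the locale is entered for its algebra of cylinder sets.\<close>
  define Q where "Q J = distr std_normal_distribution (PiM J (\<lambda>_. borel :: real measure)) (\<lambda>\<omega>. \<lambda>t\<in>J. \<omega>)" for J :: "real set"
  have "projective_family {0..1} Q (\<lambda>_. borel)"
  proof (rule projective_family.intro)
    fix J H :: "real set" assume JH: "J \<subseteq> H"
    show "Q J = distr (Q H) (PiM J (\<lambda>_. borel)) (\<lambda>f. restrict f J)" unfolding Q_def
      by (subst distr_distr[OF measurable_restrict_subset[OF JH] m]) (use JH in \<open>auto intro!: distr_cong simp: restrict_def fun_eq_iff\<close>)
  next
    fix J :: "real set"
    show "prob_space (Q J)" unfolding Q_def by (rule std_normal.prob_space_distr[OF m])
  qed
  then interpret PF: projective_family "{0..1}" Q "\<lambda>_. borel" .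
  show ?thesis
  proof (rule that[of PF.generator])
    show "algebra (space path_space) PF.generator" unfolding path_space_def by (rule PF.algebra_generator)
    show "sets path_space = sigma_sets (space path_space) PF.generator" unfolding path_space_def by (rule PF.sets_PiM_generator)
  qed (auto elim!: PF.generator.cases)
qed

section \<open>Chi-square comparison of shifted Gaussian vectors\<close>

definition likelihood_ratio :: "real \<Rightarrow> real \<Rightarrow> real \<Rightarrow> real \<Rightarrow> real" where
  "likelihood_ratio a b s x = exp (((x - b)\<^sup>2 - (x - a)\<^sup>2) / (2 * s\<^sup>2))"

text \<open>Completing the square in the second identity gives a normal density around the reflected
  mean \<open>2 * a - b\<close>. Its mass \<open>exp ((a - b)\<^sup>2 / s\<^sup>2)\<close> is the
  second moment of the likelihood ratio.\<close>

lemma normal_density_likelihood_ratio: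
  assumes "0 < s"
  shows "normal_density b s x * likelihood_ratio a b s x = normal_density a s x"
    and "normal_density b s x * (likelihood_ratio a b s x)\<^sup>2 = exp ((a - b)\<^sup>2 / s\<^sup>2) * normal_density (2 * a - b) s x"
proof -
  show "normal_density b s x * likelihood_ratio a b s x = normal_density a s x"
    unfolding normal_density_def likelihood_ratio_def using assms by (simp add: mult_exp_exp diff_divide_distrib)
  have e: "- (x - b)\<^sup>2 / (2 * s\<^sup>2) + 2 * (((x - b)\<^sup>2 - (x - a)\<^sup>2) / (2 * s\<^sup>2)) = (a - b)\<^sup>2 / s\<^sup>2 + - (x - (2 * a - b))\<^sup>2 / (2 * s\<^sup>2)"
  proof -
    have num: "- p + 2 * (p - q) = 2 * r - t \<Longrightarrow> - p / (2 * v) + 2 * ((p - q) / (2 * v)) = r / v + - t / (2 * v)"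
      if "0 < v" for p q r t v :: real
    proof -
      assume n: "- p + 2 * (p - q) = 2 * r - t"
      have "- p / (2 * v) + 2 * ((p - q) / (2 * v)) = (- p + 2 * (p - q)) / (2 * v)"
        by (simp only: add_divide_distrib times_divide_eq_right)
      also have "\<dots> = r / v + - t / (2 * v)" unfolding n using that by (simp add: diff_divide_distrib)
      finally show ?thesis .
    qed
    show ?thesis
      by (rule num) (use assms in \<open>simp_all add: power2_eq_square algebra_simps\<close>)
  qed
  have "(likelihood_ratio a b s x)\<^sup>2 = exp (2 * (((x - b)\<^sup>2 - (x - a)\<^sup>2) / (2 * s\<^sup>2)))"
    by (simp only: likelihood_ratio_def exp_double)
  hence "exp (- (x - b)\<^sup>2 / (2 * s\<^sup>2)) * (likelihood_ratio a b s x)\<^sup>2 = exp ((a - b)\<^sup>2 / s\<^sup>2) * exp (- (x - (2 * a - b))\<^sup>2 / (2 * s\<^sup>2))"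
    by (simp only: exp_add[symmetric] e)
  thus "normal_density b s x * (likelihood_ratio a b s x)\<^sup>2 = exp ((a - b)\<^sup>2 / s\<^sup>2) * normal_density (2 * a - b) s x"
    unfolding normal_density_def by (simp add: ac_simps)
qed

text \<open>The difference of the two probabilities is the integral of \<open>L - 1\<close> over
  \<open>G\<close> under the law with means \<open>b\<close>, and the hypothesis bounds the variance
  of \<open>L\<close> by \<open>\<delta>\<^sup>2\<close>.\<close>

lemma product_normal_shift:
  fixes a b s :: "nat \<Rightarrow> real"
  assumes s: "\<And>i. i < n \<Longrightarrow> 0 < s i" and \<delta>: "0 < \<delta>"
    and chi: "exp (\<Sum>i<n. (a i - b i)\<^sup>2 / (s i)\<^sup>2) \<le> 1 + \<delta>\<^sup>2"
    and G: "G \<in> sets (PiM {..<n} (\<lambda>_. borel))"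
  shows "measure (PiM {..<n} (\<lambda>i. density lborel (normal_density (a i) (s i)))) G
    \<le> measure (PiM {..<n} (\<lambda>i. density lborel (normal_density (b i) (s i)))) G + \<delta>"
proof -
  define s' where "s' i = (if i < n then s i else 1)" for i
  have s': "0 < s' i" for i using s by (simp add: s'_def)
  define N where "N m i = density lborel (\<lambda>x. ennreal (normal_density (m i) (s' i) x))" for m :: "nat \<Rightarrow> real" and i
  have Nprob: "prob_space (N m i)" for m i unfolding N_def by (rule prob_space_normal_density[OF s'])
  have NP: "PiM {..<n} (\<lambda>i. density lborel (normal_density (m i) (s i))) = PiM {..<n} (N m)" for m
    by (rule PiM_cong) (auto simp: N_def s'_def)
  interpret PA: product_prob_space "N a" "{..<n}" by (rule product_prob_spaceI) (rule Nprob)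
  interpret PB: product_prob_space "N b" "{..<n}" by (rule product_prob_spaceI) (rule Nprob)
  have sN: "sets (PiM {..<n} (N m)) = sets (PiM {..<n} (\<lambda>_. borel))" for m by (rule sets_PiM_cong) (simp_all add: N_def)
  let ?l = "\<lambda>i. likelihood_ratio (a i) (b i) (s' i)"
  have lm[measurable]: "?l i \<in> borel_measurable borel" for i unfolding likelihood_ratio_def by measurable
  have lm': "?l i \<in> borel_measurable (N b i)" for i by (simp add: N_def)
  have lpos: "0 \<le> ?l i x" for i x by (simp add: likelihood_ratio_def)
  define L where "L x = (\<Prod>i<n. ?l i (x i))" for x :: "nat \<Rightarrow> real"
  have int1: "integrable (N b i) (?l i)" "(\<integral>x. ?l i x \<partial>N b i) = 1" for i
  proof -
    show "integrable (N b i) (?l i)" unfolding N_def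
      by (subst integrable_density) (auto simp: normal_density_likelihood_ratio(1)[OF s'] normal_density_nonneg integrable_normal_density[OF s'])
    show "(\<integral>x. ?l i x \<partial>N b i) = 1" unfolding N_def
      by (subst integral_density) (auto simp: normal_density_likelihood_ratio(1)[OF s'] normal_density_nonneg integral_normal_density[OF s'])
  qed
  have int2: "integrable (N b i) (\<lambda>x. (?l i x)\<^sup>2)" "(\<integral>x. (?l i x)\<^sup>2 \<partial>N b i) = exp ((a i - b i)\<^sup>2 / (s' i)\<^sup>2)" for i
  proof -
    show "integrable (N b i) (\<lambda>x. (?l i x)\<^sup>2)" unfolding N_def
      by (subst integrable_density) (auto simp: normal_density_likelihood_ratio(2)[OF s'] normal_density_nonneg integrable_normal_density[OF s'])
    show "(\<integral>x. (?l i x)\<^sup>2 \<partial>N b i) = exp ((a i - b i)\<^sup>2 / (s' i)\<^sup>2)" unfolding N_def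
      by (subst integral_density) (auto simp: normal_density_likelihood_ratio(2)[OF s'] normal_density_nonneg integral_normal_density[OF s'])
  qed
  have L1: "integrable (PiM {..<n} (N b)) L" unfolding L_def
    by (rule PB.product_integrable_prod) (auto intro: int1)
  have L1v: "(\<integral>x. L x \<partial>PiM {..<n} (N b)) = 1" unfolding L_def
    by (subst PB.product_integral_prod) (auto simp: int1)
  have L2: "integrable (PiM {..<n} (N b)) (\<lambda>x. (L x)\<^sup>2)" unfolding L_def prod_power_distrib
    by (rule PB.product_integrable_prod) (auto intro: int2)
  have "(\<integral>x. (L x)\<^sup>2 \<partial>PiM {..<n} (N b)) = (\<Prod>i<n. exp ((a i - b i)\<^sup>2 / (s' i)\<^sup>2))" unfolding L_def prod_power_distrib
    by (subst PB.product_integral_prod) (auto simp: int2)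
  also have "\<dots> = exp (\<Sum>i<n. (a i - b i)\<^sup>2 / (s i)\<^sup>2)" by (simp add: exp_sum s'_def)
  finally have L2v: "(\<integral>x. (L x)\<^sup>2 \<partial>PiM {..<n} (N b)) \<le> 1 + \<delta>\<^sup>2" using chi by simp
  have Lm: "L \<in> borel_measurable (PiM {..<n} (N b))" using L1 by auto
  have dens: "density (PiM {..<n} (N b)) (\<lambda>x. ennreal (L x)) = PiM {..<n} (N a)"
  proof (rule PA.PiM_eqI)
    show "sets (density (PiM {..<n} (N b)) (\<lambda>x. ennreal (L x))) = sets (PiM {..<n} (N a))" by (simp add: sN)
    fix A assume A: "\<And>i. i \<in> {..<n} \<Longrightarrow> A i \<in> sets (N a i)"
    have Ab: "A i \<in> sets borel" if "i < n" for i using A[of i] that by (simp add: N_def)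
    have PE: "Pi\<^sub>E {..<n} A \<in> sets (PiM {..<n} (N b))" unfolding sN using Ab by (intro sets_PiM_I_finite) auto
    have "emeasure (density (PiM {..<n} (N b)) (\<lambda>x. ennreal (L x))) (Pi\<^sub>E {..<n} A)
      = (\<integral>\<^sup>+x. ennreal (L x) * indicator (Pi\<^sub>E {..<n} A) x \<partial>PiM {..<n} (N b))"
      by (rule emeasure_density) (use Lm PE in auto)
    also have "\<dots> = (\<integral>\<^sup>+x. (\<Prod>i<n. ennreal (?l i (x i)) * indicator (A i) (x i)) \<partial>PiM {..<n} (N b))"
    proof (rule nn_integral_cong)
      fix x assume x: "x \<in> space (PiM {..<n} (N b))"
      have "(indicator (Pi\<^sub>E {..<n} A) x :: ennreal) = (\<Prod>i<n. indicator (A i) (x i))"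
        using x by (auto simp: indicator_def space_PiM PiE_iff prod_eq_1_iff prod_zero_iff)
      thus "ennreal (L x) * indicator (Pi\<^sub>E {..<n} A) x = (\<Prod>i<n. ennreal (?l i (x i)) * indicator (A i) (x i))"
        by (simp add: L_def prod.distrib prod_ennreal[symmetric] lpos)
    qed
    also have "\<dots> = (\<Prod>i<n. \<integral>\<^sup>+x. ennreal (?l i x) * indicator (A i) x \<partial>N b i)"
      by (rule PB.product_nn_integral_prod) (use Ab in \<open>auto simp: N_def\<close>)
    also have "\<dots> = (\<Prod>i<n. emeasure (N a i) (A i))"
    proof (intro prod.cong refl)
      fix i assume "i \<in> {..<n}"
      hence [measurable]: "A i \<in> sets borel" using Ab by simp
      have "(\<integral>\<^sup>+x. ennreal (?l i x) * indicator (A i) x \<partial>N b i)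
         = (\<integral>\<^sup>+x. ennreal (normal_density (b i) (s' i) x) * (ennreal (?l i x) * indicator (A i) x) \<partial>lborel)"
        unfolding N_def by (rule nn_integral_density) measurable
      also have "\<dots> = (\<integral>\<^sup>+x. ennreal (normal_density (a i) (s' i) x) * indicator (A i) x \<partial>lborel)"
      proof (rule nn_integral_cong)
        fix x
        have "ennreal (normal_density (a i) (s' i) x) = ennreal (normal_density (b i) (s' i) x) * ennreal (?l i x)"
          unfolding normal_density_likelihood_ratio(1)[OF s'[of i], where a="a i" and b="b i" and x=x, symmetric] by (rule ennreal_mult') simp
        thus "ennreal (normal_density (b i) (s' i) x) * (ennreal (?l i x) * indicator (A i) x) = ennreal (normal_density (a i) (s' i) x) * indicator (A i) x"
          by (simp only: mult.assoc)
      qed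
      also have "\<dots> = emeasure (N a i) (A i)" unfolding N_def by (rule emeasure_density[symmetric]) measurable
      finally show "(\<integral>\<^sup>+x. ennreal (?l i x) * indicator (A i) x \<partial>N b i) = emeasure (N a i) (A i)" .
    qed
    finally show "emeasure (density (PiM {..<n} (N b)) (\<lambda>x. ennreal (L x))) (Pi\<^sub>E {..<n} A) = (\<Prod>i\<in>{..<n}. emeasure (N a i) (A i))" .
  qed simp
  have Gb: "G \<in> sets (PiM {..<n} (N b))" using G by (simp add: sN)
  have Lnn: "0 \<le> L x" for x unfolding L_def by (rule prod_nonneg) (simp add: lpos)
  have iG: "integrable (PiM {..<n} (N b)) (\<lambda>x. indicator G x * L x)"
    using integrable_mult_indicator[OF Gb L1] by simp
  have "emeasure (PiM {..<n} (N a)) G = (\<integral>\<^sup>+x. ennreal (L x) * indicator G x \<partial>PiM {..<n} (N b))"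
    unfolding dens[symmetric] by (rule emeasure_density) (use Lm Gb in auto)
  also have "\<dots> = (\<integral>\<^sup>+x. ennreal (indicator G x * L x) \<partial>PiM {..<n} (N b))"
    by (rule nn_integral_cong) (simp add: indicator_def)
  also have "\<dots> = ennreal (\<integral>x. indicator G x * L x \<partial>PiM {..<n} (N b))"
    by (rule nn_integral_eq_integral[OF iG]) (simp add: Lnn)
  finally have "measure (PiM {..<n} (N a)) G = (\<integral>x. indicator G x * L x \<partial>PiM {..<n} (N b))"
    by (simp add: measure_def Lnn)
  \<comment> \<open>A pointwise replacement for Cauchy-Schwarz:
    \<open>L - 1 \<le> ((L - 1)\<^sup>2 / \<delta> + \<delta>) / 2\<close>. The right-hand side is
    nonnegative, so it may also be added outside \<open>G\<close>, and its integral is at most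
    \<delta>.\<close>
  also have "\<dots> \<le> (\<integral>x. indicator G x + (((L x)\<^sup>2 - 2 * L x + 1) / \<delta> + \<delta>) / 2 \<partial>PiM {..<n} (N b))"
  proof (rule integral_mono[OF iG])
    show "integrable (PiM {..<n} (N b)) (\<lambda>x. indicator G x + (((L x)\<^sup>2 - 2 * L x + 1) / \<delta> + \<delta>) / 2)"
      using L1 L2 Gb by (intro Bochner_Integration.integrable_add integrable_divide Bochner_Integration.integrable_diff integrable_mult_right integrable_real_indicator)
        (auto simp: PB.P.emeasure_eq_measure)
    fix x
    have "0 \<le> ((L x - 1) - \<delta>)\<^sup>2" by simp
    hence "2 * \<delta> * (L x - 1) \<le> (L x)\<^sup>2 - 2 * L x + 1 + \<delta> * \<delta>" by (simp add: power2_eq_square algebra_simps)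
    hence k: "L x - 1 \<le> (((L x)\<^sup>2 - 2 * L x + 1) / \<delta> + \<delta>) / 2" using \<delta> by (simp add: field_simps)
    have "0 \<le> ((L x)\<^sup>2 - 2 * L x + 1) / \<delta>" using \<delta> zero_le_power2[of "L x - 1"] by (simp add: power2_diff)
    hence nn: "0 \<le> (((L x)\<^sup>2 - 2 * L x + 1) / \<delta> + \<delta>) / 2" using \<delta> by simp
    show "indicator G x * L x \<le> indicator G x + (((L x)\<^sup>2 - 2 * L x + 1) / \<delta> + \<delta>) / 2"
    proof (cases "x \<in> G")
      case True
      hence i: "indicator G x = (1::real)" by simp
      show ?thesis unfolding i using k by linarith
    next
      case False
      hence i: "indicator G x = (0::real)" by simp
      show ?thesis unfolding i using nn by linarith
    qed
  qed
  also have "\<dots> = measure (PiM {..<n} (N b)) G + (((\<integral>x. (L x)\<^sup>2 \<partial>PiM {..<n} (N b)) - 2 * 1 + 1) / \<delta> + \<delta>) / 2"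
    using L1 L2 Gb L1v PB.P.prob_space sets.sets_into_space[OF Gb] by (simp add: PB.P.emeasure_eq_measure Int_absorb1 Int_absorb2)
  also have "\<dots> \<le> measure (PiM {..<n} (N b)) G + \<delta>"
  proof -
    have "((\<integral>x. (L x)\<^sup>2 \<partial>PiM {..<n} (N b)) - 2 * 1 + 1) / \<delta> \<le> \<delta>\<^sup>2 / \<delta>" using L2v \<delta> by (intro divide_right_mono) auto
    thus ?thesis using \<delta> by (simp add: power2_eq_square)
  qed
  finally show ?thesis unfolding NP .
qed

text \<open>Cauchy-Schwarz in the form of a nonnegative variance: the square of \<open>h\<close>
  minus its mean \<open>c\<close> is integrated.\<close>

lemma set_integral_square_le:
  fixes h :: "real \<Rightarrow> real"
  assumes h: "set_integrable lborel {a..b} h" and h2: "set_integrable lborel {a..b} (\<lambda>t. (h t)\<^sup>2)" and ab: "a < b"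
  shows "(LBINT t:{a..b}. h t)\<^sup>2 / (b - a) \<le> (LBINT t:{a..b}. (h t)\<^sup>2)"
proof -
  define c where "c = (LBINT t:{a..b}. h t) / (b - a)"
  have ch: "set_integrable lborel {a..b} (\<lambda>t. (2 * c) * h t)" using h by (rule set_integrable_mult_right)
  have cc: "set_integrable lborel {a..b} (\<lambda>_. c\<^sup>2)"
    unfolding set_integrable_def by (intro integrable_scaleR_left integrable_real_indicator) (use ab in auto)
  have "0 \<le> (LBINT t:{a..b}. (h t - c)\<^sup>2)"
    unfolding set_lebesgue_integral_def by (intro Bochner_Integration.integral_nonneg) simp
  also have "(LBINT t:{a..b}. (h t - c)\<^sup>2) = (LBINT t:{a..b}. (h t)\<^sup>2 - (2 * c) * h t + c\<^sup>2)"
    by (intro set_lebesgue_integral_cong) (auto simp: power2_diff)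
  also have "\<dots> = (LBINT t:{a..b}. (h t)\<^sup>2) - (2 * c) * (LBINT t:{a..b}. h t) + (b - a) * c\<^sup>2"
    using set_integral_add(2)[OF set_integral_diff(1)[OF h2 ch] cc] set_integral_diff(2)[OF h2 ch] ab
    by (simp add: set_lebesgue_integral_def[of _ _ "\<lambda>_. c\<^sup>2"])
  also have "(2 * c) * (LBINT t:{a..b}. h t) = 2 * ((b - a) * c\<^sup>2)"
    using ab by (simp add: c_def power2_eq_square)
  finally have "(b - a) * c\<^sup>2 \<le> (LBINT t:{a..b}. (h t)\<^sup>2)" by simp
  moreover have "(b - a) * c\<^sup>2 = (LBINT t:{a..b}. h t)\<^sup>2 / (b - a)"
    using ab by (simp add: c_def power2_eq_square)
  ultimately show ?thesis by simp
qed

text \<open>Averaging over the cells of a partition can only lose energy. The resulting bound does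
  not depend on the partition and thus holds for all cylinder sets at once.\<close>

lemma sum_increments_square_le:
  fixes h :: "real \<Rightarrow> real" and \<tau> :: "nat \<Rightarrow> real"
  assumes h: "set_integrable lborel {0..1} h" and h2: "set_integrable lborel {0..1} (\<lambda>t. (h t)\<^sup>2)"
    and \<tau>: "strict_mono_on {..n} \<tau>" "\<tau> ` {..n} \<subseteq> {0..1}"
  shows "(\<Sum>i<n. (LBINT t:{\<tau> i..\<tau> (Suc i)}. h t)\<^sup>2 / (\<tau> (Suc i) - \<tau> i)) \<le> (LBINT t:{0..1}. (h t)\<^sup>2)"
proof -
  have mem: "0 \<le> \<tau> i \<and> \<tau> i \<le> 1" if "i \<le> n" for i using \<tau>(2) that by auto
  have step: "\<tau> i < \<tau> (Suc i)" if "i < n" for i using \<tau>(1) that by (auto simp: strict_mono_on_def)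
  let ?H = "\<lambda>b. LBINT t:{0..b}. (h t)\<^sup>2"
  have nn: "0 \<le> (LBINT t:{a..b}. (h t)\<^sup>2)" for a b
    unfolding set_lebesgue_integral_def by (intro Bochner_Integration.integral_nonneg) simp
  have "(\<Sum>i<n. (LBINT t:{\<tau> i..\<tau> (Suc i)}. h t)\<^sup>2 / (\<tau> (Suc i) - \<tau> i)) \<le> (\<Sum>i<n. LBINT t:{\<tau> i..\<tau> (Suc i)}. (h t)\<^sup>2)"
  proof (rule sum_mono)
    fix i assume "i \<in> {..<n}"
    hence i: "i < n" by simp
    show "(LBINT t:{\<tau> i..\<tau> (Suc i)}. h t)\<^sup>2 / (\<tau> (Suc i) - \<tau> i) \<le> (LBINT t:{\<tau> i..\<tau> (Suc i)}. (h t)\<^sup>2)"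
      by (rule set_integral_square_le[OF set_integrable_subset[OF h] set_integrable_subset[OF h2] step[OF i]])
        (use mem[of i] mem[of "Suc i"] i in auto)
  qed
  also have "\<dots> = (\<Sum>i<n. ?H (\<tau> (Suc i)) - ?H (\<tau> i))"
  proof (intro sum.cong refl)
    fix i assume "i \<in> {..<n}"
    thus "(LBINT t:{\<tau> i..\<tau> (Suc i)}. (h t)\<^sup>2) = ?H (\<tau> (Suc i)) - ?H (\<tau> i)"
      using mem[of i] mem[of "Suc i"] step[of i] by (intro set_integral_Icc_diff[OF h2, symmetric]) auto
  qed
  also have "\<dots> = ?H (\<tau> n) - ?H (\<tau> 0)" by (rule sum_lessThan_telescope)
  also have "\<dots> \<le> ?H 1" using set_integral_Icc_diff[OF h2, of "\<tau> n" 1] nn[of "\<tau> n" 1] nn[of 0 "\<tau> 0"] mem[of n] by simp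
  finally show ?thesis .
qed

section \<open>Laws of the observed path under two drifts\<close>

context brownian_motion
begin

lemma drift_increments_vector:
  fixes D :: "real \<Rightarrow> real"
  assumes \<epsilon>: "0 < \<epsilon>" and \<tau>: "0 < n" "strict_mono_on {..n} \<tau>" "\<tau> ` {..n} \<subseteq> {0..1}"
  shows "distr M (PiM {..<n} (\<lambda>_. borel)) (\<lambda>\<omega>. \<lambda>i\<in>{..<n}. D (\<tau> (Suc i)) - D (\<tau> i) + \<epsilon> * (W (\<tau> (Suc i)) \<omega> - W (\<tau> i) \<omega>))
     = PiM {..<n} (\<lambda>i. density lborel (normal_density (D (\<tau> (Suc i)) - D (\<tau> i)) (\<epsilon> * sqrt (\<tau> (Suc i) - \<tau> i))))"
proof -
  have mem: "0 \<le> \<tau> i \<and> \<tau> i \<le> 1" if "i \<le> n" for i using \<tau>(3) that by auto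
  have step: "\<tau> i < \<tau> (Suc i)" if "i < n" for i using \<tau>(2) that by (auto simp: strict_mono_on_def)
  let ?X = "\<lambda>i \<omega>. D (\<tau> (Suc i)) - D (\<tau> i) + \<epsilon> * (W (\<tau> (Suc i)) \<omega> - W (\<tau> i) \<omega>)"
  have ind: "indep_vars (\<lambda>_. borel) ?X {..<n}"
    by (rule indep_vars_compose2[OF indep_increments[OF \<tau>(2,3)]]) measurable
  have rv: "random_variable borel (?X i)" if "i \<in> {..<n}" for i
    using ind that by (auto simp: indep_vars_def2)
  have "distr M (PiM {..<n} (\<lambda>_. borel)) (\<lambda>\<omega>. \<lambda>i\<in>{..<n}. ?X i \<omega>) = PiM {..<n} (\<lambda>i. distr M borel (?X i))"
    by (rule iffD1[OF indep_vars_iff_distr_eq_PiM' ind]) (use \<tau>(1) rv in auto)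
  also have "\<dots> = PiM {..<n} (\<lambda>i. density lborel (normal_density (D (\<tau> (Suc i)) - D (\<tau> i)) (\<epsilon> * sqrt (\<tau> (Suc i) - \<tau> i))))"
  proof (intro PiM_cong refl)
    fix i assume "i \<in> {..<n}"
    hence i: "i < n" by simp
    have "distributed M lborel (\<lambda>\<omega>. W (\<tau> (Suc i)) \<omega> - W (\<tau> i) \<omega>) (normal_density 0 (sqrt (\<tau> (Suc i) - \<tau> i)))"
      using normal_increments[OF _ step[OF i]] mem[of i] mem[of "Suc i"] i by simp
    from normal_density_affine[OF this, of \<epsilon> "D (\<tau> (Suc i)) - D (\<tau> i)"] step[OF i] \<epsilon>
    have "distr M lborel (?X i) = density lborel (normal_density (D (\<tau> (Suc i)) - D (\<tau> i)) (\<epsilon> * sqrt (\<tau> (Suc i) - \<tau> i)))"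
      by (simp add: distributed_def)
    moreover have "distr M borel (?X i) = distr M lborel (?X i)" by (rule distr_cong) simp_all
    ultimately show "distr M borel (?X i) = density lborel (normal_density (D (\<tau> (Suc i)) - D (\<tau> i)) (\<epsilon> * sqrt (\<tau> (Suc i) - \<tau> i)))"
      by simp
  qed
  finally show ?thesis .
qed

lemma measurable_obs: "t \<in> {0..1} \<Longrightarrow> obs W \<epsilon> h t \<in> borel_measurable M"
  unfolding obs_def[abs_def] using measurable_at[of t] by measurable

text \<open>A cylinder set is, up to the null event that the Brownian path does not start at zero,
  an event on an increment vector; there the chi-square bound applies with an exponent controlled by
  the norm of \<open>f - g\<close>.\<close>

lemma obs_law_le:
  assumes \<epsilon>: "0 < \<epsilon>" and \<delta>: "0 < \<delta>"
    and fi: "set_integrable lborel {0..1} f" and gi: "set_integrable lborel {0..1} g"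
    and sq: "set_integrable lborel {0..1} (\<lambda>t. (f t - g t)\<^sup>2)"
    and chi: "exp ((LBINT t:{0..1}. (f t - g t)\<^sup>2) / \<epsilon>\<^sup>2) \<le> 1 + \<delta>\<^sup>2"
    and A: "A \<in> sets path_space"
  shows "measure (distr M path_space (path_of (obs W \<epsilon> f))) A \<le> measure (distr M path_space (path_of (obs W \<epsilon> g))) A + \<delta>"
proof -
  define L where "L h = distr M path_space (path_of (obs W \<epsilon> h))" for h
  have pm: "path_of (obs W \<epsilon> h) \<in> M \<rightarrow>\<^sub>M path_space" for h by (intro measurable_path_of measurable_obs)
  have fin: "finite_measure (L h)" for h
    unfolding L_def by (rule prob_space.finite_measure[OF prob_space_distr[OF pm]])
  obtain G where G: "algebra (space path_space) G" "sets path_space = sigma_sets (space path_space) G"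
    "\<And>C. C \<in> G \<Longrightarrow> \<exists>J B. finite J \<and> J \<subseteq> {0..1} \<and> B \<in> sets (PiM J (\<lambda>_. borel)) \<and> C = prod_emb {0..1} (\<lambda>_. borel) J B"
    by (rule path_space_generator; rule that; assumption)
  have "measure (L f) C \<le> measure (L g) C + \<delta>" if C: "C \<in> G" for C
  proof -
    obtain J B where J: "finite J" "J \<subseteq> {0..1}" and B: "B \<in> sets (PiM J (\<lambda>_. borel))"
      and CJ: "C = prod_emb {0..1} (\<lambda>_. borel) J B" using G(3)[OF C] by blast
    obtain n \<tau> where \<tau>: "0 < (n::nat)" "strict_mono_on {..n} \<tau>" "\<tau> ` {..n} \<subseteq> {0..1}" "\<tau> 0 = 0" "J \<subseteq> \<tau> ` {..n}"
      by (rule times_enumeration[OF J])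
    have mem: "0 \<le> \<tau> i \<and> \<tau> i \<le> 1" if "i \<le> n" for i using \<tau>(3) that by auto
    have step: "\<tau> i < \<tau> (Suc i)" if "i < n" for i using \<tau>(2) that by (auto simp: strict_mono_on_def)
    define p where "p t = (SOME i. i \<le> n \<and> \<tau> i = t)" for t
    have p: "p t \<le> n" "\<tau> (p t) = t" if "t \<in> J" for t
    proof -
      have "\<exists>i. i \<le> n \<and> \<tau> i = t" using \<tau>(5) that by auto
      from someI_ex[OF this] show "p t \<le> n" "\<tau> (p t) = t" unfolding p_def by auto
    qed
    let ?P = "PiM {..<n} (\<lambda>_. borel) :: (nat \<Rightarrow> real) measure"
    define D where "D h b = (LBINT t:{0..b}. h t)" for h :: "real \<Rightarrow> real" and b
    define V where "V h \<omega> = (\<lambda>i\<in>{..<n}. D h (\<tau> (Suc i)) - D h (\<tau> i) + \<epsilon> * (W (\<tau> (Suc i)) \<omega> - W (\<tau> i) \<omega>))" for h \<omega>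
    \<comment> \<open>Partial sums recover the path at the times in \<open>J\<close> from its
      increments.\<close>
    define \<Phi> where "\<Phi> v = (\<lambda>t\<in>J. \<Sum>i<p t. v i)" for v :: "nat \<Rightarrow> real"
    define E where "E = \<Phi> -` B \<inter> space ?P"
    have "\<Phi> \<in> ?P \<rightarrow>\<^sub>M PiM J (\<lambda>_. borel)" unfolding \<Phi>_def
    proof (intro measurable_restrict borel_measurable_sum measurable_component_singleton)
      fix t i assume "t \<in> J" "i \<in> {..<p t}"
      thus "i \<in> {..<n}" using p(1)[of t] by simp
    qed
    hence E: "E \<in> sets ?P" unfolding E_def using B by (rule measurable_sets)
    have Vm: "V h \<in> M \<rightarrow>\<^sub>M ?P" for h
      unfolding V_def using mem by (intro measurable_restrict borel_measurable_add borel_measurable_const borel_measurable_times borel_measurable_diff measurable_at) auto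
    have LC: "measure (L h) C = measure (distr M ?P (V h)) E" for h
    proof -
      have Cs: "C \<in> sets path_space" unfolding G(2) using C by (rule sigma_sets.Basic)
      have "measure (L h) C = prob (path_of (obs W \<epsilon> h) -` C \<inter> space M)"
        unfolding L_def by (rule measure_distr[OF pm Cs])
      also have "\<dots> = prob (V h -` E \<inter> space M)"
      proof (rule finite_measure_eq_AE)
        show "AE \<omega> in M. (\<omega> \<in> path_of (obs W \<epsilon> h) -` C \<inter> space M) = (\<omega> \<in> V h -` E \<inter> space M)"
          using starts_at_0
        proof eventually_elim
          case (elim \<omega>)
          have D0: "D h 0 = 0"
            using set_integral_discrete_difference[of "{0}" "{0::real}" "{}" lborel h]
            by (simp add: D_def set_lebesgue_integral_def[of _ "{}"])
          have "\<Phi> (V h \<omega>) = restrict (path_of (obs W \<epsilon> h) \<omega>) J"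
          proof (rule ext)
            fix t
            show "\<Phi> (V h \<omega>) t = restrict (path_of (obs W \<epsilon> h) \<omega>) J t"
            proof (cases "t \<in> J")
              case t: True
              let ?o = "\<lambda>i. D h (\<tau> i) + \<epsilon> * W (\<tau> i) \<omega>"
              have "\<Phi> (V h \<omega>) t = (\<Sum>i<p t. V h \<omega> i)" using t by (simp add: \<Phi>_def)
              also have "\<dots> = (\<Sum>i<p t. ?o (Suc i) - ?o i)"
                using p(1)[OF t] by (intro sum.cong) (auto simp: V_def algebra_simps)
              also have "\<dots> = D h t + \<epsilon> * W t \<omega>"
                using sum_lessThan_telescope[of ?o "p t"] p(2)[OF t] \<tau>(4) elim D0 by simp
              finally show ?thesis using t J(2) by (simp add: path_of_def obs_def D_def subset_eq)
            qed (simp add: \<Phi>_def)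
          qed
          moreover have "path_of (obs W \<epsilon> h) \<omega> \<in> C \<longleftrightarrow> restrict (path_of (obs W \<epsilon> h) \<omega>) J \<in> B"
            unfolding CJ prod_emb_def by (auto simp: path_of_def)
          moreover have "V h \<omega> \<in> space ?P" by (simp add: V_def space_PiM)
          ultimately show ?case by (simp add: E_def)
        qed
        show "path_of (obs W \<epsilon> h) -` C \<inter> space M \<in> sets M" by (rule measurable_sets[OF pm Cs])
        show "V h -` E \<inter> space M \<in> sets M" by (rule measurable_sets[OF Vm E])
      qed
      also have "\<dots> = measure (distr M ?P (V h)) E" by (rule measure_distr[OF Vm E, symmetric])
      finally show ?thesis .
    qed
    have Dfg: "(D f (\<tau> (Suc i)) - D f (\<tau> i)) - (D g (\<tau> (Suc i)) - D g (\<tau> i)) = (LBINT t:{\<tau> i..\<tau> (Suc i)}. f t - g t)"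
      if i: "i < n" for i
    proof -
      have m: "0 \<le> \<tau> i" "\<tau> i \<le> \<tau> (Suc i)" "\<tau> (Suc i) \<le> 1" using mem[of i] mem[of "Suc i"] step[OF i] i by auto
      have s: "{\<tau> i..\<tau> (Suc i)} \<subseteq> {0..1}" using m by auto
      show ?thesis unfolding D_def set_integral_Icc_diff[OF fi m] set_integral_Icc_diff[OF gi m]
        by (rule set_integral_diff(2)[symmetric]) (rule set_integrable_subset[OF fi _ s] set_integrable_subset[OF gi _ s], simp)+
    qed
    have "(\<Sum>i<n. ((D f (\<tau> (Suc i)) - D f (\<tau> i)) - (D g (\<tau> (Suc i)) - D g (\<tau> i)))\<^sup>2 / (\<epsilon> * sqrt (\<tau> (Suc i) - \<tau> i))\<^sup>2)
       = (\<Sum>i<n. (LBINT t:{\<tau> i..\<tau> (Suc i)}. f t - g t)\<^sup>2 / (\<tau> (Suc i) - \<tau> i)) / \<epsilon>\<^sup>2"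
      unfolding sum_divide_distrib
    proof (intro sum.cong refl)
      fix i assume "i \<in> {..<n}"
      hence i: "i < n" by simp
      show "((D f (\<tau> (Suc i)) - D f (\<tau> i)) - (D g (\<tau> (Suc i)) - D g (\<tau> i)))\<^sup>2 / (\<epsilon> * sqrt (\<tau> (Suc i) - \<tau> i))\<^sup>2
        = (LBINT t:{\<tau> i..\<tau> (Suc i)}. f t - g t)\<^sup>2 / (\<tau> (Suc i) - \<tau> i) / \<epsilon>\<^sup>2"
        unfolding Dfg[OF i] using step[OF i] by (simp add: power_mult_distrib mult.commute)
    qed
    also have "\<dots> \<le> (LBINT t:{0..1}. (f t - g t)\<^sup>2) / \<epsilon>\<^sup>2"
      by (intro divide_right_mono sum_increments_square_le[OF set_integral_diff(1)[OF fi gi] sq \<tau>(2,3)]) simp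
    finally have "exp (\<Sum>i<n. ((D f (\<tau> (Suc i)) - D f (\<tau> i)) - (D g (\<tau> (Suc i)) - D g (\<tau> i)))\<^sup>2 / (\<epsilon> * sqrt (\<tau> (Suc i) - \<tau> i))\<^sup>2) \<le> 1 + \<delta>\<^sup>2"
      using chi by (meson exp_le_cancel_iff order_trans)
    from product_normal_shift[OF _ \<delta> this E] step \<epsilon>
    have "measure (distr M ?P (V f)) E \<le> measure (distr M ?P (V g)) E + \<delta>"
      unfolding V_def drift_increments_vector[OF \<epsilon> \<tau>(1,2,3)] by simp
    thus ?thesis unfolding LC .
  qed
  from measure_le_from_algebra[OF G(1) fin _ fin _ this] A show ?thesis
    unfolding L_def by (simp add: G(2))
qed

lemma prob_space_expt_law: "prob_space (expt_law M W \<epsilon> h)"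
proof -
  interpret L: prob_space "distr M path_space (path_of (obs W \<epsilon> h))"
    by (intro prob_space_distr measurable_path_of measurable_obs)
  interpret U: prob_space "uniform_measure lborel {0..1::real}" by (rule prob_space_uniform_measure) auto
  interpret P: pair_prob_space "distr M path_space (path_of (obs W \<epsilon> h))" "uniform_measure lborel {0..1::real}" ..
  show ?thesis unfolding expt_law_def by (rule P.prob_space_axioms)
qed

lemma sets_expt_law: "sets (expt_law M W \<epsilon> h) = sets (path_space \<Otimes>\<^sub>M borel)"
  unfolding expt_law_def by (rule sets_pair_measure_cong) simp_all

text \<open>The auxiliary variable has the same law under both drifts, so the path bound is applied
  to every section and then averaged.\<close>

lemma expt_law_le:
  assumes "0 < \<epsilon>" and \<delta>: "0 < \<delta>"
    and "set_integrable lborel {0..1} f" and "set_integrable lborel {0..1} g"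
    and "set_integrable lborel {0..1} (\<lambda>t. (f t - g t)\<^sup>2)"
    and "exp ((LBINT t:{0..1}. (f t - g t)\<^sup>2) / \<epsilon>\<^sup>2) \<le> 1 + \<delta>\<^sup>2"
    and A: "A \<in> sets (path_space \<Otimes>\<^sub>M borel)"
  shows "measure (expt_law M W \<epsilon> f) A \<le> measure (expt_law M W \<epsilon> g) A + \<delta>"
proof -
  define L where "L h = distr M path_space (path_of (obs W \<epsilon> h))" for h
  let ?U = "uniform_measure lborel {0..1::real}"
  have prob: "prob_space (L h)" for h
    unfolding L_def by (intro prob_space_distr measurable_path_of measurable_obs)
  interpret U: prob_space ?U by (rule prob_space_uniform_measure) auto
  have sf: "pair_sigma_finite (L h) ?U" for h
    using prob[of h] U.sigma_finite_measure_axioms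
    by (auto intro!: pair_sigma_finite.intro prob_space_imp_sigma_finite)
  have A': "A \<in> sets (L h \<Otimes>\<^sub>M ?U)" for h
    using A sets_expt_law[of \<epsilon> h] by (simp add: expt_law_def L_def)
  have sec: "(\<lambda>x. (x, y)) -` A \<in> sets path_space" for y
    using sets_Pair2[OF A] .
  have "emeasure (L f \<Otimes>\<^sub>M ?U) A = (\<integral>\<^sup>+y. emeasure (L f) ((\<lambda>x. (x, y)) -` A) \<partial>?U)"
    by (rule pair_sigma_finite.emeasure_pair_measure_alt2[OF sf A'])
  also have "\<dots> \<le> (\<integral>\<^sup>+y. emeasure (L g) ((\<lambda>x. (x, y)) -` A) + ennreal \<delta> \<partial>?U)"
  proof (rule nn_integral_mono)
    fix y
    have "measure (L f) ((\<lambda>x. (x, y)) -` A) \<le> measure (L g) ((\<lambda>x. (x, y)) -` A) + \<delta>"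
      unfolding L_def by (rule obs_law_le[OF assms(1-6) sec])
    hence "ennreal (measure (L f) ((\<lambda>x. (x, y)) -` A)) \<le> ennreal (measure (L g) ((\<lambda>x. (x, y)) -` A)) + ennreal \<delta>"
      using \<delta> by (simp flip: ennreal_plus)
    thus "emeasure (L f) ((\<lambda>x. (x, y)) -` A) \<le> emeasure (L g) ((\<lambda>x. (x, y)) -` A) + ennreal \<delta>"
      by (simp add: finite_measure.emeasure_eq_measure[OF prob_space.finite_measure[OF prob]])
  qed
  also have "\<dots> = (\<integral>\<^sup>+y. emeasure (L g) ((\<lambda>x. (x, y)) -` A) \<partial>?U) + ennreal \<delta>"
    using pair_sigma_finite.measurable_emeasure_Pair2[OF sf A', of g]
    by (subst nn_integral_add) (simp_all add: U.emeasure_space_1)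
  also have "(\<integral>\<^sup>+y. emeasure (L g) ((\<lambda>x. (x, y)) -` A) \<partial>?U) = emeasure (L g \<Otimes>\<^sub>M ?U) A"
    by (rule pair_sigma_finite.emeasure_pair_measure_alt2[OF sf A', symmetric])
  finally have e: "emeasure (expt_law M W \<epsilon> f) A \<le> emeasure (expt_law M W \<epsilon> g) A + ennreal \<delta>"
    by (simp add: expt_law_def L_def)
  have em: "emeasure (expt_law M W \<epsilon> h) A = ennreal (measure (expt_law M W \<epsilon> h) A)" for h
    by (rule finite_measure.emeasure_eq_measure[OF prob_space.finite_measure[OF prob_space_expt_law]])
  show ?thesis using e \<delta> unfolding em by (simp flip: ennreal_plus)
qed

end

section \<open>The two-point lower bound\<close>

context convex_min
begin

lemma two_point:
  assumes \<epsilon>: "0 < \<epsilon>"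
  shows "\<exists>g\<in>conv_class. \<exists>\<eta>. rho_m \<epsilon> f / 24 \<le> \<eta> \<and> minimum g = m0 + \<eta> \<and>
    set_integrable lborel {0..1} (\<lambda>t. (f t - g t)\<^sup>2) \<and> (LBINT t:{0..1}. (f t - g t)\<^sup>2) \<le> \<epsilon>\<^sup>2 / 36"
proof -
  obtain u where u: "rho_m \<epsilon> f / 2 \<le> u - m0" "L2_norm (gap u) \<le> \<epsilon>" by (rule rho_attained[OF \<epsilon>])
  define \<eta> where "\<eta> = (u - m0) / 12"
  have \<eta>: "rho_m \<epsilon> f / 24 \<le> \<eta>" "0 < \<eta>" "u = m0 + 12 * \<eta>"
    using u(1) rho_ge_eps[OF \<epsilon>] \<epsilon> by (simp_all add: \<eta>_def field_simps)
  \<comment> \<open>Without the term \<open>dist Z t\<close> the truncated function would be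
    constant near \<open>Z\<close>, and its minimizer would not be unique.\<close>
  define g where "g t = max (f t) (m0 + \<eta> * (1 + dist Z t))" for t
  have gZ: "g Z = m0 + \<eta>" using \<eta>(2) by (simp add: g_def f_Z)
  have g_gt: "m0 + \<eta> < g t" if "t \<noteq> Z" for t
  proof -
    have "0 < \<eta> * dist Z t" using \<eta>(2) that by simp
    thus ?thesis by (simp add: g_def less_max_iff_disj distrib_left)
  qed
  have minZ: "is_minimizer g t \<longleftrightarrow> t = Z" for t
  proof
    assume "is_minimizer g t"
    hence "g t \<le> g Z" using Z by (simp add: is_minimizer_def)
    thus "t = Z" using g_gt[of t] gZ by force
  next
    assume "t = Z"
    moreover have "g Z \<le> g s" for s using g_gt[of s] gZ by (cases "s = Z") auto
    ultimately show "is_minimizer g t" using Z by (simp add: is_minimizer_def)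
  qed
  have "convex_on {0..1} g"
  proof (rule convex_onI)
    fix t x y :: real assume t: "0 < t" "t < 1" and xy: "x \<in> {0..1}" "y \<in> {0..1}"
    let ?p = "(1 - t) *\<^sub>R x + t *\<^sub>R y"
    have "f ?p \<le> (1 - t) * f x + t * f y" using convex_onD[OF conv _ _ xy] t by simp
    also have "\<dots> \<le> (1 - t) * g x + t * g y"
      using t by (intro add_mono mult_left_mono) (auto simp: g_def)
    finally have 1: "f ?p \<le> (1 - t) * g x + t * g y" .
    have "dist Z ?p \<le> (1 - t) * dist Z x + t * dist Z y"
      using convex_onD[OF convex_on_dist[of "UNIV :: real set" Z], of t x y] t by simp
    hence "\<eta> * dist Z ?p \<le> \<eta> * ((1 - t) * dist Z x + t * dist Z y)" using \<eta>(2) by (intro mult_left_mono) auto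
    hence "m0 + \<eta> * (1 + dist Z ?p) \<le> (1 - t) * (m0 + \<eta> * (1 + dist Z x)) + t * (m0 + \<eta> * (1 + dist Z y))"
      by (simp add: algebra_simps)
    also have "\<dots> \<le> (1 - t) * g x + t * g y"
      using t by (intro add_mono mult_left_mono) (auto simp: g_def)
    finally show "g ?p \<le> (1 - t) * g x + t * g y" using 1 by (simp add: g_def)
  qed simp
  moreover have "\<exists>!t. is_minimizer g t"
    by (rule ex1I[of _ Z]) (simp_all only: minZ)
  ultimately have g: "g \<in> conv_class" unfolding conv_class_def by (intro CollectI conjI)
  have min: "minimum g = m0 + \<eta>" by (simp add: minimum_def minimizer_def minZ gZ)
  have close: "(f t - g t)\<^sup>2 \<le> (gap u t)\<^sup>2 / 36" if t: "0 \<le> t" "t \<le> 1" for t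
  proof -
    have "dist Z t \<le> 1" using t Z by (simp add: dist_real_def)
    hence "\<eta> * dist Z t \<le> \<eta>" using \<eta>(2) by simp
    \<comment> \<open>The new floor is at most \<open>m + 2 * e\<close>, one sixth of the height
      \<open>12 * e\<close> of the truncation. Where the floor is active, the inequality reduces to
      \<open>5 * (m - x) \<le> 0\<close>; this is why \<eta> is a twelfth of
      \<open>u - m0\<close>.\<close>
    moreover have "\<bar>x - max x (m + (e + d))\<bar> \<le> \<bar>(x - max x (m + 12 * e)) / 6\<bar>"
      if "m \<le> x" "d \<le> e" "0 < e" for x m e d :: real
      using that by (cases "x \<le> m + 12 * e"; cases "x \<le> m + (e + d)") simp_all
    ultimately have "\<bar>f t - g t\<bar> \<le> \<bar>gap u t / 6\<bar>"
      using m0_le[OF t] \<eta>(2) by (simp add: g_def gap_def \<eta>(3) distrib_left)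
    hence "(f t - g t)\<^sup>2 \<le> (gap u t / 6)\<^sup>2" by (simp only: abs_le_square_iff)
    thus ?thesis by (simp add: power_divide)
  qed
  have gapi: "integrable lborel (\<lambda>t. indicator {0..1} t * ((gap u t)\<^sup>2 / 36))"
    using integrable_divide[OF gap_sq_integrable[of u], of 36] by simp
  have fg: "integrable lborel (\<lambda>t. indicator {0..1} t * (f t - g t)\<^sup>2)"
  proof (rule Bochner_Integration.integrable_bound[OF gapi])
    have "(\<lambda>t. (indicator {0..1} t * f t - indicator {0..1} t * g t)\<^sup>2) \<in> borel_measurable borel"
      using f_measurable convex_min.f_measurable[OF convex_min.intro[OF g]] by measurable
    also have "(\<lambda>t. (indicator {0..1} t * f t - indicator {0..1} t * g t)\<^sup>2) = (\<lambda>t. indicator {0..1} t * (f t - g t)\<^sup>2)"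
      by (auto simp: fun_eq_iff indicator_def)
    finally show "(\<lambda>t. indicator {0..1} t * (f t - g t)\<^sup>2) \<in> borel_measurable lborel" by simp
    show "AE t in lborel. norm (indicator {0..1} t * (f t - g t)\<^sup>2) \<le> norm (indicator {0..1} t * ((gap u t)\<^sup>2 / 36))"
      using close by (intro AE_I2) (auto simp: indicator_def)
  qed
  have "(\<integral>t. indicator {0..1} t * (f t - g t)\<^sup>2 \<partial>lborel) \<le> (\<integral>t. indicator {0..1} t * ((gap u t)\<^sup>2 / 36) \<partial>lborel)"
    using close by (intro integral_mono[OF fg gapi]) (auto simp: indicator_def)
  also have "\<dots> = (L2_norm (gap u))\<^sup>2 / 36"
  proof -
    have "0 \<le> (\<integral>t. indicator {0..1} t * (gap u t)\<^sup>2 \<partial>lborel)"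
      by (intro Bochner_Integration.integral_nonneg) simp
    thus ?thesis by (simp add: L2_norm_gap)
  qed
  also have "\<dots> \<le> \<epsilon>\<^sup>2 / 36"
    using u(2) by (intro divide_right_mono power_mono) (simp_all add: L2_norm_gap Bochner_Integration.integral_nonneg)
  finally show ?thesis
    using fg \<eta>(1) by (intro bexI[OF _ g] exI[of _ \<eta>]) (simp add: min set_integrable_def set_lebesgue_integral_def)
qed

end

text \<open>Norm at most \<open>\<epsilon> / 6\<close> gives the exponent \<open>1 / 36\<close>,
  small enough for total variation \<open>1 / 5\<close>.\<close>

lemma exp_inverse_36_le: "exp (1 / 36 :: real) \<le> 1 + (1 / 5)\<^sup>2"
proof -
  have "exp (1 / 36 :: real) \<le> 1 + 1 / 36 + (1 / 36)\<^sup>2" by (rule exp_bound) auto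
  thus ?thesis by (simp add: power2_eq_square)
qed

text \<open>An interval that contains both minima has length at least \<eta>. Under \<open>f\<close>
  this happens with probability at least \<open>(1 - \<alpha>) + (1 - \<alpha> - 1 / 5) - 1\<close>,
  which exceeds \<open>1 / 5\<close> precisely because \<alpha> is below 0.3. The constant 120 is 24
  times 5.\<close>

theorem (in min_ci) benchmark_lower:
  assumes \<alpha>: "\<alpha> < 0.3"
  shows "ennreal (rho_m \<epsilon> f / 120) \<le> benchmark M W \<alpha> \<epsilon> f"
proof -
  obtain g \<eta> where g: "g \<in> conv_class" and \<eta>: "rho_m \<epsilon> f / 24 \<le> \<eta>" and min: "minimum g = m0 + \<eta>"
    and sq: "set_integrable lborel {0..1} (\<lambda>t. (f t - g t)\<^sup>2)" and le: "(LBINT t:{0..1}. (f t - g t)\<^sup>2) \<le> \<epsilon>\<^sup>2 / 36"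
    using two_point[OF eps] by (elim bexE exE conjE)
  have \<eta>0: "0 < \<eta>" using \<eta> rho_ge_eps[OF eps] eps by simp
  let ?L = "expt_law M W \<epsilon>"
  have close: "measure (?L g) A \<le> measure (?L f) A + 1 / 5" if A: "A \<in> sets (path_space \<Otimes>\<^sub>M borel)" for A
  proof (rule W.expt_law_le[OF eps _ _ _ _ _ A])
    have c: "(\<lambda>t. (g t - f t)\<^sup>2) = (\<lambda>t. (f t - g t)\<^sup>2)" by (simp add: fun_eq_iff power2_commute)
    show "set_integrable lborel {0..1} (\<lambda>t. (g t - f t)\<^sup>2)" unfolding c by (rule sq)
    have "(LBINT t:{0..1}. (f t - g t)\<^sup>2) / \<epsilon>\<^sup>2 \<le> 1 / 36" using le eps by (simp add: field_simps)
    thus "exp ((LBINT t:{0..1}. (g t - f t)\<^sup>2) / \<epsilon>\<^sup>2) \<le> 1 + (1 / 5)\<^sup>2"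
      unfolding c using exp_inverse_36_le by (meson exp_le_cancel_iff order_trans)
    show "set_integrable lborel {0..1} f" by (rule f_integrable) simp_all
    show "set_integrable lborel {0..1} g" by (rule convex_min.f_integrable[OF convex_min.intro[OF g]]) simp_all
  qed simp
  have "ennreal (rho_m \<epsilon> f / 120) \<le> (\<integral>\<^sup>+ x. interval_length (CI x) \<partial>?L f)"
    if CI: "CI \<in> conf_intervals M W \<alpha> \<epsilon> {f, g}" for CI
  proof -
    interpret L: prob_space "?L f" by (rule W.prob_space_expt_law)
    obtain lo hi where lh[measurable]: "lo \<in> borel_measurable (path_space \<Otimes>\<^sub>M borel)" "hi \<in> borel_measurable (path_space \<Otimes>\<^sub>M borel)"
      and CIeq: "CI = (\<lambda>x. {lo x..hi x})"
      and cov: "\<And>h. h \<in> {f, g} \<Longrightarrow> 1 - \<alpha> \<le> measure (?L h) {x \<in> space (?L h). minimum h \<in> CI x}"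
      using CI unfolding conf_intervals_def by blast
    have sp: "space (?L h) = space (path_space \<Otimes>\<^sub>M borel)" for h
      by (rule sets_eq_imp_space_eq[OF W.sets_expt_law])
    define A where "A m = {x \<in> space (path_space \<Otimes>\<^sub>M borel). lo x \<le> m \<and> m \<le> hi x}" for m
    have Am: "A m \<in> sets (path_space \<Otimes>\<^sub>M borel)" for m unfolding A_def by measurable
    have Am': "A m \<in> L.events" for m using Am W.sets_expt_law[of \<epsilon> f] by simp
    have "1 - \<alpha> \<le> L.prob (A m0)" using cov[of f] by (simp add: CIeq sp A_def m0_def)
    moreover have "1 - \<alpha> \<le> L.prob (A (m0 + \<eta>)) + 1 / 5"
      using cov[of g] close[OF Am, of "m0 + \<eta>"] by (simp add: CIeq sp A_def min)
    moreover have "L.prob (A m0) + L.prob (A (m0 + \<eta>)) \<le> L.prob (A m0 \<inter> A (m0 + \<eta>)) + 1"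
      using L.finite_measure_Union'[OF Am' Am', of m0 "m0 + \<eta>"] L.finite_measure_Diff'[OF Am' Am', of "m0 + \<eta>" m0]
        L.prob_le_1[of "A m0 \<union> A (m0 + \<eta>)"] by (simp add: Int_commute)
    ultimately have p: "1 / 5 \<le> L.prob (A m0 \<inter> A (m0 + \<eta>))" using \<alpha> by simp
    have "ennreal (rho_m \<epsilon> f / 120) \<le> ennreal (\<eta> * (1 / 5))" using \<eta> by (intro ennreal_leI) simp
    also have "\<dots> = ennreal \<eta> * ennreal (1 / 5)" using \<eta>0 by (intro ennreal_mult) simp_all
    also have "\<dots> \<le> ennreal \<eta> * emeasure (?L f) (A m0 \<inter> A (m0 + \<eta>))"
      using p by (intro mult_left_mono) (auto simp: L.emeasure_eq_measure intro: ennreal_leI)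
    also have "\<dots> = (\<integral>\<^sup>+ x. ennreal \<eta> * indicator (A m0 \<inter> A (m0 + \<eta>)) x \<partial>?L f)"
      using Am' by (intro nn_integral_cmult_indicator[symmetric]) auto
    also have "\<dots> \<le> (\<integral>\<^sup>+ x. interval_length (CI x) \<partial>?L f)"
    proof (rule nn_integral_mono)
      fix x
      show "ennreal \<eta> * indicator (A m0 \<inter> A (m0 + \<eta>)) x \<le> interval_length (CI x)"
      proof (cases "x \<in> A m0 \<inter> A (m0 + \<eta>)")
        case True
        hence "\<eta> \<le> hi x - lo x" by (simp add: A_def)
        thus ?thesis using True \<eta>0 by (simp add: CIeq interval_length_def emeasure_lborel_Icc_eq ennreal_leI)
      qed simp
    qed
    finally show ?thesis .
  qed
  thus ?thesis unfolding benchmark_def by (intro SUP_upper2[OF g] INF_greatest)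
qed

theorem theorem3p4:
  fixes \<alpha> :: real
  assumes "0 < \<alpha>" and "\<alpha> < 1"
  shows "(\<forall>(M :: 'a measure) W B1 B2 \<epsilon> f.
            white_noise_model M W B1 B2 \<and> 0 < \<epsilon> \<and> f \<in> conv_class \<longrightarrow>
              1 - \<alpha> \<le> measure M {\<omega> \<in> space M. minimum f \<in> CI_random W B1 B2 \<alpha> \<epsilon> f \<omega>})
       \<and> (\<alpha> < 0.3 \<longrightarrow>
           (\<exists>c > 0. \<exists>C > 0. \<forall>(M :: 'a measure) W B1 B2 \<epsilon> f.
              white_noise_model M W B1 B2 \<and> 0 < \<epsilon> \<and> f \<in> conv_class \<longrightarrow>
                (\<integral>\<^sup>+ \<omega>. interval_length (CI_random W B1 B2 \<alpha> \<epsilon> f \<omega>) \<partial>M) \<le> ennreal (c * rho_m \<epsilon> f) \<and>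
                ennreal (c * rho_m \<epsilon> f) \<le> ennreal C * benchmark M W \<alpha> \<epsilon> f))"
proof (rule conjI)
  have loc: "min_ci M W B1 B2 f \<epsilon>" if "white_noise_model M W B1 B2 \<and> 0 < \<epsilon> \<and> f \<in> conv_class"
    for M :: "'a measure" and W B1 B2 \<epsilon> f
    using that by (intro min_ci.intro convex_min.intro min_ci_axioms.intro) auto
  show "\<forall>(M :: 'a measure) W B1 B2 \<epsilon> f.
            white_noise_model M W B1 B2 \<and> 0 < \<epsilon> \<and> f \<in> conv_class \<longrightarrow>
              1 - \<alpha> \<le> measure M {\<omega> \<in> space M. minimum f \<in> CI_random W B1 B2 \<alpha> \<epsilon> f \<omega>}"
    by (intro allI impI) (rule min_ci.coverage[OF loc assms])
  define c where "c = 96 * len_const \<alpha>"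
  have c: "0 < c" using len_const_pos[of \<alpha>] by (simp add: c_def)
  have "(\<integral>\<^sup>+ \<omega>. interval_length (CI_random W B1 B2 \<alpha> \<epsilon> f \<omega>) \<partial>M) \<le> ennreal (c * rho_m \<epsilon> f) \<and>
        ennreal (c * rho_m \<epsilon> f) \<le> ennreal (120 * c) * benchmark M W \<alpha> \<epsilon> f"
    if "\<alpha> < 0.3" and m: "white_noise_model M W B1 B2 \<and> 0 < \<epsilon> \<and> f \<in> conv_class"
    for M :: "'a measure" and W B1 B2 \<epsilon> f
  proof
    show "(\<integral>\<^sup>+ \<omega>. interval_length (CI_random W B1 B2 \<alpha> \<epsilon> f \<omega>) \<partial>M) \<le> ennreal (c * rho_m \<epsilon> f)"
      unfolding c_def by (rule min_ci.expected_length[OF loc[OF m]])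
    have "ennreal (c * rho_m \<epsilon> f) = ennreal (120 * c) * ennreal (rho_m \<epsilon> f / 120)"
      using c by (simp add: ennreal_mult'[symmetric])
    also have "\<dots> \<le> ennreal (120 * c) * benchmark M W \<alpha> \<epsilon> f"
      by (intro mult_left_mono min_ci.benchmark_lower[OF loc[OF m] that(1)]) simp
    finally show "ennreal (c * rho_m \<epsilon> f) \<le> ennreal (120 * c) * benchmark M W \<alpha> \<epsilon> f" .
  qed
  thus "\<alpha> < 0.3 \<longrightarrow>
           (\<exists>c > 0. \<exists>C > 0. \<forall>(M :: 'a measure) W B1 B2 \<epsilon> f.
              white_noise_model M W B1 B2 \<and> 0 < \<epsilon> \<and> f \<in> conv_class \<longrightarrow>
                (\<integral>\<^sup>+ \<omega>. interval_length (CI_random W B1 B2 \<alpha> \<epsilon> f \<omega>) \<partial>M) \<le> ennreal (c * rho_m \<epsilon> f) \<and>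
                ennreal (c * rho_m \<epsilon> f) \<le> ennreal C * benchmark M W \<alpha> \<epsilon> f)"
    by (intro impI exI[of _ c] conjI exI[of _ "120 * c"] allI) (use c in \<open>simp\<close>, use c in \<open>simp\<close>, blast+)
qed

end
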